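(* Let $M$ be a compact Kähler-Einstein manifold and let $K$ be a compact connected semisimple group of isometries of $M$ acting in a Hamiltonian fashion. Then a Lagrangian $K$-orbit in $M$ is a minimal submanifold of $M$.
   Context: Let $(M,\omega,J)$ be a compact Kähler manifold of real dimension $2n$. A submanifold is Lagrangian if it has real dimension $n$ and $\omega$ vanishes on it; it is minimal if its mean curvature vector vanishes identically. The action of $K$ is Hamiltonian if there is a smooth map $\mu:M\to\mathfrak{k}^*$, $\mathfrak{k}=\mathrm{Lie}(K)$, equivariant for the coadjoint action, with $d\mu_p(v)(X)=\omega_p(v,\widehat{X}_p)$ for all $p\in M$, $v\in T_pM$, $X\in\mathfrak{k}$, where $\widehat{X}$ is the fundamental vector field of $X$. *)

theory Defs
  imports "HOL-Analysis.Analysis"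
begin

section \<open>Smooth maps between open subsets of vector spaces\<close>

text \<open>Only used for open \<open>S\<close> in a finite-dimensional domain; there continuity of all iterated
  directional derivatives up to order \<open>k\<close> is the usual notion of class \<open>C\<^sup>k\<close>.\<close>

primrec Ck_on :: "nat \<Rightarrow> 'a::real_normed_vector set \<Rightarrow> ('a \<Rightarrow> 'b::real_normed_vector) \<Rightarrow> bool" where
  "Ck_on 0 S f \<longleftrightarrow> continuous_on S f"
| "Ck_on (Suc k) S f \<longleftrightarrow> (\<forall>x\<in>S. f differentiable (at x)) \<and>
     (\<forall>v. Ck_on k S (\<lambda>x. frechet_derivative f (at x) v))"

definition smooth_on :: "'a::real_normed_vector set \<Rightarrow> ('a \<Rightarrow> 'b::real_normed_vector) \<Rightarrow> bool" where
  "smooth_on S f \<longleftrightarrow> (\<forall>k. Ck_on k S f)"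


section \<open>Smooth manifolds\<close>

text \<open>The underlying space of a manifold is a type. A chart is a pair of an open domain and a map
  into the model space (values outside the domain are irrelevant); an atlas is a set of pairwise
  smoothly compatible charts, not required to be maximal.\<close>

type_synonym ('m, 'e) chart = "'m set \<times> ('m \<Rightarrow> 'e)"

abbreviation cdom :: "('m, 'e) chart \<Rightarrow> 'm set" where "cdom \<equiv> fst"
abbreviation cmap :: "('m, 'e) chart \<Rightarrow> 'm \<Rightarrow> 'e" where "cmap \<equiv> snd"

definition cinv :: "('m, 'e) chart \<Rightarrow> 'e \<Rightarrow> 'm" where
  "cinv c = inv_into (cdom c) (cmap c)"

definition is_chart :: "('m::topological_space, 'e::real_normed_vector) chart \<Rightarrow> bool" where
  "is_chart c \<longleftrightarrow> open (cdom c) \<and> open (cmap c ` cdom c) \<and>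
     homeomorphism (cdom c) (cmap c ` cdom c) (cmap c) (cinv c)"

definition smooth_transition :: "('m, 'e::real_normed_vector) chart \<Rightarrow> ('m, 'e) chart \<Rightarrow> bool" where
  "smooth_transition c d \<longleftrightarrow> smooth_on (cmap c ` (cdom c \<inter> cdom d)) (cmap d \<circ> cinv c)"

definition smooth_atlas :: "('m::topological_space, 'e::euclidean_space) chart set \<Rightarrow> bool" where
  "smooth_atlas A \<longleftrightarrow> (\<Union>c\<in>A. cdom c) = UNIV \<and> (\<forall>c\<in>A. is_chart c) \<and>
     (\<forall>c\<in>A. \<forall>d\<in>A. smooth_transition c d)"

definition compatible_chart ::
    "('m::topological_space, 'e::real_normed_vector) chart set \<Rightarrow> ('m, 'e) chart \<Rightarrow> bool" where
  "compatible_chart A c \<longleftrightarrow> is_chart c \<and>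
     (\<forall>d\<in>A. smooth_transition c d \<and> smooth_transition d c)"

definition vector_atlas :: "('v, 'v) chart set" where
  "vector_atlas = {(UNIV, \<lambda>x. x)}"

definition prod_atlas ::
    "('m, 'e) chart set \<Rightarrow> ('n, 'f) chart set \<Rightarrow> ('m \<times> 'n, 'e \<times> 'f) chart set" where
  "prod_atlas A B = (\<lambda>(c, d). (cdom c \<times> cdom d, map_prod (cmap c) (cmap d))) ` (A \<times> B)"

definition smooth_map_on :: "('m::topological_space, 'e::real_normed_vector) chart set \<Rightarrow>
    ('n::topological_space, 'f::real_normed_vector) chart set \<Rightarrow> 'm set \<Rightarrow> ('m \<Rightarrow> 'n) \<Rightarrow> bool" where
  "smooth_map_on A B S f \<longleftrightarrow> continuous_on S f \<and>
     (\<forall>c\<in>A. \<forall>d\<in>B. smooth_on (cmap c ` (cdom c \<inter> S \<inter> f -` cdom d)) (cmap d \<circ> f \<circ> cinv c))"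

abbreviation smooth_map :: "('m::topological_space, 'e::real_normed_vector) chart set \<Rightarrow>
    ('n::topological_space, 'f::real_normed_vector) chart set \<Rightarrow> ('m \<Rightarrow> 'n) \<Rightarrow> bool" where
  "smooth_map A B \<equiv> smooth_map_on A B UNIV"


section \<open>Tangent vectors\<close>

text \<open>Every point has a preferred chart of the atlas, and the tangent space at \<open>p\<close> is the model
  space, a vector standing for its components in the preferred chart at \<open>p\<close>. Accordingly, \<open>mderiv\<close>
  is the differential of a map, expressed in the preferred charts at a point and at its image.\<close>

definition chart_at :: "('m, 'e) chart set \<Rightarrow> 'm \<Rightarrow> ('m, 'e) chart" where
  "chart_at A p = (SOME c. c \<in> A \<and> p \<in> cdom c)"

definition mderiv :: "('m, 'e::real_normed_vector) chart set \<Rightarrow>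
    ('n, 'f::real_normed_vector) chart set \<Rightarrow> ('m \<Rightarrow> 'n) \<Rightarrow> 'm \<Rightarrow> 'e \<Rightarrow> 'f" where
  "mderiv A B f p =
     frechet_derivative (cmap (chart_at B (f p)) \<circ> f \<circ> cinv (chart_at A p)) (at (cmap (chart_at A p) p))"

text \<open>\<open>chart_vec A c x u\<close> is the tangent vector at \<open>cinv c x\<close> with components \<open>u\<close> in the chart
  \<open>c\<close>; \<open>field_comp A c V\<close> is the component function of a vector field \<open>V\<close> in the chart \<open>c\<close>.\<close>

definition chart_vec ::
    "('m, 'e::real_normed_vector) chart set \<Rightarrow> ('m, 'e) chart \<Rightarrow> 'e \<Rightarrow> 'e \<Rightarrow> 'e" where
  "chart_vec A c x u = mderiv vector_atlas A (cinv c) x u"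

definition field_comp ::
    "('m, 'e::real_normed_vector) chart set \<Rightarrow> ('m, 'e) chart \<Rightarrow> ('m \<Rightarrow> 'e) \<Rightarrow> 'e \<Rightarrow> 'e" where
  "field_comp A c V x = mderiv A vector_atlas (cmap c) (cinv c x) (V (cinv c x))"

definition smooth_field_on ::
    "('m, 'e::real_normed_vector) chart set \<Rightarrow> 'm set \<Rightarrow> ('m \<Rightarrow> 'e) \<Rightarrow> bool" where
  "smooth_field_on A W V \<longleftrightarrow> (\<forall>c\<in>A. smooth_on (cmap c ` (cdom c \<inter> W)) (field_comp A c V))"

definition field_bracket :: "('m, 'e::real_normed_vector) chart set \<Rightarrow>
    ('m \<Rightarrow> 'e) \<Rightarrow> ('m \<Rightarrow> 'e) \<Rightarrow> 'm \<Rightarrow> 'e" where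
  "field_bracket A V W p =
     (let c = chart_at A p; x = cmap c p in
        frechet_derivative (field_comp A c W) (at x) (V p) -
        frechet_derivative (field_comp A c V) (at x) (W p))"


section \<open>Riemannian metrics, Levi-Civita connection, Ricci tensor\<close>

text \<open>For a field of bilinear forms \<open>b\<close>, \<open>form_comp A c b x u v\<close> is the value at \<open>cinv c x\<close> on the
  vectors with components \<open>u\<close>, \<open>v\<close> in the chart \<open>c\<close>.\<close>

definition form_comp :: "('m, 'e::real_normed_vector) chart set \<Rightarrow> ('m, 'e) chart \<Rightarrow>
    ('m \<Rightarrow> 'e \<Rightarrow> 'e \<Rightarrow> real) \<Rightarrow> 'e \<Rightarrow> 'e \<Rightarrow> 'e \<Rightarrow> real" where
  "form_comp A c b x u v = b (cinv c x) (chart_vec A c x u) (chart_vec A c x v)"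

definition riemannian_metric ::
    "('m, 'e::real_normed_vector) chart set \<Rightarrow> ('m \<Rightarrow> 'e \<Rightarrow> 'e \<Rightarrow> real) \<Rightarrow> bool" where
  "riemannian_metric A g \<longleftrightarrow>
     (\<forall>p. bilinear (g p)) \<and> (\<forall>p u v. g p u v = g p v u) \<and> (\<forall>p u. u \<noteq> 0 \<longrightarrow> g p u u > 0) \<and>
     (\<forall>c\<in>A. \<forall>u v. smooth_on (cmap c ` cdom c) (\<lambda>x. form_comp A c g x u v))"

text \<open>\<open>christoffel A g c x u v\<close> has the components of \<open>\<nabla>\<^sub>u v\<close> at \<open>cinv c x\<close>, where \<open>u\<close> and \<open>v\<close> are
  constant coordinate fields of the chart \<open>c\<close>: torsion-freeness is symmetry, and the second
  condition is compatibility with the metric.\<close>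

definition christoffel :: "('m, 'e::real_normed_vector) chart set \<Rightarrow> ('m \<Rightarrow> 'e \<Rightarrow> 'e \<Rightarrow> real) \<Rightarrow>
    ('m, 'e) chart \<Rightarrow> 'e \<Rightarrow> 'e \<Rightarrow> 'e \<Rightarrow> 'e" where
  "christoffel A g c x = (THE \<Gamma>. (\<forall>u v. \<Gamma> u v = \<Gamma> v u) \<and>
     (\<forall>u v w. frechet_derivative (\<lambda>y. form_comp A c g y v w) (at x) u =
        form_comp A c g x (\<Gamma> u v) w + form_comp A c g x v (\<Gamma> u w)))"

text \<open>\<open>\<nabla>\<^sub>u V\<close> at \<open>p\<close>\<close>

definition cov_deriv :: "('m, 'e::real_normed_vector) chart set \<Rightarrow> ('m \<Rightarrow> 'e \<Rightarrow> 'e \<Rightarrow> real) \<Rightarrow>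
    ('m \<Rightarrow> 'e) \<Rightarrow> 'm \<Rightarrow> 'e \<Rightarrow> 'e" where
  "cov_deriv A g V p u =
     (let c = chart_at A p; x = cmap c p in
        frechet_derivative (field_comp A c V) (at x) u + christoffel A g c x u (V p))"

text \<open>\<open>R(u,v)w = \<nabla>\<^sub>u \<nabla>\<^sub>v w - \<nabla>\<^sub>v \<nabla>\<^sub>u w\<close> for constant coordinate fields, and
  \<open>Ric(v,w)\<close> is the trace of \<open>u \<mapsto> R(u,v)w\<close>.\<close>

definition curvature :: "('m, 'e::real_normed_vector) chart set \<Rightarrow> ('m \<Rightarrow> 'e \<Rightarrow> 'e \<Rightarrow> real) \<Rightarrow>
    'm \<Rightarrow> 'e \<Rightarrow> 'e \<Rightarrow> 'e \<Rightarrow> 'e" where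
  "curvature A g p u v w =
     (let c = chart_at A p; x = cmap c p; \<Gamma> = christoffel A g c in
        frechet_derivative (\<lambda>y. \<Gamma> y v w) (at x) u - frechet_derivative (\<lambda>y. \<Gamma> y u w) (at x) v
        + \<Gamma> x u (\<Gamma> x v w) - \<Gamma> x v (\<Gamma> x u w))"

definition ricci :: "('m, 'e::euclidean_space) chart set \<Rightarrow> ('m \<Rightarrow> 'e \<Rightarrow> 'e \<Rightarrow> real) \<Rightarrow>
    'm \<Rightarrow> 'e \<Rightarrow> 'e \<Rightarrow> real" where
  "ricci A g p v w = (\<Sum>b\<in>Basis. curvature A g p b v w \<bullet> b)"

definition einstein_metric ::
    "('m, 'e::euclidean_space) chart set \<Rightarrow> ('m \<Rightarrow> 'e \<Rightarrow> 'e \<Rightarrow> real) \<Rightarrow> bool" where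
  "einstein_metric A g \<longleftrightarrow> (\<exists>k::real. \<forall>p u v. ricci A g p u v = k * g p u v)"

definition isometry :: "('m::topological_space, 'e::real_normed_vector) chart set \<Rightarrow>
    ('m \<Rightarrow> 'e \<Rightarrow> 'e \<Rightarrow> real) \<Rightarrow> ('m \<Rightarrow> 'm) \<Rightarrow> bool" where
  "isometry A g f \<longleftrightarrow> bij f \<and> smooth_map A A f \<and> smooth_map A A (inv f) \<and>
     (\<forall>p u v. g (f p) (mderiv A A f p u) (mderiv A A f p v) = g p u v)"


section \<open>Submanifolds\<close>

definition embedded_submanifold ::
    "('m::topological_space, 'e::euclidean_space) chart set \<Rightarrow> nat \<Rightarrow> 'm set \<Rightarrow> bool" where
  "embedded_submanifold A k L \<longleftrightarrow>
     (\<forall>q\<in>L. \<exists>c S. compatible_chart A c \<and> q \<in> cdom c \<and> subspace S \<and> dim S = k \<and>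
        cmap c ` (cdom c \<inter> L) = cmap c ` cdom c \<inter> S)"

text \<open>Velocities at \<open>q\<close> of smooth curves in \<open>L\<close>\<close>

definition tangent_space_of ::
    "('m::topological_space, 'e::real_normed_vector) chart set \<Rightarrow> 'm set \<Rightarrow> 'm \<Rightarrow> 'e set" where
  "tangent_space_of A L q = {v. \<exists>\<gamma> \<epsilon>::real. \<epsilon> > 0 \<and> smooth_map_on vector_atlas A {-\<epsilon><..<\<epsilon>} \<gamma> \<and>
     (\<forall>t\<in>{-\<epsilon><..<\<epsilon>}. \<gamma> t \<in> L) \<and> \<gamma> 0 = q \<and> v = mderiv vector_atlas A \<gamma> 0 1}"

definition normal_part :: "('e::real_vector \<Rightarrow> 'e \<Rightarrow> real) \<Rightarrow> 'e set \<Rightarrow> 'e \<Rightarrow> 'e" where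
  "normal_part b T w = (THE z. w - z \<in> T \<and> (\<forall>t\<in>T. b z t = 0))"

text \<open>\<open>II(u,v) = (\<nabla>\<^sub>u V)\<^sup>\<bottom>\<close>, where \<open>V\<close> is any smooth field near \<open>q\<close> that is tangent to \<open>L\<close> along \<open>L\<close>
  and extends \<open>v\<close>; for \<open>u\<close>, \<open>v\<close> tangent to \<open>L\<close> the result does not depend on \<open>V\<close>.\<close>

definition second_fundamental_form :: "('m::topological_space, 'e::real_normed_vector) chart set \<Rightarrow>
    ('m \<Rightarrow> 'e \<Rightarrow> 'e \<Rightarrow> real) \<Rightarrow> 'm set \<Rightarrow> 'm \<Rightarrow> 'e \<Rightarrow> 'e \<Rightarrow> 'e" where
  "second_fundamental_form A g L q u v = (THE w. \<exists>W V. open W \<and> q \<in> W \<and> smooth_field_on A W V \<and>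
     (\<forall>r\<in>L \<inter> W. V r \<in> tangent_space_of A L r) \<and> V q = v \<and>
     w = normal_part (g q) (tangent_space_of A L q) (cov_deriv A g V q u))"

definition orthonormal_basis :: "('e::real_vector \<Rightarrow> 'e \<Rightarrow> real) \<Rightarrow> 'e set \<Rightarrow> 'e set \<Rightarrow> bool" where
  "orthonormal_basis b T E \<longleftrightarrow> finite E \<and> span E = T \<and>
     (\<forall>u\<in>E. \<forall>v\<in>E. b u v = (if u = v then 1 else 0))"

text \<open>Trace of the second fundamental form; as that form is bilinear, the choice of the orthonormal
  basis is immaterial. A normalising factor is omitted.\<close>

definition mean_curvature :: "('m::topological_space, 'e::real_normed_vector) chart set \<Rightarrow>
    ('m \<Rightarrow> 'e \<Rightarrow> 'e \<Rightarrow> real) \<Rightarrow> 'm set \<Rightarrow> 'm \<Rightarrow> 'e" where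
  "mean_curvature A g L q =
     (\<Sum>e\<in>(SOME E. orthonormal_basis (g q) (tangent_space_of A L q) E).
        second_fundamental_form A g L q e e)"

definition minimal_submanifold :: "('m::topological_space, 'e::euclidean_space) chart set \<Rightarrow>
    ('m \<Rightarrow> 'e \<Rightarrow> 'e \<Rightarrow> real) \<Rightarrow> 'm set \<Rightarrow> bool" where
  "minimal_submanifold A g L \<longleftrightarrow>
     (\<exists>k. embedded_submanifold A k L) \<and> (\<forall>q\<in>L. mean_curvature A g L q = 0)"


section \<open>Kaehler manifolds\<close>

text \<open>Complex manifolds of complex dimension \<open>CARD('n)\<close>: transition maps have complex-linear
  derivatives. Since the preferred charts are holomorphic, the complex structure \<open>J\<close> is
  multiplication by \<open>\<i>\<close> on every tangent space.\<close>

definition complex_atlas :: "('m::topological_space, complex ^ 'n) chart set \<Rightarrow> bool" where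
  "complex_atlas A \<longleftrightarrow> smooth_atlas A \<and>
     (\<forall>c\<in>A. \<forall>d\<in>A. \<forall>x\<in>cmap c ` (cdom c \<inter> cdom d). \<forall>u.
        frechet_derivative (cmap d \<circ> cinv c) (at x) (\<i> *s u) =
        \<i> *s frechet_derivative (cmap d \<circ> cinv c) (at x) u)"

definition kaehler_form ::
    "('m \<Rightarrow> complex ^ 'n \<Rightarrow> complex ^ 'n \<Rightarrow> real) \<Rightarrow> 'm \<Rightarrow> complex ^ 'n \<Rightarrow> complex ^ 'n \<Rightarrow> real" where
  "kaehler_form g p u v = g p (\<i> *s u) v"

definition closed_2form ::
    "('m, 'e::real_normed_vector) chart set \<Rightarrow> ('m \<Rightarrow> 'e \<Rightarrow> 'e \<Rightarrow> real) \<Rightarrow> bool" where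
  "closed_2form A \<omega> \<longleftrightarrow> (\<forall>c\<in>A. \<forall>x\<in>cmap c ` cdom c. \<forall>u v w.
     frechet_derivative (\<lambda>y. form_comp A c \<omega> y v w) (at x) u +
     frechet_derivative (\<lambda>y. form_comp A c \<omega> y w u) (at x) v +
     frechet_derivative (\<lambda>y. form_comp A c \<omega> y u v) (at x) w = 0)"

definition kaehler_manifold :: "('m::topological_space, complex ^ 'n) chart set \<Rightarrow>
    ('m \<Rightarrow> complex ^ 'n \<Rightarrow> complex ^ 'n \<Rightarrow> real) \<Rightarrow> bool" where
  "kaehler_manifold A g \<longleftrightarrow> complex_atlas A \<and> riemannian_metric A g \<and>
     (\<forall>p u v. g p (\<i> *s u) (\<i> *s v) = g p u v) \<and> closed_2form A (kaehler_form g)"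

definition lagrangian_submanifold :: "('m::topological_space, complex ^ 'n) chart set \<Rightarrow>
    ('m \<Rightarrow> complex ^ 'n \<Rightarrow> complex ^ 'n \<Rightarrow> real) \<Rightarrow> 'm set \<Rightarrow> bool" where
  "lagrangian_submanifold A g L \<longleftrightarrow> embedded_submanifold A CARD('n) L \<and>
     (\<forall>q\<in>L. \<forall>u\<in>tangent_space_of A L q. \<forall>v\<in>tangent_space_of A L q. kaehler_form g q u v = 0)"


section \<open>Lie groups and semisimplicity\<close>

definition lie_group :: "('k::topological_space, 'f::euclidean_space) chart set \<Rightarrow>
    ('k \<Rightarrow> 'k \<Rightarrow> 'k) \<Rightarrow> 'k \<Rightarrow> ('k \<Rightarrow> 'k) \<Rightarrow> bool" where
  "lie_group B mul e iv \<longleftrightarrow> group mul e iv \<and> smooth_atlas B \<and>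
     smooth_map (prod_atlas B B) B (\<lambda>(a, b). mul a b) \<and> smooth_map B B iv"

text \<open>The Lie algebra is the tangent space at \<open>e\<close>, with the bracket of left-invariant fields.\<close>

definition left_invariant_field :: "('k, 'f::real_normed_vector) chart set \<Rightarrow>
    ('k \<Rightarrow> 'k \<Rightarrow> 'k) \<Rightarrow> 'k \<Rightarrow> 'f \<Rightarrow> 'k \<Rightarrow> 'f" where
  "left_invariant_field B mul e X a = mderiv B B (mul a) e X"

definition lie_bracket :: "('k, 'f::real_normed_vector) chart set \<Rightarrow>
    ('k \<Rightarrow> 'k \<Rightarrow> 'k) \<Rightarrow> 'k \<Rightarrow> 'f \<Rightarrow> 'f \<Rightarrow> 'f" where
  "lie_bracket B mul e X Y =
     field_bracket B (left_invariant_field B mul e X) (left_invariant_field B mul e Y) e"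

definition Ad :: "('k, 'f::real_normed_vector) chart set \<Rightarrow>
    ('k \<Rightarrow> 'k \<Rightarrow> 'k) \<Rightarrow> 'k \<Rightarrow> ('k \<Rightarrow> 'k) \<Rightarrow> 'k \<Rightarrow> 'f \<Rightarrow> 'f" where
  "Ad B mul e iv a X = mderiv B B (\<lambda>h. mul (mul a h) (iv a)) e X"

definition lie_ideal :: "('f::real_vector \<Rightarrow> 'f \<Rightarrow> 'f) \<Rightarrow> 'f set \<Rightarrow> bool" where
  "lie_ideal br I \<longleftrightarrow> subspace I \<and> (\<forall>X\<in>I. \<forall>Y. br X Y \<in> I)"

primrec derived_series :: "('f::real_vector \<Rightarrow> 'f \<Rightarrow> 'f) \<Rightarrow> 'f set \<Rightarrow> nat \<Rightarrow> 'f set" where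
  "derived_series br I 0 = I"
| "derived_series br I (Suc n) =
     span {br X Y |X Y. X \<in> derived_series br I n \<and> Y \<in> derived_series br I n}"

definition semisimple_lie_algebra :: "('f::real_vector \<Rightarrow> 'f \<Rightarrow> 'f) \<Rightarrow> bool" where
  "semisimple_lie_algebra br \<longleftrightarrow>
     (\<forall>I. lie_ideal br I \<and> (\<exists>n. derived_series br I n = {0}) \<longrightarrow> I = {0})"


section \<open>Isometric and Hamiltonian actions\<close>

text \<open>A Lie group of isometries: it acts smoothly and effectively by isometries.\<close>

definition isometric_action :: "('k::topological_space, 'f::euclidean_space) chart set \<Rightarrow>
    ('k \<Rightarrow> 'k \<Rightarrow> 'k) \<Rightarrow> 'k \<Rightarrow> ('m::topological_space, 'e::euclidean_space) chart set \<Rightarrow>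
    ('m \<Rightarrow> 'e \<Rightarrow> 'e \<Rightarrow> real) \<Rightarrow> ('k \<Rightarrow> 'm \<Rightarrow> 'm) \<Rightarrow> bool" where
  "isometric_action B mul e A g act \<longleftrightarrow>
     (\<forall>p. act e p = p) \<and> (\<forall>a b p. act (mul a b) p = act a (act b p)) \<and>
     smooth_map (prod_atlas B A) A (\<lambda>(a, p). act a p) \<and>
     (\<forall>a. isometry A g (act a)) \<and>
     (\<forall>a. (\<forall>p. act a p = p) \<longrightarrow> a = e)"

definition fundamental_field :: "('k, 'f::real_normed_vector) chart set \<Rightarrow> 'k \<Rightarrow>
    ('m, 'e::real_normed_vector) chart set \<Rightarrow> ('k \<Rightarrow> 'm \<Rightarrow> 'm) \<Rightarrow> 'f \<Rightarrow> 'm \<Rightarrow> 'e" where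
  "fundamental_field B e A act X p = mderiv B A (\<lambda>a. act a p) e X"

text \<open>The coadjoint action is \<open>(Ad\<^sup>*(a) \<xi>)(X) = \<xi>(Ad(a\<^sup>-\<^sup>1) X)\<close>.\<close>

definition moment_map :: "('k, 'f::euclidean_space) chart set \<Rightarrow>
    ('k \<Rightarrow> 'k \<Rightarrow> 'k) \<Rightarrow> 'k \<Rightarrow> ('k \<Rightarrow> 'k) \<Rightarrow>
    ('m::topological_space, 'e::euclidean_space) chart set \<Rightarrow> ('m \<Rightarrow> 'e \<Rightarrow> 'e \<Rightarrow> real) \<Rightarrow>
    ('k \<Rightarrow> 'm \<Rightarrow> 'm) \<Rightarrow> ('m \<Rightarrow> ('f \<Rightarrow>\<^sub>L real)) \<Rightarrow> bool" where
  "moment_map B mul e iv A \<omega> act \<mu> \<longleftrightarrow>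
     smooth_map A vector_atlas \<mu> \<and>
     (\<forall>a p X. blinfun_apply (\<mu> (act a p)) X = blinfun_apply (\<mu> p) (Ad B mul e iv (iv a) X)) \<and>
     (\<forall>p v X. blinfun_apply (mderiv A vector_atlas \<mu> p v) X =
        \<omega> p v (fundamental_field B e A act X p))"

definition hamiltonian_action :: "('k, 'f::euclidean_space) chart set \<Rightarrow>
    ('k \<Rightarrow> 'k \<Rightarrow> 'k) \<Rightarrow> 'k \<Rightarrow> ('k \<Rightarrow> 'k) \<Rightarrow>
    ('m::topological_space, 'e::euclidean_space) chart set \<Rightarrow> ('m \<Rightarrow> 'e \<Rightarrow> 'e \<Rightarrow> real) \<Rightarrow>
    ('k \<Rightarrow> 'm \<Rightarrow> 'm) \<Rightarrow> bool" where
  "hamiltonian_action B mul e iv A \<omega> act \<longleftrightarrow> (\<exists>\<mu>. moment_map B mul e iv A \<omega> act \<mu>)"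

definition orbit :: "('k \<Rightarrow> 'm \<Rightarrow> 'm) \<Rightarrow> 'm \<Rightarrow> 'm set" where
  "orbit act p = range (\<lambda>a. act a p)"

end

theory Submission
  imports Defs
begin

text \<open>Write \<open>X\<^sup>*\<close> for the fundamental field of \<open>X\<close> and \<open>A\<^sub>X = \<nabla>X\<^sup>*\<close>. The isometries make \<open>A\<^sub>X\<close> skew,
  the moment map makes it commute with \<open>J\<close>, and \<open>\<nabla>\<^sub>w A\<^sub>X = R(w, X\<^sup>*)\<close> for Killing fields. Hence
  \<open>\<nabla>\<^sub>w [X\<^sup>*,Y\<^sup>*] = R(w,X\<^sup>*)Y\<^sup>* - R(w,Y\<^sup>*)X\<^sup>*\<close> up to a commutator, and for an Einstein metric
  \<open>tr (J A\<^sub>[\<^sub>X\<^sub>,\<^sub>Y\<^sub>])\<close> is a multiple of \<open>\<omega>(X\<^sup>*,Y\<^sup>*)\<close>, which vanishes on a Lagrangian orbit. So at a point of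
  the orbit the functional \<open>X \<mapsto> tr (J A\<^sub>X)\<close> vanishes on all brackets. A functional with this property is
  invariant under \<open>Ad\<close>; were it nonzero, the compact group would fix a vector on which it does not vanish,
  and that vector would span an abelian ideal.

  On the other hand the fundamental fields span the tangent spaces of the orbit, because an orbit map of
  smaller rank would have nowhere dense image. Differentiating \<open>g(V, JY\<^sup>*) = 0\<close> along the orbit gives
  \<open>g(II(u,v), JY\<^sup>*) = - g(v, J A\<^sub>Y u)\<close>, and with \<open>e\<close> running through an orthonormal basis of a Lagrangian
  tangent space, \<open>e\<close> and \<open>Je\<close> together form one of the whole space. The mean curvature vector \<open>H\<close>
  therefore satisfies \<open>g(H, JY\<^sup>*) = - tr (J A\<^sub>Y) / 2 = 0\<close>.\<close>


section \<open>Calculus of smooth maps\<close>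

text \<open>The number tr (J \<open>A\<^sub>X\<close>) is the divergence of J
  \<open>X\<^sup>*\<close>, hence up to sign the Laplacian of the component of the moment map along
  \<open>X\<close>. Its values on brackets are needed at single points: \<omega> of two fundamental
  fields is known to vanish on the orbit, not near it. The curvature identity makes this possible,
  because apart from a commutator it expresses the derivative of a bracket by the values of the
  fields at the point.

  Semisimplicity is given as the absence of nonzero solvable ideals, so a functional that vanishes
  on brackets has to be turned into such an ideal.

  Several objects are known only by a characterisation, and this shapes the calculations.
  Christoffel symbols are the unique solution of equations, so their differentiability is that of
  the solution of a linear system. The second fundamental form ranges over all extending fields and
  is reached only through pairings that do not depend on the extension. Tangent spaces consist of
  velocities of curves; an adapted chart bounds them from above, and the lower bound is where
  compactness of the group enters a second time.\<close>

abbreviation Dr :: "('a::real_normed_vector \<Rightarrow> 'b::real_normed_vector) \<Rightarrow> 'a \<Rightarrow> 'a \<Rightarrow> 'b" where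
  "Dr f x \<equiv> frechet_derivative f (at x)"

lemma Dr_works: "f differentiable (at x) \<Longrightarrow> (f has_derivative Dr f x) (at x)"
  by (simp add: frechet_derivative_works)

lemma Dr_eq: "(f has_derivative f') (at x) \<Longrightarrow> Dr f x = f'"
  by (metis frechet_derivative_at)

lemma has_derivative_cong_open:
  assumes "open S" "x \<in> S" "\<And>y. y \<in> S \<Longrightarrow> f y = g y"
  shows "(f has_derivative f') (at x) \<longleftrightarrow> (g has_derivative f') (at x)"
  using assms by (metis has_derivative_transform_within_open)

lemma has_derivative_cong_openI:
  assumes "(g has_derivative f') (at x)" "open S" "x \<in> S" "\<And>y. y \<in> S \<Longrightarrow> f y = g y"
  shows "(f has_derivative f') (at x)"
  using assms has_derivative_cong_open by blast

lemma Dr_cong: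
  assumes "open S" "x \<in> S" "\<And>y. y \<in> S \<Longrightarrow> f y = g y"
  shows "Dr f x = Dr g x"
  unfolding frechet_derivative_def using has_derivative_cong_open[OF assms] by simp

lemma differentiable_cong_open:
  assumes "open S" "x \<in> S" "\<And>y. y \<in> S \<Longrightarrow> f y = g y"
  shows "f differentiable (at x) \<longleftrightarrow> g differentiable (at x)"
  unfolding differentiable_def using has_derivative_cong_open[OF assms] by simp

lemma Dr_compose:
  assumes "g differentiable (at x)" "f differentiable (at (g x))"
  shows "Dr (\<lambda>y. f (g y)) x = (\<lambda>v. Dr f (g x) (Dr g x v))"
  using diff_chain_at[OF Dr_works[OF assms(1)] Dr_works[OF assms(2)]]
  by (intro Dr_eq) (simp add: o_def)

lemma linear_Dr: "f differentiable (at x) \<Longrightarrow> linear (Dr f x)"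
  by (rule linear_frechet_derivative)

section \<open>Closure properties of the classes of continuously differentiable maps\<close>

lemma Ck_on_cong:
  assumes "open S" "\<And>y. y \<in> S \<Longrightarrow> f y = g y"
  shows "Ck_on k S f \<longleftrightarrow> Ck_on k S g"
  using assms(2)
proof (induction k arbitrary: f g)
  case 0
  then show ?case by (auto intro!: continuous_on_cong)
next
  case (Suc k)
  have "Ck_on k S (\<lambda>x. Dr f x v) \<longleftrightarrow> Ck_on k S (\<lambda>x. Dr g x v)" for v
    using Suc.prems assms(1) by (intro Suc.IH) (metis Dr_cong)
  moreover have "\<forall>x\<in>S. f differentiable at x \<longleftrightarrow> g differentiable at x"
    using differentiable_cong_open[OF assms(1)] Suc.prems by blast
  ultimately show ?case by auto
qed

lemma Ck_on_subset: "Ck_on k S f \<Longrightarrow> T \<subseteq> S \<Longrightarrow> Ck_on k T f"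
  by (induction k arbitrary: f) (auto intro: continuous_on_subset)

lemma Ck_on_Suc_imp: "Ck_on (Suc k) S f \<Longrightarrow> Ck_on k S f"
proof (induction k arbitrary: f)
  case 0
  then show ?case
    by (auto intro!: continuous_at_imp_continuous_on differentiable_imp_continuous_within)
next
  case (Suc k)
  then show ?case by (metis Ck_on.simps(2))
qed

lemma Ck_on_const: "Ck_on k S (\<lambda>x. c)"
proof (induction k arbitrary: c)
  case (Suc k)
  have "Dr (\<lambda>x. c) x v = 0" for x v :: 'a by (simp)
  then show ?case using Suc by simp
qed simp

lemma Ck_on_bounded_linear:
  assumes "bounded_linear h"
  shows "Ck_on k S h"
proof (cases k)
  case 0
  then show ?thesis using assms by (simp add: linear_continuous_on)
next
  case (Suc j)
  have d: "(h has_derivative h) (at x)" for x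
    using assms by (rule bounded_linear_imp_has_derivative)
  then have "Dr h x = h" for x by (rule Dr_eq)
  then show ?thesis using d Suc by (auto simp: differentiable_def Ck_on_const)
qed

lemma Ck_on_bounded_linear_compose:
  assumes "open S" "bounded_linear h" "Ck_on k S f"
  shows "Ck_on k S (\<lambda>x. h (f x))"
  using assms(3)
proof (induction k arbitrary: f)
  case 0
  then show ?case using assms(2) by (simp add: bounded_linear.continuous_on)
next
  case (Suc k)
  have d: "((\<lambda>x. h (f x)) has_derivative (\<lambda>v. h (Dr f x v))) (at x)" if "x \<in> S" for x
    using Suc.prems that by (auto intro!: bounded_linear.has_derivative[OF assms(2)] Dr_works)
  have "Ck_on k S (\<lambda>x. h (Dr f x v))" for v
    using Suc by simp
  moreover have "Ck_on k S (\<lambda>x. Dr (\<lambda>x. h (f x)) x v) \<longleftrightarrow> Ck_on k S (\<lambda>x. h (Dr f x v))" for v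
    by (rule Ck_on_cong[OF assms(1)]) (simp add: Dr_eq[OF d])
  ultimately show ?case using d by (auto simp: differentiable_def)
qed

lemma Ck_on_add:
  assumes "open S" "Ck_on k S f" "Ck_on k S g"
  shows "Ck_on k S (\<lambda>x. f x + g x)"
  using assms(2,3)
proof (induction k arbitrary: f g)
  case 0
  then show ?case by (simp add: continuous_on_add)
next
  case (Suc k)
  have d: "((\<lambda>x. f x + g x) has_derivative (\<lambda>v. Dr f x v + Dr g x v)) (at x)" if "x \<in> S" for x
    using Suc.prems that by (auto intro!: has_derivative_add Dr_works)
  have "Ck_on k S (\<lambda>x. Dr (\<lambda>x. f x + g x) x v) \<longleftrightarrow> Ck_on k S (\<lambda>x. Dr f x v + Dr g x v)" for v
    by (rule Ck_on_cong[OF assms(1)]) (simp add: Dr_eq[OF d])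
  then show ?case using d Suc by (auto simp: differentiable_def)
qed

lemma Ck_on_sum:
  assumes "open S" "finite I" "\<And>i. i \<in> I \<Longrightarrow> Ck_on k S (f i)"
  shows "Ck_on k S (\<lambda>x. \<Sum>i\<in>I. f i x)"
  using assms(2,3)
  by (induction I rule: finite_induct) (auto intro!: Ck_on_const Ck_on_add[OF assms(1)])

lemma Ck_on_scaleR:
  assumes "open S" "Ck_on k S f" "Ck_on k S g"
  shows "Ck_on k S (\<lambda>x. f x *\<^sub>R g x)"
  using assms(2,3)
proof (induction k arbitrary: f g)
  case 0
  then show ?case by (simp add: continuous_on_scaleR)
next
  case (Suc k)
  have d: "((\<lambda>x. f x *\<^sub>R g x) has_derivative (\<lambda>v. f x *\<^sub>R Dr g x v + Dr f x v *\<^sub>R g x)) (at x)"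
    if "x \<in> S" for x
    using Suc.prems that by (auto intro!: has_derivative_scaleR Dr_works)
  have "Ck_on k S (\<lambda>x. Dr (\<lambda>x. f x *\<^sub>R g x) x v) \<longleftrightarrow>
      Ck_on k S (\<lambda>x. f x *\<^sub>R Dr g x v + Dr f x v *\<^sub>R g x)" for v
    by (rule Ck_on_cong[OF assms(1)]) (simp add: Dr_eq[OF d])
  moreover have "Ck_on k S (\<lambda>x. f x *\<^sub>R Dr g x v + Dr f x v *\<^sub>R g x)" for v
    using Suc.prems Ck_on_Suc_imp[OF Suc.prems(1)] Ck_on_Suc_imp[OF Suc.prems(2)]
    by (intro Ck_on_add Suc.IH assms(1)) auto
  ultimately show ?case using d by (auto simp: differentiable_def)
qed

lemma linear_basis_expansion:
  fixes f :: "'a::euclidean_space \<Rightarrow> 'b::real_vector"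
  assumes "linear f"
  shows "f v = (\<Sum>b\<in>Basis. (v \<bullet> b) *\<^sub>R f b)"
proof -
  have "f v = f (\<Sum>b\<in>Basis. (v \<bullet> b) *\<^sub>R b)" by (simp add: euclidean_representation)
  also have "\<dots> = (\<Sum>b\<in>Basis. (v \<bullet> b) *\<^sub>R f b)"
    unfolding linear_sum[OF assms] linear_scale[OF assms] ..
  finally show ?thesis .
qed

lemma Dr_basis:
  fixes f :: "'a::euclidean_space \<Rightarrow> 'b::real_normed_vector"
  assumes "f differentiable (at x)"
  shows "Dr f x v = (\<Sum>b\<in>Basis. (v \<bullet> b) *\<^sub>R Dr f x b)"
  by (rule linear_basis_expansion[OF linear_Dr[OF assms]])

text \<open>The chain rule is expanded over \<open>Basis\<close>, so that only derivatives of
  \<open>f\<close> in fixed directions occur and the induction hypothesis applies to them; hence the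
  Euclidean type in the middle.\<close>

lemma Ck_on_compose:
  fixes g :: "'a::real_normed_vector \<Rightarrow> 'b::euclidean_space" and f :: "'b \<Rightarrow> 'c::real_normed_vector"
  assumes "open S" "open T" "Ck_on k S g" "Ck_on k T f" "\<And>x. x \<in> S \<Longrightarrow> g x \<in> T"
  shows "Ck_on k S (\<lambda>x. f (g x))"
  using assms(3,4)
proof (induction k arbitrary: f)
  case 0
  then show ?case using assms(5) by (auto intro: continuous_on_compose2)
next
  case (Suc k)
  have dg: "g differentiable (at x)" if "x \<in> S" for x using Suc.prems that by simp
  have df: "f differentiable (at (g x))" if "x \<in> S" for x using Suc.prems that assms(5) by simp
  have d: "Dr (\<lambda>x. f (g x)) x v = (\<Sum>b\<in>Basis. (Dr g x v \<bullet> b) *\<^sub>R Dr f (g x) b)" if "x \<in> S" for x v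
    unfolding Dr_compose[OF dg[OF that] df[OF that]] by (rule Dr_basis[OF df[OF that]])
  have "Ck_on k S (\<lambda>x. Dr (\<lambda>x. f (g x)) x v) \<longleftrightarrow>
      Ck_on k S (\<lambda>x. \<Sum>b\<in>Basis. (Dr g x v \<bullet> b) *\<^sub>R Dr f (g x) b)" for v
    by (rule Ck_on_cong[OF assms(1)]) (simp add: d)
  moreover have "Ck_on k S (\<lambda>x. \<Sum>b\<in>Basis. (Dr g x v \<bullet> b) *\<^sub>R Dr f (g x) b)" for v
    using Suc.prems Ck_on_Suc_imp[OF Suc.prems(1)]
    by (intro Ck_on_sum Ck_on_scaleR Suc.IH assms(1)
        Ck_on_bounded_linear_compose[OF assms(1) bounded_linear_inner_left]) auto
  moreover have "(\<lambda>x. f (g x)) differentiable (at x)" if "x \<in> S" for x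
    using differentiable_chain_at[OF dg[OF that] df[OF that]] by (simp add: o_def)
  ultimately show ?case by auto
qed

lemma Ck_on_Pair:
  fixes f :: "'a::real_normed_vector \<Rightarrow> 'b::real_normed_vector" and g :: "'a \<Rightarrow> 'c::real_normed_vector"
  assumes "open S" "Ck_on k S f" "Ck_on k S g"
  shows "Ck_on k S (\<lambda>x. (f x, g x))"
proof -
  have 1: "bounded_linear (\<lambda>a::'b. (a, 0::'c))" and 2: "bounded_linear (\<lambda>a::'c. (0::'b, a))"
    by (rule bounded_linear_Pair bounded_linear_ident bounded_linear_zero)+
  have "Ck_on k S (\<lambda>x. (f x, 0) + (0, g x))"
    using assms Ck_on_bounded_linear_compose[OF _ 1] Ck_on_bounded_linear_compose[OF _ 2]
    by (intro Ck_on_add) auto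
  then show ?thesis by simp
qed

text \<open>Continuity is local and the derivative clauses are pointwise. This serves compositions
  of maps between manifolds, where the chart in the middle changes from point to point.\<close>

lemma Ck_on_local:
  assumes "\<And>x. x \<in> S \<Longrightarrow> \<exists>T. open T \<and> x \<in> T \<and> Ck_on k (S \<inter> T) f"
  shows "Ck_on k S f"
  using assms
proof (induction k arbitrary: f)
  case 0
  have "continuous (at x within S) f" if "x \<in> S" for x
  proof -
    obtain T where T: "open T" "x \<in> T" "continuous_on (S \<inter> T) f" using 0 \<open>x \<in> S\<close> by auto
    then have "continuous (at x within (S \<inter> T)) f" using that by (simp add: continuous_on_eq_continuous_within)
    then show ?thesis using at_within_nhd[OF T(2,1), of "S \<inter> T" S] by (auto simp: continuous_within)
  qed
  then show ?case by (simp add: continuous_on_eq_continuous_within)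
next
  case (Suc k)
  then show ?case by (force intro!: Suc.IH)
qed

lemma smooth_on_cong:
  "open S \<Longrightarrow> (\<And>y. y \<in> S \<Longrightarrow> f y = g y) \<Longrightarrow> smooth_on S f \<longleftrightarrow> smooth_on S g"
  using Ck_on_cong unfolding smooth_on_def by blast

lemma smooth_on_subset: "smooth_on S f \<Longrightarrow> T \<subseteq> S \<Longrightarrow> smooth_on T f"
  using Ck_on_subset unfolding smooth_on_def by blast

lemma smooth_on_const: "smooth_on S (\<lambda>x. c)"
  by (simp add: smooth_on_def Ck_on_const)

lemma smooth_on_bounded_linear: "bounded_linear h \<Longrightarrow> smooth_on S h"
  by (simp add: smooth_on_def Ck_on_bounded_linear)

lemma smooth_on_bounded_linear_compose:
  "open S \<Longrightarrow> bounded_linear h \<Longrightarrow> smooth_on S f \<Longrightarrow> smooth_on S (\<lambda>x. h (f x))"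
  by (simp add: smooth_on_def Ck_on_bounded_linear_compose)

lemma smooth_on_add:
  "open S \<Longrightarrow> smooth_on S f \<Longrightarrow> smooth_on S g \<Longrightarrow> smooth_on S (\<lambda>x. f x + g x)"
  by (simp add: smooth_on_def Ck_on_add)

lemma smooth_on_Pair:
  "open S \<Longrightarrow> smooth_on S f \<Longrightarrow> smooth_on S g \<Longrightarrow> smooth_on S (\<lambda>x. (f x, g x))"
  by (simp add: smooth_on_def Ck_on_Pair)

lemma smooth_on_compose:
  fixes g :: "'a::real_normed_vector \<Rightarrow> 'b::euclidean_space" and f :: "'b \<Rightarrow> 'c::real_normed_vector"
  assumes "open S" "open T" "smooth_on S g" "smooth_on T f" "\<And>x. x \<in> S \<Longrightarrow> g x \<in> T"
  shows "smooth_on S (\<lambda>x. f (g x))"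
  using assms unfolding smooth_on_def by (blast intro: Ck_on_compose)

lemma smooth_on_Dr: "smooth_on S f \<Longrightarrow> smooth_on S (\<lambda>x. Dr f x v)"
  unfolding smooth_on_def by (metis Ck_on.simps(2))

lemma smooth_on_differentiable: "smooth_on S f \<Longrightarrow> x \<in> S \<Longrightarrow> f differentiable (at x)"
  unfolding smooth_on_def by (metis Ck_on.simps(2))

lemma smooth_on_continuous_on: "smooth_on S f \<Longrightarrow> continuous_on S f"
  unfolding smooth_on_def by (metis Ck_on.simps(1))

lemma smooth_on_has_derivative: "smooth_on S f \<Longrightarrow> x \<in> S \<Longrightarrow> (f has_derivative Dr f x) (at x)"
  by (intro Dr_works smooth_on_differentiable)

lemma smooth_on_local:
  assumes "\<And>x. x \<in> S \<Longrightarrow> \<exists>T. open T \<and> x \<in> T \<and> smooth_on (S \<inter> T) f"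
  shows "smooth_on S f"
  using assms unfolding smooth_on_def by (metis Ck_on_local)

text \<open>The second difference is symmetric in \<open>v\<close> and \<open>w\<close>.\<close>

lemma second_difference:
  fixes f :: "'a::real_normed_vector \<Rightarrow> real"
  assumes f: "smooth_on (ball x r) f" and t: "0 < t" "t * (norm v + norm w) < r"
  shows "\<exists>\<xi>. norm (\<xi> - x) \<le> t * (norm v + norm w) \<and>
    f (x + t *\<^sub>R v + t *\<^sub>R w) - f (x + t *\<^sub>R v) - f (x + t *\<^sub>R w) + f x = t\<^sup>2 * Dr (\<lambda>y. Dr f y v) \<xi> w"
proof -
  have nb: "norm (a *\<^sub>R v + b *\<^sub>R w) \<le> t * (norm v + norm w)" if "0 \<le> a" "a \<le> t" "0 \<le> b" "b \<le> t" for a b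
  proof -
    have "norm (a *\<^sub>R v + b *\<^sub>R w) \<le> a * norm v + b * norm w"
      using norm_triangle_ineq[of "a *\<^sub>R v" "b *\<^sub>R w"] that by simp
    also have "\<dots> \<le> t * norm v + t * norm w" using that by (intro add_mono mult_right_mono) auto
    finally show ?thesis by (simp add: algebra_simps)
  qed
  have inb: "x + a *\<^sub>R v + b *\<^sub>R w \<in> ball x r" if "0 \<le> a" "a \<le> t" "0 \<le> b" "b \<le> t" for a b
  proof -
    have "dist x (x + a *\<^sub>R v + b *\<^sub>R w) = norm (a *\<^sub>R v + b *\<^sub>R w)"
      unfolding dist_norm norm_minus_commute[of x] by (simp add: add.assoc)
    then show ?thesis using nb[OF that] t by simp
  qed
  \<comment> \<open>The second difference is the increment of this function from 0 to
    \<open>t\<close>. The mean value theorem in \<open>s\<close> produces the derivative along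
    \<open>v\<close>, a second use in \<open>b\<close> the mixed derivative. The vacuous
    \<open>0 *\<^sub>R w\<close> lets \<open>d1\<close> cover both summands.\<close>
  let ?\<phi> = "\<lambda>s. f (x + s *\<^sub>R v + t *\<^sub>R w) - f (x + s *\<^sub>R v + 0 *\<^sub>R w)"
  let ?\<phi>' = "\<lambda>s. Dr f (x + s *\<^sub>R v + t *\<^sub>R w) v - Dr f (x + s *\<^sub>R v + 0 *\<^sub>R w) v"
  have lin: "linear (Dr f y)" if "y \<in> ball x r" for y
    using smooth_on_differentiable[OF f that] by (rule linear_Dr)
  have d1: "((\<lambda>s. f (x + s *\<^sub>R v + b *\<^sub>R w)) has_derivative (\<lambda>h. h * Dr f (x + s *\<^sub>R v + b *\<^sub>R w) v)) (at s)"
    if "0 \<le> s" "s \<le> t" "0 \<le> b" "b \<le> t" for s b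
  proof -
    have "((\<lambda>s. x + s *\<^sub>R v + b *\<^sub>R w) has_derivative (\<lambda>h. h *\<^sub>R v)) (at s)"
      by (auto intro!: derivative_eq_intros)
    from diff_chain_at[OF this smooth_on_has_derivative[OF f inb[OF that]]]
    show ?thesis by (simp add: o_def linear_scale[OF lin[OF inb[OF that]]])
  qed
  have "\<exists>s>0. s < t \<and> ?\<phi> t - ?\<phi> 0 = (t - 0) * ?\<phi>' s"
  proof (rule MVT2)
    fix s assume "0 \<le> s" "s \<le> t"
    then have "(?\<phi> has_derivative (\<lambda>h. h * Dr f (x + s *\<^sub>R v + t *\<^sub>R w) v - h * Dr f (x + s *\<^sub>R v + 0 *\<^sub>R w) v)) (at s)"
      using t by (intro has_derivative_diff d1) auto
    then show "(?\<phi> has_real_derivative ?\<phi>' s) (at s)"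
      by (simp add: has_field_derivative_def left_diff_distrib[symmetric] mult_commute_abs right_diff_distrib[symmetric])
  qed (use t in auto)
  then obtain s where s: "0 < s" "s < t" "?\<phi> t - ?\<phi> 0 = t * ?\<phi>' s" by auto
  let ?f2 = "\<lambda>y. Dr f y v"
  have f2: "smooth_on (ball x r) ?f2" by (rule smooth_on_Dr[OF f])
  have lin2: "linear (Dr ?f2 y)" if "y \<in> ball x r" for y
    using smooth_on_differentiable[OF f2 that] by (rule linear_Dr)
  have "\<exists>b>0. b < t \<and> ?f2 (x + s *\<^sub>R v + t *\<^sub>R w) - ?f2 (x + s *\<^sub>R v + 0 *\<^sub>R w) =
     (t - 0) * Dr ?f2 (x + s *\<^sub>R v + b *\<^sub>R w) w"
  proof (rule MVT2)
    fix b assume b: "0 \<le> b" "b \<le> t"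
    then have i: "x + s *\<^sub>R v + b *\<^sub>R w \<in> ball x r" using inb s by simp
    have "((\<lambda>b. x + s *\<^sub>R v + b *\<^sub>R w) has_derivative (\<lambda>h. h *\<^sub>R w)) (at b)"
      by (auto intro!: derivative_eq_intros)
    from diff_chain_at[OF this smooth_on_has_derivative[OF f2 i]]
    show "((\<lambda>b. ?f2 (x + s *\<^sub>R v + b *\<^sub>R w)) has_real_derivative Dr ?f2 (x + s *\<^sub>R v + b *\<^sub>R w) w) (at b)"
      by (simp add: o_def linear_scale[OF lin2[OF i]] has_field_derivative_def mult_commute_abs)
  qed (use t in auto)
  then obtain b where b: "0 < b" "b < t"
    "?f2 (x + s *\<^sub>R v + t *\<^sub>R w) - ?f2 (x + s *\<^sub>R v + 0 *\<^sub>R w) = t * Dr ?f2 (x + s *\<^sub>R v + b *\<^sub>R w) w" by auto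
  have "f (x + t *\<^sub>R v + t *\<^sub>R w) - f (x + t *\<^sub>R v) - f (x + t *\<^sub>R w) + f x = ?\<phi> t - ?\<phi> 0" by simp
  also have "\<dots> = t\<^sup>2 * Dr ?f2 (x + s *\<^sub>R v + b *\<^sub>R w) w"
    unfolding s(3) b(3) by (simp add: power2_eq_square)
  finally show ?thesis
    using nb[of s b] s b by (intro exI[of _ "x + s *\<^sub>R v + b *\<^sub>R w"]) (auto simp: algebra_simps)
qed

text \<open>One and the same second difference equals a mixed derivative in either order, at two
  points close to \<open>x\<close>. Continuity of both derivatives then contradicts a gap
  \<open>e\<close> at \<open>x\<close>.\<close>

lemma Dr_symmetric_real:
  fixes f :: "'a::real_normed_vector \<Rightarrow> real"
  assumes "open S" "x \<in> S" and f: "smooth_on S f"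
  shows "Dr (\<lambda>y. Dr f y v) x w = Dr (\<lambda>y. Dr f y w) x v"
proof (rule ccontr)
  let ?a = "\<lambda>y. Dr (\<lambda>y. Dr f y v) y w" and ?b = "\<lambda>y. Dr (\<lambda>y. Dr f y w) y v"
  define e where "e = \<bar>?a x - ?b x\<bar>"
  assume "?a x \<noteq> ?b x"
  then have e: "e > 0" by (simp add: e_def)
  obtain r where r: "r > 0" "ball x r \<subseteq> S" using assms openE by blast
  have "continuous_on S ?a" "continuous_on S ?b"
    by (auto intro!: smooth_on_continuous_on smooth_on_Dr f)
  then have "isCont ?a x" "isCont ?b x"
    using assms continuous_on_eq_continuous_at by blast+
  then obtain d1 d2 where d: "d1 > 0" "\<And>y. dist y x < d1 \<Longrightarrow> dist (?a y) (?a x) < e / 2"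
    "d2 > 0" "\<And>y. dist y x < d2 \<Longrightarrow> dist (?b y) (?b x) < e / 2"
    using e unfolding continuous_at_eps_delta by (metis half_gt_zero)
  define \<delta> where "\<delta> = min r (min d1 d2)"
  \<comment> \<open>Makes \<open>t * (norm v + norm w)\<close> at most \<open>\<delta> / 2\<close>;
    the summand 1 covers \<open>v = w = 0\<close>.\<close>
  define t where "t = \<delta> / (2 * (norm v + norm w + 1))"
  have \<delta>: "\<delta> > 0" using r d by (simp add: \<delta>_def)
  have nn: "norm v + norm w + 1 > 0" by (metis add_nonneg_pos norm_ge_zero zero_less_one add_nonneg_nonneg)
  have t: "t > 0" unfolding t_def using \<delta> nn by simp
  have "t * (norm v + norm w) \<le> t * (norm v + norm w + 1)" using t by simp
  also have "\<dots> = \<delta> / 2" unfolding t_def using nn by (simp add: field_simps)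
  finally have td: "t * (norm v + norm w) < \<delta>" using \<delta> by simp
  then have tr: "t * (norm v + norm w) < r" "t * (norm w + norm v) < r" by (auto simp: \<delta>_def add.commute)
  have f': "smooth_on (ball x r) f" using f r smooth_on_subset by blast
  obtain y where y: "norm (y - x) \<le> t * (norm v + norm w)"
    "f (x + t *\<^sub>R v + t *\<^sub>R w) - f (x + t *\<^sub>R v) - f (x + t *\<^sub>R w) + f x = t\<^sup>2 * ?a y"
    using second_difference[OF f' t tr(1)] by blast
  obtain z where z: "norm (z - x) \<le> t * (norm w + norm v)"
    "f (x + t *\<^sub>R w + t *\<^sub>R v) - f (x + t *\<^sub>R w) - f (x + t *\<^sub>R v) + f x = t\<^sup>2 * ?b z"
    using second_difference[OF f' t tr(2)] by blast
  have "x + t *\<^sub>R w + t *\<^sub>R v = x + t *\<^sub>R v + t *\<^sub>R w" by (simp add: algebra_simps)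
  then have "t\<^sup>2 * ?a y = t\<^sup>2 * ?b z" unfolding y(2)[symmetric] z(2)[symmetric] by (simp only:)
  then have yz: "?a y = ?b z"
    using t by (metis mult_cancel_left power_not_zero less_irrefl)
  have "dist (?a y) (?a x) < e / 2" using y(1) td by (intro d) (auto simp: dist_norm \<delta>_def)
  moreover have "dist (?b z) (?b x) < e / 2" using z(1) td by (intro d) (auto simp: dist_norm \<delta>_def add.commute)
  moreover have "dist (?a x) (?b x) \<le> dist (?a y) (?a x) + dist (?a y) (?b x)"
    by (rule dist_triangle3)
  ultimately show False unfolding yz e_def dist_real_def[symmetric] by linarith
qed

lemma Dr_bounded_linear_compose:
  assumes "bounded_linear h" "f differentiable (at x)"
  shows "Dr (\<lambda>y. h (f y)) x v = h (Dr f x v)"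
  using Dr_eq[OF bounded_linear.has_derivative[OF assms(1) Dr_works[OF assms(2)]]] by simp

lemma Dr_symmetric:
  fixes f :: "'a::real_normed_vector \<Rightarrow> 'b::euclidean_space"
  assumes S: "open S" "x \<in> S" and f: "smooth_on S f"
  shows "Dr (\<lambda>y. Dr f y v) x w = Dr (\<lambda>y. Dr f y w) x v"
proof (rule euclidean_eqI)
  fix b :: 'b
  have i: "Dr (\<lambda>y. Dr f y v) x w \<bullet> b = Dr (\<lambda>y. Dr (\<lambda>y. f y \<bullet> b) y v) x w" for v w
  proof -
    have *: "Dr (\<lambda>y. Dr (\<lambda>y. f y \<bullet> b) y v) x = Dr (\<lambda>y. Dr f y v \<bullet> b) x"
      using f by (intro Dr_cong[OF S] Dr_bounded_linear_compose[OF bounded_linear_inner_left])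
        (auto intro: smooth_on_differentiable)
    have "Dr (\<lambda>y. Dr f y v \<bullet> b) x w = Dr (\<lambda>y. Dr f y v) x w \<bullet> b"
      using f S by (intro Dr_bounded_linear_compose[OF bounded_linear_inner_left])
        (auto intro: smooth_on_differentiable smooth_on_Dr)
    then show ?thesis unfolding * by simp
  qed
  have "smooth_on S (\<lambda>y. f y \<bullet> b)"
    by (rule smooth_on_bounded_linear_compose[OF S(1) bounded_linear_inner_left f])
  from Dr_symmetric_real[OF S this] show "Dr (\<lambda>y. Dr f y v) x w \<bullet> b = Dr (\<lambda>y. Dr f y w) x v \<bullet> b"
    unfolding i .
qed

text \<open>A product rule for operators of which only the values on fixed vectors are known to be
  differentiable. Expanding \<open>f y\<close> in the basis leaves finitely many products of a
  scalar and a vector, without a topology on the space of operators.\<close>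

lemma linear_family_has_derivative:
  fixes L :: "'a::real_normed_vector \<Rightarrow> 'b::euclidean_space \<Rightarrow> 'c::real_normed_vector"
  assumes S: "open S" "x \<in> S" and lin: "\<And>y. y \<in> S \<Longrightarrow> linear (L y)"
    and L: "\<And>b. (\<lambda>y. L y b) differentiable (at x)" and f: "f differentiable (at x)"
  shows "((\<lambda>y. L y (f y)) has_derivative (\<lambda>u. Dr (\<lambda>y. L y (f x)) x u + L x (Dr f x u))) (at x)"
proof -
  have ex: "L y w = (\<Sum>b\<in>Basis. (w \<bullet> b) *\<^sub>R L y b)" if "y \<in> S" for y w
    by (rule linear_basis_expansion[OF lin[OF that]])
  have d: "((\<lambda>y. \<Sum>b\<in>Basis. (f y \<bullet> b) *\<^sub>R L y b) has_derivative
     (\<lambda>u. \<Sum>b\<in>Basis. (f x \<bullet> b) *\<^sub>R Dr (\<lambda>y. L y b) x u + (Dr f x u \<bullet> b) *\<^sub>R L x b)) (at x)"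
    by (intro has_derivative_sum has_derivative_scaleR Dr_works L
        bounded_linear.has_derivative[OF bounded_linear_inner_left] f)
  have "((\<lambda>y. \<Sum>b\<in>Basis. (f x \<bullet> b) *\<^sub>R L y b) has_derivative
     (\<lambda>u. \<Sum>b\<in>Basis. (f x \<bullet> b) *\<^sub>R Dr (\<lambda>y. L y b) x u)) (at x)"
    by (intro has_derivative_sum bounded_linear.has_derivative[OF bounded_linear_scaleR_right] Dr_works L)
  then have "((\<lambda>y. L y (f x)) has_derivative (\<lambda>u. \<Sum>b\<in>Basis. (f x \<bullet> b) *\<^sub>R Dr (\<lambda>y. L y b) x u)) (at x)"
    by (rule has_derivative_cong_openI[OF _ S]) (rule ex)
  then have "Dr (\<lambda>y. L y (f x)) x u = (\<Sum>b\<in>Basis. (f x \<bullet> b) *\<^sub>R Dr (\<lambda>y. L y b) x u)" for u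
    by (simp add: Dr_eq)
  then have e: "(\<lambda>u. \<Sum>b\<in>Basis. (f x \<bullet> b) *\<^sub>R Dr (\<lambda>y. L y b) x u + (Dr f x u \<bullet> b) *\<^sub>R L x b) =
     (\<lambda>u. Dr (\<lambda>y. L y (f x)) x u + L x (Dr f x u))"
    by (simp add: sum.distrib ex[OF S(2), of "Dr f x _"])
  show ?thesis
    using d unfolding e by (rule has_derivative_cong_openI[OF _ S]) (rule ex)
qed

lemma bilinear_family_has_derivative:
  fixes L :: "'a::real_normed_vector \<Rightarrow> 'b::euclidean_space \<Rightarrow> 'd::euclidean_space \<Rightarrow> 'c::real_normed_vector"
  assumes S: "open S" "x \<in> S" and lin: "\<And>y. y \<in> S \<Longrightarrow> bilinear (L y)"
    and L: "\<And>b d. (\<lambda>y. L y b d) differentiable (at x)"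
    and f: "f differentiable (at x)" and g: "g differentiable (at x)"
  shows "((\<lambda>y. L y (f y) (g y)) has_derivative
     (\<lambda>u. Dr (\<lambda>y. L y (f x) (g x)) x u + L x (Dr f x u) (g x) + L x (f x) (Dr g x u))) (at x)"
proof -
  have 1: "((\<lambda>y. L y b (g y)) has_derivative (\<lambda>u. Dr (\<lambda>y. L y b (g x)) x u + L x b (Dr g x u))) (at x)" for b
    using lin L g by (intro linear_family_has_derivative[OF S]) (auto simp: bilinear_def)
  have "((\<lambda>y. (\<lambda>b. L y b (g y)) (f y)) has_derivative
     (\<lambda>u. Dr (\<lambda>y. L y (f x) (g y)) x u + L x (Dr f x u) (g x))) (at x)"
    using lin 1 f by (intro linear_family_has_derivative[OF S] differentiableI[OF 1]) (auto simp: bilinear_def)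
  then show ?thesis using Dr_eq[OF 1, of "f x"] by (simp add: algebra_simps)
qed

text \<open>Injectivity bounds \<open>G x\<close> from below, which makes \<open>z y - z x\<close>
  of order \<open>norm (y - x)\<close>, although \<open>z\<close> is not even known to be
  continuous. Christoffel symbols and the adjoint representation are both accessible only through
  such systems.\<close>

lemma linear_system_differentiable:
  fixes G :: "'a::euclidean_space \<Rightarrow> 'b::euclidean_space \<Rightarrow> 'b"
  assumes S: "open S" "x \<in> S" and lin: "\<And>y. y \<in> S \<Longrightarrow> linear (G y)"
    and inj: "inj (G x)"
    and G: "\<And>b. (\<lambda>y. G y b) differentiable (at x)" and h: "h differentiable (at x)"
    and eq: "\<And>y. y \<in> S \<Longrightarrow> G y (z y) = h y"
  shows "z differentiable (at x)"
proof -
  have linx: "linear (G x)" by (rule lin[OF S(2)])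
  obtain B where B: "B > 0" "\<And>v. B * norm v \<le> norm (G x v)"
    using linear_inj_bounded_below_pos[OF linx inj] by metis
  obtain Gi where Gi: "linear Gi" "\<And>v. Gi (G x v) = v"
    using linear_injective_left_inverse[OF linx inj] by (auto simp: o_def fun_eq_iff)
  obtain C where C: "C > 0" "\<And>v. norm (Gi v) \<le> C * norm v"
    using linear_bounded_pos[OF Gi(1)] by metis
  define \<eta> where "\<eta> y = (\<Sum>b\<in>Basis. norm (G y b - G x b))" for y
  have \<eta>0: "\<eta> y \<ge> 0" for y unfolding \<eta>_def by (simp add: sum_nonneg)
  have "isCont (\<lambda>y. \<Sum>b\<in>Basis. norm (G y b - G x b)) x"
    by (intro continuous_intros differentiable_imp_continuous_within G)
  then have \<eta>lim: "(\<eta> \<longlongrightarrow> 0) (at x)" by (simp add: isCont_def \<eta>_def[abs_def])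
  have diff: "norm (G y v - G x v) \<le> \<eta> y * norm v" if "y \<in> S" for y v
  proof -
    have "G y v - G x v = (\<Sum>b\<in>Basis. (v \<bullet> b) *\<^sub>R (G y b - G x b))"
      unfolding scaleR_diff_right sum_subtractf
      using linear_basis_expansion[OF lin[OF that], of v] linear_basis_expansion[OF linx, of v] by simp
    also have "norm \<dots> \<le> (\<Sum>b\<in>Basis. norm ((v \<bullet> b) *\<^sub>R (G y b - G x b)))" by (rule norm_sum)
    also have "\<dots> \<le> (\<Sum>b\<in>Basis. norm v * norm (G y b - G x b))"
      by (intro sum_mono) (simp add: mult_right_mono Basis_le_norm)
    finally show ?thesis by (simp add: \<eta>_def sum_distrib_left mult.commute)
  qed
  \<comment> \<open>The residual of the constant candidate \<open>z x\<close>: differentiable, zero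
    at \<open>x\<close>, and equal to \<open>G y (z y - z x)\<close>.\<close>
  define \<zeta> where "\<zeta> y = h y - G y (z x)" for y
  have \<zeta>d: "(\<zeta> has_derivative (\<lambda>u. Dr h x u - Dr (\<lambda>y. G y (z x)) x u)) (at x)"
    unfolding \<zeta>_def by (intro has_derivative_diff Dr_works h G)
  obtain \<zeta>' where \<zeta>': "(\<zeta> has_derivative \<zeta>') (at x)" using \<zeta>d by blast
  have \<zeta>x: "\<zeta> x = 0" by (simp add: \<zeta>_def eq[OF S(2)])
  have \<zeta>z: "\<zeta> y = G y (z y - z x)" if "y \<in> S" for y
    by (simp add: \<zeta>_def eq[OF that] linear_diff[OF lin[OF that]])
  obtain K0 where K0: "\<And>u. norm (\<zeta>' u) \<le> K0 * norm u"
    using \<zeta>' has_derivative_bounded_linear bounded_linear.bounded by (metis mult.commute)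
  obtain d where d: "d > 0" "\<And>y. norm (y - x) < d \<Longrightarrow> norm (\<zeta> y - \<zeta> x - \<zeta>' (y - x)) \<le> 1 * norm (y - x)"
    using \<zeta>' unfolding has_derivative_at_alt by (meson zero_less_one)
  define K where "K = \<bar>K0\<bar> + 1"
  have \<zeta>K: "norm (\<zeta> y) \<le> K * norm (y - x)" if "norm (y - x) < d" for y
  proof -
    have "norm (\<zeta> y) \<le> norm (\<zeta> y - \<zeta> x - \<zeta>' (y - x)) + norm (\<zeta>' (y - x))"
      using norm_triangle_ineq[of "\<zeta> y - \<zeta> x - \<zeta>' (y - x)" "\<zeta>' (y - x)"] by (simp add: \<zeta>x)
    also have "\<dots> \<le> 1 * norm (y - x) + K0 * norm (y - x)" using d(2)[OF that] K0 by (intro add_mono) auto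
    also have "\<dots> \<le> K * norm (y - x)" unfolding K_def distrib_right[symmetric] by (intro mult_right_mono) auto
    finally show ?thesis .
  qed
  \<comment> \<open>The error of replacing \<open>G y\<close> by \<open>G x\<close>. Near
    \<open>x\<close> it is at most a constant times \<open>\<eta> y * norm (y - x)\<close>, so its
    derivative is 0 and \<open>z\<close> agrees with \<open>z x + Gi (\<zeta> y)\<close> to first
    order.\<close>
  define \<rho> where "\<rho> y = Gi (G y (z y - z x) - G x (z y - z x))" for y
  have zz: "z y = z x + Gi (\<zeta> y) - \<rho> y" if "y \<in> S" for y
    unfolding \<rho>_def linear_diff[OF Gi(1)] Gi(2) \<zeta>z[OF that] by simp
  have ev: "\<forall>\<^sub>F y in at x. y \<in> S \<and> norm (y - x) < d \<and> \<eta> y < B / 2"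
  proof (intro eventually_conj)
    show "\<forall>\<^sub>F y in at x. y \<in> S" using S by (simp add: eventually_at_topological) blast
    show "\<forall>\<^sub>F y in at x. norm (y - x) < d"
      using d(1) unfolding eventually_at dist_norm by blast
    \<comment> \<open>Then half of the lower bound \<open>B\<close> survives for
      \<open>G y\<close>.\<close>
    show "\<forall>\<^sub>F y in at x. \<eta> y < B / 2" using \<eta>lim B(1) by (metis half_gt_zero order_tendstoD(2))
  qed
  have \<rho>b: "norm (\<rho> y) / norm (y - x) \<le> C * (2 / B) * K * \<eta> y" if y: "y \<in> S \<and> norm (y - x) < d \<and> \<eta> y < B / 2" for y
  proof -
    let ?w = "z y - z x"
    have yS: "y \<in> S" using y by blast
    have "norm (G y ?w - G x ?w) \<le> (B / 2) * norm ?w"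
      using diff[OF yS, of ?w] y by (smt (verit) mult_right_mono norm_ge_zero)
    moreover have "norm (G x ?w) \<le> norm (G y ?w) + norm (G y ?w - G x ?w)"
      by (metis add.commute norm_minus_commute norm_triangle_sub)
    ultimately have "B / 2 * norm ?w \<le> norm (\<zeta> y)"
      using B(2)[of ?w] unfolding \<zeta>z[OF yS] by (simp add: field_simps)
    then have w: "norm ?w \<le> 2 / B * norm (\<zeta> y)" using B(1) by (simp add: field_simps)
    have w2: "norm ?w \<le> 2 / B * (K * norm (y - x))"
      using B(1) \<zeta>K y by (intro order_trans[OF w] mult_left_mono) auto
    have "norm (\<rho> y) \<le> C * (\<eta> y * norm ?w)"
      unfolding \<rho>_def using C diff[OF yS] by (meson mult_left_mono order_less_imp_le order_trans)
    also have "\<dots> \<le> C * (\<eta> y * (2 / B * (K * norm (y - x))))"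
      using w2 C \<eta>0 by (intro mult_left_mono) auto
    finally have "norm (\<rho> y) \<le> (C * (2 / B) * K * \<eta> y) * norm (y - x)" by (simp add: mult_ac)
    moreover have "0 \<le> C * (2 / B) * K * \<eta> y" using B(1) C(1) \<eta>0 by (simp add: K_def)
    ultimately show ?thesis by (cases "y = x") (simp_all add: pos_divide_le_eq)
  qed
  have "((\<lambda>y. C * (2 / B) * K * \<eta> y) \<longlongrightarrow> 0) (at x)" by (rule tendsto_mult_right_zero[OF \<eta>lim])
  moreover have "\<forall>\<^sub>F y in at x. norm (norm (\<rho> y) / norm (y - x)) \<le> C * (2 / B) * K * \<eta> y"
    using ev
  proof eventually_elim
    case (elim y)
    show ?case using \<rho>b[OF elim] by simp
  qed
  ultimately have "((\<lambda>y. norm (\<rho> y) / norm (y - x)) \<longlongrightarrow> 0) (at x)"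
    by (rule Lim_null_comparison[rotated])
  moreover have "\<rho> x = 0" by (simp add: \<rho>_def linear_0[OF Gi(1)])
  ultimately have \<rho>d: "(\<rho> has_derivative (\<lambda>u. 0)) (at x)"
    by (simp add: has_derivative_iff_norm)
  have bl: "bounded_linear Gi" using Gi(1) by (rule linear_conv_bounded_linear[THEN iffD1])
  have "((\<lambda>y. z x + Gi (\<zeta> y) - \<rho> y) has_derivative (\<lambda>u. 0 + Gi (\<zeta>' u) - 0)) (at x)"
    by (rule has_derivative_diff[OF has_derivative_add[OF has_derivative_const
            bounded_linear.has_derivative[OF bl \<zeta>']] \<rho>d])
  then have "(z has_derivative (\<lambda>u. 0 + Gi (\<zeta>' u) - 0)) (at x)"
    by (rule has_derivative_cong_openI[OF _ S]) (rule zz)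
  then show ?thesis by (auto simp: differentiable_def)
qed


section \<open>Kaehler metrics and Killing fields in a chart\<close>

text \<open>Taken in the Euclidean basis, as in \<open>ricci\<close>, and not in a basis adapted to
  the metric; \<open>tr_orthonormal\<close> links the two.\<close>

definition tr :: "('e::euclidean_space \<Rightarrow> 'e) \<Rightarrow> real" where
  "tr L = (\<Sum>b\<in>Basis. L b \<bullet> b)"

lemma tr_commute:
  fixes A B :: "'e::euclidean_space \<Rightarrow> 'e"
  assumes "linear A" "linear B"
  shows "tr (\<lambda>w. A (B w)) = tr (\<lambda>w. B (A w))"
proof -
  have e: "tr (\<lambda>w. A (B w)) = (\<Sum>b\<in>Basis. \<Sum>c\<in>Basis. (B b \<bullet> c) * (A c \<bullet> b))"
    if "linear A" for A B :: "'e \<Rightarrow> 'e"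
    unfolding tr_def linear_basis_expansion[OF that, of "B _"]
    by (simp add: inner_sum_left)
  show ?thesis unfolding e[OF assms(1)] e[OF assms(2)]
    by (subst sum.swap) (simp add: mult.commute)
qed

lemma tr_add: "tr (\<lambda>w. A w + B w) = tr A + tr B"
  by (simp add: tr_def inner_add_left sum.distrib)

lemma tr_diff: "tr (\<lambda>w. A w - B w) = tr A - tr B"
  by (simp add: tr_def inner_diff_left sum_subtractf)

text \<open>Metric and complex structure in a single chart. In holomorphic charts \<open>J\<close>
  has constant components and commutes with partial derivatives; \<open>closed\<close> is d\<omega>
  = 0 for \<omega>(u,v) = \<open>G x (J u) v\<close>.\<close>

locale local_kaehler =
  fixes U :: "'e::euclidean_space set" and G :: "'e \<Rightarrow> 'e \<Rightarrow> 'e \<Rightarrow> real" and J :: "'e \<Rightarrow> 'e"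
  assumes open_U: "open U"
    and bil: "x \<in> U \<Longrightarrow> bilinear (G x)"
    and G_sym: "x \<in> U \<Longrightarrow> G x u v = G x v u"
    and G_pos: "x \<in> U \<Longrightarrow> u \<noteq> 0 \<Longrightarrow> G x u u > 0"
    and G_smooth: "smooth_on U (\<lambda>x. G x u v)"
    and J_linear: "linear J"
    and JJ: "J (J u) = - u"
    and GJJ: "x \<in> U \<Longrightarrow> G x (J u) (J v) = G x u v"
    and closed: "x \<in> U \<Longrightarrow> Dr (\<lambda>y. G y (J v) w) x u + Dr (\<lambda>y. G y (J w) u) x v +
       Dr (\<lambda>y. G y (J u) v) x w = 0"
begin

text \<open>The same description as in \<open>christoffel\<close>, with \<open>G\<close> for the
  components of the metric, so that results transfer by unfolding.\<close>

definition Gam :: "'e \<Rightarrow> 'e \<Rightarrow> 'e \<Rightarrow> 'e" where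
  "Gam x = (THE \<Gamma>. (\<forall>u v. \<Gamma> u v = \<Gamma> v u) \<and>
     (\<forall>u v w. Dr (\<lambda>y. G y v w) x u = G x (\<Gamma> u v) w + G x v (\<Gamma> u w)))"

lemma G_add_left: "x \<in> U \<Longrightarrow> G x (u + u') v = G x u v + G x u' v"
  and G_add_right: "x \<in> U \<Longrightarrow> G x v (u + u') = G x v u + G x v u'"
  and G_diff_left: "x \<in> U \<Longrightarrow> G x (u - u') v = G x u v - G x u' v"
  and G_diff_right: "x \<in> U \<Longrightarrow> G x v (u - u') = G x v u - G x v u'"
  and G_scale_left: "x \<in> U \<Longrightarrow> G x (r *\<^sub>R u) v = r * G x u v"
  and G_scale_right: "x \<in> U \<Longrightarrow> G x v (r *\<^sub>R u) = r * G x v u"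
  and G_minus_left: "x \<in> U \<Longrightarrow> G x (- u) v = - G x u v"
  and G_minus_right: "x \<in> U \<Longrightarrow> G x v (- u) = - G x v u"
  using bil[of x]
  by (simp_all add: bilinear_ladd bilinear_radd bilinear_lsub bilinear_rsub bilinear_lmul
      bilinear_rmul bilinear_lneg bilinear_rneg)

lemmas G_simps = G_add_left G_add_right G_diff_left G_diff_right G_scale_left G_scale_right
  G_minus_left G_minus_right

lemma G_eqI: "x \<in> U \<Longrightarrow> (\<And>w. G x a w = G x b w) \<Longrightarrow> a = b"
  using G_pos[of x "a - b"] by (auto simp: G_simps)

lemma GJ_skew: "x \<in> U \<Longrightarrow> G x (J u) v = - G x u (J v)"
  using GJJ[of x "J u" v] by (simp add: JJ G_minus_left)

lemma G_diff': "x \<in> U \<Longrightarrow> (\<lambda>y. G y u v) differentiable (at x)"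
  using G_smooth by (rule smooth_on_differentiable)

section \<open>The Levi-Civita connection of a metric given in coordinates\<close>

definition dG :: "'e \<Rightarrow> 'e \<Rightarrow> 'e \<Rightarrow> 'e \<Rightarrow> real" where
  "dG x u v w = Dr (\<lambda>y. G y v w) x u"

lemma dG_sym: "x \<in> U \<Longrightarrow> dG x u v w = dG x u w v"
  unfolding dG_def using Dr_cong[OF open_U, of x "\<lambda>y. G y v w" "\<lambda>y. G y w v"] G_sym by simp

lemma dG_linear1: "x \<in> U \<Longrightarrow> linear (\<lambda>u. dG x u v w)"
  unfolding dG_def by (rule linear_Dr[OF G_diff'])

lemma dG_linear2: "x \<in> U \<Longrightarrow> linear (\<lambda>v. dG x u v w)"
proof (rule linearI)
  fix a b :: 'e and r :: real assume x: "x \<in> U"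
  have "((\<lambda>y. G y a w + G y b w) has_derivative (\<lambda>u. dG x u a w + dG x u b w)) (at x)"
    unfolding dG_def by (intro has_derivative_add Dr_works G_diff' x)
  then have "((\<lambda>y. G y (a + b) w) has_derivative (\<lambda>u. dG x u a w + dG x u b w)) (at x)"
    by (rule has_derivative_cong_openI[OF _ open_U x]) (simp add: G_simps)
  then show "dG x u (a + b) w = dG x u a w + dG x u b w" by (simp add: dG_def Dr_eq)
  have "((\<lambda>y. r *\<^sub>R G y a w) has_derivative (\<lambda>u. r *\<^sub>R dG x u a w)) (at x)"
    unfolding dG_def by (intro has_derivative_scaleR_right Dr_works G_diff' x)
  then have "((\<lambda>y. G y (r *\<^sub>R a) w) has_derivative (\<lambda>u. r *\<^sub>R dG x u a w)) (at x)"
    by (rule has_derivative_cong_openI[OF _ open_U x]) (simp add: G_simps)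
  then show "dG x u (r *\<^sub>R a) w = r *\<^sub>R dG x u a w" by (simp add: dG_def Dr_eq)
qed

lemma dG_linear3: "x \<in> U \<Longrightarrow> linear (\<lambda>w. dG x u v w)"
  using dG_linear2[of x u v] by (simp add: dG_sym[of x u v])

definition koszul :: "'e \<Rightarrow> 'e \<Rightarrow> 'e \<Rightarrow> 'e \<Rightarrow> real" where
  "koszul x u v w = (dG x u v w + dG x v u w - dG x w u v) / 2"

text \<open>\<open>M x\<close> lowers an index with the metric and then raises it with the Euclidean inner product,
  so that the Christoffel symbols solve a linear system in \<open>'e\<close>.\<close>

definition M :: "'e \<Rightarrow> 'e \<Rightarrow> 'e" where
  "M x z = (\<Sum>b\<in>Basis. G x z b *\<^sub>R b)"

lemma M_inner: "x \<in> U \<Longrightarrow> M x z \<bullet> w = G x z w"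
  unfolding M_def using linear_basis_expansion[of "G x z" w] bil[of x]
  by (simp add: inner_sum_left inner_commute[of w] bilinear_def mult.commute)

lemma M_linear: "x \<in> U \<Longrightarrow> linear (M x)"
  by (rule linearI) (auto simp: M_def G_simps scaleR_add_left sum.distrib scaleR_sum_right)

lemma M_inj: "x \<in> U \<Longrightarrow> inj (M x)"
  unfolding linear_injective_0[OF M_linear]
  by (metis G_pos M_inner inner_zero_left less_irrefl)

lemma koszul_solution: "x \<in> U \<Longrightarrow> \<exists>z. M x z = (\<Sum>b\<in>Basis. koszul x u v b *\<^sub>R b) \<and> (\<forall>w. G x z w = koszul x u v w)"
proof -
  assume x: "x \<in> U"
  have lin: "linear (koszul x u v)"
    unfolding koszul_def
    by (rule linearI) (simp_all add: linear_add[OF dG_linear1[OF x]] linear_scale[OF dG_linear1[OF x]]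
        linear_add[OF dG_linear3[OF x]] linear_scale[OF dG_linear3[OF x]] field_simps)
  obtain z where z: "M x z = (\<Sum>b\<in>Basis. koszul x u v b *\<^sub>R b)"
    using linear_injective_imp_surjective[OF M_linear[OF x] M_inj[OF x]] by (metis surjD)
  have "G x z w = koszul x u v w" for w
    unfolding M_inner[OF x, symmetric] z linear_basis_expansion[OF lin, of w]
    by (simp add: inner_sum_left inner_commute[of w] mult.commute)
  then show ?thesis using z by blast
qed

text \<open>Symmetry and compatibility force the Koszul formula, which gives uniqueness; existence
  comes from solving with the injective linear map \<open>M x\<close>. Both are needed before the
  definite description yields anything.\<close>

lemma Gam_props:
  assumes x: "x \<in> U"
  shows Gam_sym: "Gam x u v = Gam x v u"
    and Gam_compat: "dG x u v w = G x (Gam x u v) w + G x v (Gam x u w)"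
    and Gam_koszul: "G x (Gam x u v) w = koszul x u v w"
proof -
  let ?P = "\<lambda>\<Gamma>. (\<forall>u v. \<Gamma> u v = \<Gamma> v u) \<and>
     (\<forall>u v w. dG x u v w = G x (\<Gamma> u v) w + G x v (\<Gamma> u w))"
  have kos: "G x (\<Gamma> u v) w = koszul x u v w" if "?P \<Gamma>" for \<Gamma> u v w
  proof -
    have c: "\<And>u v w. dG x u v w = G x (\<Gamma> u v) w + G x v (\<Gamma> u w)" "\<And>u v. \<Gamma> u v = \<Gamma> v u"
      using that by blast+
    show ?thesis unfolding koszul_def c(1)
      using c(2)[of v u] c(2)[of w u] c(2)[of w v]
      by (simp add: G_sym[OF x, of v] G_sym[OF x, of u])
  qed
  define \<Gamma>0 where "\<Gamma>0 u v = (SOME z. \<forall>w. G x z w = koszul x u v w)" for u v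
  have \<Gamma>0: "G x (\<Gamma>0 u v) w = koszul x u v w" for u v w
    unfolding \<Gamma>0_def by (rule someI2_ex) (use koszul_solution[OF x] in blast)+
  have P0: "?P \<Gamma>0"
  proof (intro conjI allI)
    show "\<Gamma>0 u v = \<Gamma>0 v u" for u v
      by (rule G_eqI[OF x]) (simp add: \<Gamma>0 koszul_def dG_sym[OF x, of _ u v])
    show "dG x u v w = G x (\<Gamma>0 u v) w + G x v (\<Gamma>0 u w)" for u v w
      unfolding G_sym[OF x, of v] \<Gamma>0 koszul_def
      using dG_sym[OF x, of u v w] dG_sym[OF x, of v u w] dG_sym[OF x, of w u v] by (simp add: field_simps)
  qed
  have uniq: "\<Gamma> = \<Gamma>0" if "?P \<Gamma>" for \<Gamma>
    by (intro ext G_eqI[OF x]) (simp add: kos[OF that] \<Gamma>0)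
  have "Gam x = \<Gamma>0"
    unfolding Gam_def dG_def[symmetric] using P0 uniq by (rule the_equality)
  with P0 \<Gamma>0 show "Gam x u v = Gam x v u" "dG x u v w = G x (Gam x u v) w + G x v (Gam x u w)"
    "G x (Gam x u v) w = koszul x u v w" by blast+
qed

lemma Gam_linear: "x \<in> U \<Longrightarrow> linear (Gam x u)"
proof (rule linearI)
  assume x: "x \<in> U"
  note l = dG_linear1[OF x] dG_linear2[OF x] dG_linear3[OF x]
  show "Gam x u (a + b) = Gam x u a + Gam x u b" for a b
    by (rule G_eqI[OF x], unfold G_add_left[OF x] Gam_koszul[OF x] koszul_def)
      (simp add: linear_add[OF l(1)] linear_add[OF l(2)] linear_add[OF l(3)] field_simps)
  show "Gam x u (r *\<^sub>R a) = r *\<^sub>R Gam x u a" for r a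
    by (rule G_eqI[OF x], unfold G_scale_left[OF x] Gam_koszul[OF x] koszul_def)
      (simp add: linear_scale[OF l(1)] linear_scale[OF l(2)] linear_scale[OF l(3)] field_simps)
qed

lemma Gam_bilinear: "x \<in> U \<Longrightarrow> bilinear (Gam x)"
  using Gam_linear[of x] by (simp add: bilinear_def Gam_sym[of x])

text \<open>\<open>M y\<close> sends the symbol to a vector built from first derivatives of the
  metric. One derivative of the symbols is all that the curvature requires.\<close>

lemma Gam_differentiable: 
  assumes x: "x \<in> U"
  shows "(\<lambda>y. Gam y u v) differentiable (at x)"
proof (rule linear_system_differentiable[OF open_U x, of M])
  show "(\<lambda>y. M y b) differentiable (at x)" for b
    unfolding M_def by (intro differentiable_sum differentiable_scaleR finite_Basis ballI G_diff' x differentiable_const)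
  show "(\<lambda>y. \<Sum>b\<in>Basis. koszul y u v b *\<^sub>R b) differentiable (at x)"
    unfolding koszul_def dG_def divide_inverse
    by (intro differentiable_sum differentiable_scaleR finite_Basis ballI differentiable_const
        differentiable_add differentiable_diff differentiable_mult
        smooth_on_differentiable[OF smooth_on_Dr[OF G_smooth] x])
  show "M y (Gam y u v) = (\<Sum>b\<in>Basis. koszul y u v b *\<^sub>R b)" if y: "y \<in> U" for y
  proof -
    obtain z where "M y z = (\<Sum>b\<in>Basis. koszul y u v b *\<^sub>R b)" "\<forall>w. G y z w = koszul y u v w"
      using koszul_solution[OF y] by blast
    moreover from this have "Gam y u v = z" by (intro G_eqI[OF y]) (simp add: Gam_koszul[OF y])
    ultimately show ?thesis by simp
  qed
qed (simp_all add: M_linear M_inj x)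

section \<open>Covariant derivatives, curvature and Killing fields in coordinates\<close>

definition nab :: "('e \<Rightarrow> 'e) \<Rightarrow> 'e \<Rightarrow> 'e \<Rightarrow> 'e" where
  "nab V x u = Dr V x u + Gam x u (V x)"

definition Riem :: "'e \<Rightarrow> 'e \<Rightarrow> 'e \<Rightarrow> 'e \<Rightarrow> 'e" where
  "Riem x u v w = Dr (\<lambda>y. Gam y v w) x u - Dr (\<lambda>y. Gam y u w) x v
     + Gam x u (Gam x v w) - Gam x v (Gam x u w)"

lemma Riem_nab: "Riem x w z u = nab (\<lambda>y. Gam y z u) x w - nab (\<lambda>y. Gam y w u) x z"
  by (simp add: Riem_def nab_def)

lemma nab_const: "nab (\<lambda>y. u) x w = Gam x w u"
  by (simp add: nab_def)

lemma nab_linear: "x \<in> U \<Longrightarrow> V differentiable (at x) \<Longrightarrow> linear (nab V x)"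
  unfolding nab_def using linear_Dr[of V x] Gam_bilinear[of x]
  by (intro linear_compose_add) (auto simp: bilinear_def)

lemma G_product:
  assumes x: "x \<in> U" and V: "V differentiable (at x)" and W: "W differentiable (at x)"
  shows "((\<lambda>y. G y (V y) (W y)) has_derivative
    (\<lambda>u. G x (nab V x u) (W x) + G x (V x) (nab W x u))) (at x)"
proof -
  have "((\<lambda>y. G y (V y) (W y)) has_derivative
     (\<lambda>u. dG x u (V x) (W x) + G x (Dr V x u) (W x) + G x (V x) (Dr W x u))) (at x)"
    unfolding dG_def by (rule bilinear_family_has_derivative[OF open_U x bil G_diff'[OF x] V W])
  then show ?thesis by (simp add: Gam_compat[OF x] nab_def G_simps x algebra_simps)
qed

text \<open>The equation is the vanishing of the Lie derivative of the metric along
  \<open>\<xi>\<close>, evaluated on constant fields \<open>u\<close> and \<open>v\<close>.\<close>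

definition killing :: "('e \<Rightarrow> 'e) \<Rightarrow> bool" where
  "killing \<xi> \<longleftrightarrow> smooth_on U \<xi> \<and>
     (\<forall>x\<in>U. \<forall>u v. Dr (\<lambda>y. G y u v) x (\<xi> x) + G x (Dr \<xi> x u) v + G x u (Dr \<xi> x v) = 0)"

text \<open>For \<omega>(u,v) = G(Ju,v) the condition reads df = \<omega>(., \<xi>), the convention
  of \<open>moment_map\<close>.\<close>

definition hamiltonian :: "('e \<Rightarrow> 'e) \<Rightarrow> bool" where
  "hamiltonian \<xi> \<longleftrightarrow> (\<exists>f::'e \<Rightarrow> real. smooth_on U f \<and> (\<forall>x\<in>U. \<forall>u. Dr f x u = G x (J u) (\<xi> x)))"

lemma killing_differentiable: "killing \<xi> \<Longrightarrow> x \<in> U \<Longrightarrow> \<xi> differentiable (at x)"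
  unfolding killing_def using smooth_on_differentiable by blast

lemma killing_skew:
  assumes "killing \<xi>" "x \<in> U"
  shows "G x (nab \<xi> x u) v + G x u (nab \<xi> x v) = 0"
proof -
  have "dG x (\<xi> x) u v + G x (Dr \<xi> x u) v + G x u (Dr \<xi> x v) = 0"
    using assms unfolding killing_def dG_def by blast
  then show ?thesis
    unfolding Gam_compat[OF assms(2)] nab_def G_simps[OF assms(2)] Gam_sym[OF assms(2), of "\<xi> x"]
    by linarith
qed

lemma nab_differentiable:
  assumes "smooth_on U \<xi>" "x \<in> U"
  shows "(\<lambda>y. nab \<xi> y u) differentiable (at x)"
proof -
  have "(\<lambda>y. Gam y u (\<xi> y)) differentiable (at x)"
    using linear_family_has_derivative[OF open_U assms(2), of "\<lambda>y. Gam y u"] Gam_linear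
      Gam_differentiable[OF assms(2)] smooth_on_differentiable[OF assms]
    unfolding differentiable_def by blast
  then show ?thesis unfolding nab_def
    using smooth_on_differentiable[OF smooth_on_Dr[OF assms(1)] assms(2)] by (intro differentiable_add)
qed

text \<open>This is \<open>(\<nabla>\<^sub>w A) u\<close> for \<open>A = \<nabla>\<xi>\<close>; the
  subtracted term accounts for \<open>u\<close> being constant only in coordinates.\<close>

definition nab2 :: "('e \<Rightarrow> 'e) \<Rightarrow> 'e \<Rightarrow> 'e \<Rightarrow> 'e \<Rightarrow> 'e" where
  "nab2 \<xi> x w u = nab (\<lambda>y. nab \<xi> y u) x w - nab \<xi> x (Gam x w u)"

text \<open>Skewness of \<open>nab \<xi>\<close> survives covariant differentiation because the
  metric is parallel.\<close>

lemma nab2_skew: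
  assumes k: "killing \<xi>" and x: "x \<in> U"
  shows "G x (nab2 \<xi> x w u) v + G x u (nab2 \<xi> x w v) = 0"
proof -
  have s: "smooth_on U \<xi>" using k by (simp add: killing_def)
  have "((\<lambda>y. G y (nab \<xi> y u) v + G y u (nab \<xi> y v)) has_derivative
     (\<lambda>w. (G x (nab (\<lambda>y. nab \<xi> y u) x w) v + G x (nab \<xi> x u) (nab (\<lambda>y. v) x w)) +
      (G x (nab (\<lambda>y. u) x w) (nab \<xi> x v) + G x u (nab (\<lambda>y. nab \<xi> y v) x w)))) (at x)"
    by (intro has_derivative_add G_product x nab_differentiable s differentiable_const)
  moreover have "((\<lambda>y. G y (nab \<xi> y u) v + G y u (nab \<xi> y v)) has_derivative (\<lambda>w. 0)) (at x)"
    by (rule has_derivative_cong_openI[OF has_derivative_const open_U x]) (rule killing_skew[OF k])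
  ultimately have "(G x (nab (\<lambda>y. nab \<xi> y u) x w) v + G x (nab \<xi> x u) (Gam x w v)) +
      (G x (Gam x w u) (nab \<xi> x v) + G x u (nab (\<lambda>y. nab \<xi> y v) x w)) = 0"
    unfolding nab_const by (metis (no_types, lifting) has_derivative_unique)
  then show ?thesis
    unfolding nab2_def G_simps[OF x]
    using killing_skew[OF k x, of u "Gam x w v"] killing_skew[OF k x, of "Gam x w u" v] by linarith
qed

text \<open>Mixed second derivatives of \<open>G y u v\<close> agree. In their difference the
  products pairing two Christoffel symbols are symmetric in \<open>w\<close> and \<open>z\<close>
  and cancel; the curvature terms remain.\<close>

lemma Riem_skew:
  assumes x: "x \<in> U"
  shows "G x (Riem x w z u) v + G x u (Riem x w z v) = 0"
proof -
  have d: "Dr (\<lambda>y. Dr (\<lambda>y. G y u v) y z) x w =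
     (G x (nab (\<lambda>y. Gam y z u) x w) v + G x (Gam x z u) (nab (\<lambda>y. v) x w)) +
     (G x (nab (\<lambda>y. u) x w) (Gam x z v) + G x u (nab (\<lambda>y. Gam y z v) x w))" for z w
  proof -
    have "((\<lambda>y. G y (Gam y z u) v + G y u (Gam y z v)) has_derivative
      (\<lambda>w. (G x (nab (\<lambda>y. Gam y z u) x w) v + G x (Gam x z u) (nab (\<lambda>y. v) x w)) +
      (G x (nab (\<lambda>y. u) x w) (Gam x z v) + G x u (nab (\<lambda>y. Gam y z v) x w)))) (at x)"
      by (intro has_derivative_add G_product x Gam_differentiable differentiable_const)
    then have "((\<lambda>y. Dr (\<lambda>y. G y u v) y z) has_derivative
      (\<lambda>w. (G x (nab (\<lambda>y. Gam y z u) x w) v + G x (Gam x z u) (nab (\<lambda>y. v) x w)) +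
      (G x (nab (\<lambda>y. u) x w) (Gam x z v) + G x u (nab (\<lambda>y. Gam y z v) x w)))) (at x)"
      by (rule has_derivative_cong_openI[OF _ open_U x]) (rule Gam_compat[unfolded dG_def])
    then show ?thesis by (simp add: Dr_eq)
  qed
  have "Dr (\<lambda>y. Dr (\<lambda>y. G y u v) y z) x w = Dr (\<lambda>y. Dr (\<lambda>y. G y u v) y w) x z"
    by (rule Dr_symmetric[OF open_U x G_smooth])
  then show ?thesis unfolding d nab_const Riem_nab G_simps[OF x] by linarith
qed

text \<open>Alternating the symmetry in the first two slots with the skewness in the last two brings
  \<open>w\<close>, \<open>u\<close>, \<open>v\<close> back to their places after three changes of
  sign.\<close>

lemma skew_symmetric_form_zero:
  fixes T :: "'e \<Rightarrow> 'e \<Rightarrow> 'e"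
  assumes x: "x \<in> U" and sym: "\<And>u v. T u v = T v u" and skew: "\<And>w u v. G x (T w u) v + G x u (T w v) = 0"
  shows "T w u = 0"
proof (rule G_eqI[OF x])
  have s: "G x (T w u) v = - G x (T w v) u" for w u v
    using skew[of w u v] G_sym[OF x, of u] by simp
  fix v
  have "G x (T w u) v = - G x (T w u) v"
    using s[of u w v] s[of v u w] s[of w v u] sym[of w u] sym[of u v] sym[of v w] by simp
  then show "G x (T w u) v = G x 0 v" using G_scale_left[OF x, of 0] by simp
qed

text \<open>The difference of the two sides is the Lie derivative of the connection along
  \<open>\<xi>\<close>: symmetric because the connection has no torsion, and skew for the metric by
  \<open>nab2_skew\<close> and \<open>Riem_skew\<close>. Such a tensor vanishes.\<close>

lemma killing_second_derivative:
  assumes k: "killing \<xi>" and x: "x \<in> U"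
  shows "nab2 \<xi> x w u = Riem x w (\<xi> x) u"
proof -
  have s: "smooth_on U \<xi>" using k by (simp add: killing_def)
  have d: "Dr (\<lambda>y. nab \<xi> y u) x w = Dr (\<lambda>y. Dr \<xi> y u) x w + (Dr (\<lambda>y. Gam y u (\<xi> x)) x w + Gam x u (Dr \<xi> x w))" for u w
  proof -
    have "((\<lambda>y. nab \<xi> y u) has_derivative
      (\<lambda>w. Dr (\<lambda>y. Dr \<xi> y u) x w + (Dr (\<lambda>y. Gam y u (\<xi> x)) x w + Gam x u (Dr \<xi> x w)))) (at x)"
      unfolding nab_def
      by (intro has_derivative_add linear_family_has_derivative[OF open_U x] Gam_linear Gam_differentiable x
          Dr_works smooth_on_differentiable[OF smooth_on_Dr[OF s] x] smooth_on_differentiable[OF s x])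
    then show ?thesis by (simp add: Dr_eq)
  qed
  define T where "T w u = nab2 \<xi> x w u - Riem x w (\<xi> x) u" for w u
  have c: "Dr (\<lambda>y. Gam y u v) x w = Dr (\<lambda>y. Gam y v u) x w" for u v w
    using Dr_cong[OF open_U x, of "\<lambda>y. Gam y u v" "\<lambda>y. Gam y v u"] Gam_sym by simp
  \<comment> \<open>Written out, the expression is symmetric in \<open>w\<close> and
    \<open>u\<close> as soon as second derivatives commute.\<close>
  have "T w u = Dr (\<lambda>y. Dr \<xi> y u) x w + Gam x u (Dr \<xi> x w) + Gam x w (Dr \<xi> x u) - nab \<xi> x (Gam x w u)
     + Dr (\<lambda>y. Gam y w u) x (\<xi> x) + Gam x (\<xi> x) (Gam x w u)" for w u
    unfolding T_def nab2_def Riem_def nab_def[of "\<lambda>y. nab \<xi> y u"] d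
    unfolding nab_def[of \<xi> x u] linear_add[OF Gam_linear[OF x]]
    by (simp add: c[of u "\<xi> x"] Gam_sym[OF x, of "\<xi> x" u])
  then have "T w u = T u w" for w u
    using Dr_symmetric[OF open_U x s, of u w] c[of w u] Gam_sym[OF x, of w u] by simp
  moreover have "G x (T w u) v + G x u (T w v) = 0" for w u v
    unfolding T_def G_simps[OF x] using nab2_skew[OF k x, of w u v] Riem_skew[OF x, of w "\<xi> x" u v] by linarith
  ultimately have "T w u = 0" by (rule skew_symmetric_form_zero[OF x])
  then show ?thesis by (simp add: T_def)
qed

section \<open>Parallelism of the complex structure and its consequences\<close>

lemma J_add: "J (u + v) = J u + J v" and J_diff: "J (u - v) = J u - J v"
  using J_linear by (simp_all add: linear_add linear_diff)

text \<open>This is \<nabla>J = 0. The Koszul formula reduces it to derivatives of the metric;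
  closedness of \<omega> is used for the triples (u, v, w) and (u, Jv, Jw), and the rest is moving
  \<open>J\<close> across \<open>dG\<close>.\<close>

lemma Gam_J:
  assumes x: "x \<in> U"
  shows "Gam x u (J v) = J (Gam x u v)"
proof (rule G_eqI[OF x])
  fix w
  have cl: "dG x u (J v) w + dG x v (J w) u + dG x w (J u) v = 0" for u v w
    using closed[OF x] unfolding dG_def .
  have JJ2: "dG x u (J v) (J w) = dG x u v w" for u v w
    unfolding dG_def using Dr_cong[OF open_U x, of "\<lambda>y. G y (J v) (J w)" "\<lambda>y. G y v w"] GJJ by simp
  have Jm: "dG x u (- v) w = - dG x u v w" for u v w
    using linear_neg[OF dG_linear2[OF x]] .
  have sk: "dG x u v (J w) = - dG x u (J v) w" for u v w
    using JJ2[of u "J v" w] by (simp add: JJ Jm)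
  have e1: "dG x u (J v) w + dG x v (J w) u + dG x w (J u) v = 0" by (rule cl)
  have e2: "dG x u (J v) w - dG x (J v) w u + dG x (J w) u v = 0"
    using cl[of u "J v" "J w"] sk[of u v w] by (simp add: JJ JJ2 Jm)
  have "G x (Gam x u (J v)) w = (dG x u (J v) w + dG x (J v) u w - dG x w u (J v)) / 2"
    by (simp add: Gam_koszul[OF x] koszul_def)
  moreover have "G x (J (Gam x u v)) w = - ((dG x u v (J w) + dG x v u (J w) - dG x (J w) u v) / 2)"
    by (simp add: GJ_skew[OF x] Gam_koszul[OF x] koszul_def)
  ultimately show "G x (Gam x u (J v)) w = G x (J (Gam x u v)) w"
    using e1 e2 sk[of u v w] sk[of w u v] dG_sym[OF x, of v "J w" u] dG_sym[OF x, of "J v" w u] by argo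
qed

text \<open>Since \<open>J\<close> is parallel, the symmetry of the second derivatives of
  \<open>f\<close> makes \<open>G x (J u) (nab \<xi> x w)\<close> symmetric in \<open>u\<close> and
  \<open>w\<close>. Combined with the skewness of \<open>nab \<xi>\<close> this is commutation with
  \<open>J\<close>.\<close>

lemma nab_J:
  assumes k: "killing \<xi>" and h: "hamiltonian \<xi>" and x: "x \<in> U"
  shows "nab \<xi> x (J u) = J (nab \<xi> x u)"
proof (rule G_eqI[OF x])
  fix w
  obtain f :: "'e \<Rightarrow> real" where f: "smooth_on U f" "\<And>y u. y \<in> U \<Longrightarrow> Dr f y u = G y (J u) (\<xi> y)"
    using h unfolding hamiltonian_def by blast
  have d: "Dr (\<lambda>y. Dr f y u) x w = G x (Gam x w (J u)) (\<xi> x) + G x (J u) (nab \<xi> x w)" for u w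
  proof -
    have "((\<lambda>y. G y (J u) (\<xi> y)) has_derivative
       (\<lambda>w. G x (nab (\<lambda>y. J u) x w) (\<xi> x) + G x (J u) (nab \<xi> x w))) (at x)"
      by (intro G_product x killing_differentiable[OF k] differentiable_const)
    then have "((\<lambda>y. Dr f y u) has_derivative
       (\<lambda>w. G x (nab (\<lambda>y. J u) x w) (\<xi> x) + G x (J u) (nab \<xi> x w))) (at x)"
      by (rule has_derivative_cong_openI[OF _ open_U x]) (rule f(2))
    then show ?thesis by (simp add: Dr_eq nab_const)
  qed
  have "G x (J u) (nab \<xi> x w) = G x (J w) (nab \<xi> x u)"
    using Dr_symmetric[OF open_U x f(1), of u w] unfolding d Gam_J[OF x] Gam_sym[OF x, of w u] by simp
  moreover have "G x (nab \<xi> x (J u)) w = - G x (J u) (nab \<xi> x w)"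
    using killing_skew[OF k x, of "J u" w] by simp
  moreover have "G x (J w) (nab \<xi> x u) = - G x (J (nab \<xi> x u)) w"
    using G_sym[OF x, of "J w" "nab \<xi> x u"] GJ_skew[OF x, of "nab \<xi> x u" w] by simp
  ultimately show "G x (nab \<xi> x (J u)) w = G x (J (nab \<xi> x u)) w" by simp
qed

lemma bounded_linear_J: "bounded_linear J"
  using J_linear by (simp add: linear_conv_bounded_linear)

lemma Riem_J:
  assumes x: "x \<in> U"
  shows "Riem x w z (J u) = J (Riem x w z u)"
proof -
  have "Dr (\<lambda>y. Gam y z (J u)) x = Dr (\<lambda>y. J (Gam y z u)) x" for z
    by (rule Dr_cong[OF open_U x]) (rule Gam_J)
  then have "Dr (\<lambda>y. Gam y z (J u)) x w = J (Dr (\<lambda>y. Gam y z u) x w)" for z w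
    by (simp add: Dr_bounded_linear_compose[OF bounded_linear_J Gam_differentiable[OF x]])
  then show ?thesis unfolding Riem_def by (simp add: Gam_J[OF x] J_add J_diff)
qed

text \<open>The product rule for the operator field \<open>nab \<xi>\<close> applied to
  \<open>\<eta>\<close>, in covariant terms. The derivative on the left is an ordinary one, hence
  the correction by \<open>Gam x w\<close> at the end.\<close>

lemma nab_apply:
  assumes s: "smooth_on U \<xi>" and x: "x \<in> U" and \<eta>: "\<eta> differentiable (at x)"
  shows "((\<lambda>y. nab \<xi> y (\<eta> y)) has_derivative
      (\<lambda>w. nab2 \<xi> x w (\<eta> x) + nab \<xi> x (nab \<eta> x w) - Gam x w (nab \<xi> x (\<eta> x)))) (at x)"
proof -
  have lin: "linear (nab \<xi> y)" if "y \<in> U" for y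
    by (rule nab_linear[OF that smooth_on_differentiable[OF s that]])
  have "((\<lambda>y. nab \<xi> y (\<eta> y)) has_derivative
      (\<lambda>w. Dr (\<lambda>y. nab \<xi> y (\<eta> x)) x w + nab \<xi> x (Dr \<eta> x w))) (at x)"
    by (intro linear_family_has_derivative[OF open_U x] lin nab_differentiable s x \<eta>)
  moreover have "nab \<xi> x (Dr \<eta> x w) = nab \<xi> x (nab \<eta> x w) - nab \<xi> x (Gam x w (\<eta> x))" for w
    unfolding nab_def[of \<eta>] linear_add[OF lin[OF x]] by simp
  moreover have "Dr (\<lambda>y. nab \<xi> y (\<eta> x)) x w = nab2 \<xi> x w (\<eta> x) + nab \<xi> x (Gam x w (\<eta> x)) - Gam x w (nab \<xi> x (\<eta> x))" for w
    unfolding nab2_def nab_def[of "\<lambda>y. nab \<xi> y (\<eta> x)"] by simp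
  ultimately show ?thesis by (simp add: algebra_simps)
qed

text \<open>The commutator of \<open>\<nabla>\<xi>\<close> and \<open>\<nabla>\<eta>\<close> drops out of the trace because both commute with \<open>J\<close>.\<close>

lemma trace_nab_bracket:
  assumes \<xi>: "killing \<xi>" "hamiltonian \<xi>" and \<eta>: "killing \<eta>" "hamiltonian \<eta>" and x: "x \<in> U"
    and Z: "\<And>y. y \<in> U \<Longrightarrow> Z y = Dr \<xi> y (\<eta> y) - Dr \<eta> y (\<xi> y)"
  shows "tr (\<lambda>w. J (nab Z x w)) = tr (\<lambda>w. Riem x w (\<xi> x) (J (\<eta> x))) - tr (\<lambda>w. Riem x w (\<eta> x) (J (\<xi> x)))"
proof -
  have s: "smooth_on U \<xi>" "smooth_on U \<eta>" using \<xi> \<eta> by (auto simp: killing_def)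
  have lin: "linear (nab \<xi> x)" "linear (nab \<eta> x)"
    using \<xi> \<eta> x by (auto intro: nab_linear killing_differentiable)
  \<comment> \<open>The connection has no torsion, so the Christoffel terms cancel in the
    difference.\<close>
  have Z': "Z y = nab \<xi> y (\<eta> y) - nab \<eta> y (\<xi> y)" if "y \<in> U" for y
    using Z[OF that] Gam_sym[OF that, of "\<xi> y"] by (simp add: nab_def)
  have "(Z has_derivative (\<lambda>w. (nab2 \<xi> x w (\<eta> x) + nab \<xi> x (nab \<eta> x w) - Gam x w (nab \<xi> x (\<eta> x))) -
     (nab2 \<eta> x w (\<xi> x) + nab \<eta> x (nab \<xi> x w) - Gam x w (nab \<eta> x (\<xi> x))))) (at x)"
    by (rule has_derivative_cong_openI[OF has_derivative_diff[OF
            nab_apply[OF s(1) x killing_differentiable[OF \<eta>(1) x]]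
            nab_apply[OF s(2) x killing_differentiable[OF \<xi>(1) x]]] open_U x Z'])
  then have n: "nab Z x w = Riem x w (\<xi> x) (\<eta> x) - Riem x w (\<eta> x) (\<xi> x) +
      (nab \<xi> x (nab \<eta> x w) - nab \<eta> x (nab \<xi> x w))" for w
    unfolding nab_def[of Z] Z'[OF x] linear_diff[OF Gam_linear[OF x]]
    by (simp add: Dr_eq killing_second_derivative[OF \<xi>(1) x] killing_second_derivative[OF \<eta>(1) x])
  have "tr (\<lambda>w. nab \<xi> x (J (nab \<eta> x w))) = tr (\<lambda>w. J (nab \<eta> x (nab \<xi> x w)))"
    by (rule tr_commute[OF lin(1) linear_compose[OF lin(2) J_linear, unfolded o_def]])
  \<comment> \<open>Moving \<open>J\<close> inside the curvature gives the two remaining traces the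
    shape of the Ricci tensor.\<close>
  then show ?thesis
    unfolding n J_add J_diff Riem_J[OF x, symmetric] tr_add tr_diff
    by (simp add: nab_J[OF \<xi> x, symmetric])
qed

end


section \<open>Charts and components\<close>

abbreviation cim :: "('m, 'e) chart \<Rightarrow> 'e set" where "cim c \<equiv> cmap c ` cdom c"

lemma chart_open:
  assumes "is_chart c"
  shows "open (cdom c)" "open (cim c)"
  using assms by (auto simp: is_chart_def)

lemma chart_inverse:
  assumes "is_chart c"
  shows "p \<in> cdom c \<Longrightarrow> cinv c (cmap c p) = p"
    and "x \<in> cim c \<Longrightarrow> cmap c (cinv c x) = x"
    and "x \<in> cim c \<Longrightarrow> cinv c x \<in> cdom c"
  using assms by (auto simp: is_chart_def homeomorphism_def)

lemma chart_inj: "is_chart c \<Longrightarrow> inj_on (cmap c) (cdom c)"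
  by (rule inj_on_inverseI[of _ "cinv c"]) (rule chart_inverse)

lemma chart_continuous:
  assumes "is_chart c"
  shows "continuous_on (cdom c) (cmap c)" "continuous_on (cim c) (cinv c)"
  using assms by (auto simp: is_chart_def homeomorphism_def)

lemma chart_image_eq:
  assumes "is_chart c"
  shows "cmap c ` (cdom c \<inter> W) = {x \<in> cim c. cinv c x \<in> W}"
  using chart_inverse[OF assms] by force

lemma chart_image_open:
  assumes "is_chart c" "open W"
  shows "open (cmap c ` (cdom c \<inter> W))"
proof -
  have "open (cim c \<inter> cinv c -` W)"
    using continuous_open_preimage[OF chart_continuous(2) chart_open(2)] assms by blast
  moreover have "cim c \<inter> cinv c -` W = cmap c ` (cdom c \<inter> W)"
    unfolding chart_image_eq[OF assms(1)] by auto
  ultimately show ?thesis by simp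
qed

lemma atlas_chart: "smooth_atlas A \<Longrightarrow> c \<in> A \<Longrightarrow> is_chart c"
  by (simp add: smooth_atlas_def)

lemma chart_at_in:
  assumes "smooth_atlas A"
  shows "chart_at A p \<in> A" "p \<in> cdom (chart_at A p)"
proof -
  have "\<exists>c. c \<in> A \<and> p \<in> cdom c" using assms unfolding smooth_atlas_def by blast
  then have "chart_at A p \<in> A \<and> p \<in> cdom (chart_at A p)"
    unfolding chart_at_def by (rule someI_ex)
  then show "chart_at A p \<in> A" "p \<in> cdom (chart_at A p)" by auto
qed

lemma transition_smooth:
  assumes "smooth_atlas A" "c \<in> A" "d \<in> A"
  shows "smooth_on (cmap c ` (cdom c \<inter> cdom d)) (\<lambda>x. cmap d (cinv c x))"
  using assms unfolding smooth_atlas_def smooth_transition_def by (simp add: o_def)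

lemma rep_open:
  assumes "smooth_map_on A B W f" "open W" "is_chart c" "is_chart d"
  shows "open (cmap c ` (cdom c \<inter> W \<inter> f -` cdom d))"
proof -
  have "continuous_on W f" using assms(1) by (simp add: smooth_map_on_def)
  then have "open (W \<inter> f -` cdom d)"
    using assms(2) chart_open(1)[OF assms(4)] by (rule continuous_open_preimage)
  then show ?thesis using chart_image_open[OF assms(3)] by (simp add: Int_assoc)
qed

lemma rep_smooth:
  assumes "smooth_map_on A B W f" "c \<in> A" "d \<in> B"
  shows "smooth_on (cmap c ` (cdom c \<inter> W \<inter> f -` cdom d)) (\<lambda>x. cmap d (f (cinv c x)))"
  using assms by (simp add: smooth_map_on_def o_def)

lemma rep_differentiable:
  assumes "smooth_map_on A B W f" "c \<in> A" "d \<in> B" "p \<in> cdom c" "p \<in> W" "f p \<in> cdom d"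
  shows "(\<lambda>x. cmap d (f (cinv c x))) differentiable (at (cmap c p))"
  using assms by (intro smooth_on_differentiable[OF rep_smooth[OF assms(1-3)]]) auto

section \<open>Components of tangent vectors and of differentials\<close>

lemma vector_chart: "cinv (UNIV, \<lambda>x. x) = (\<lambda>x. x)"
  by (simp add: cinv_def fun_eq_iff inv_into_def)

lemma chart_at_vector: "chart_at vector_atlas p = (UNIV, \<lambda>x. x)"
  unfolding chart_at_def vector_atlas_def by (rule some_equality) auto

text \<open>The differential of the chart \<open>c\<close> at \<open>p\<close>, on vectors given in
  the preferred chart; it is inverse to \<open>chart_vec\<close>.\<close>

definition coord :: "('m, 'e::real_normed_vector) chart set \<Rightarrow> ('m, 'e) chart \<Rightarrow> 'm \<Rightarrow> 'e \<Rightarrow> 'e" where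
  "coord A c p = Dr (\<lambda>x. cmap c (cinv (chart_at A p) x)) (cmap (chart_at A p) p)"

lemma coord_mderiv: "mderiv A vector_atlas (cmap c) p = coord A c p"
  by (simp add: mderiv_def coord_def chart_at_vector o_def)

lemma field_comp_coord: "field_comp A c V x = coord A c (cinv c x) (V (cinv c x))"
  by (simp add: field_comp_def coord_mderiv)

lemma transition_differentiable:
  assumes "smooth_atlas A" "c \<in> A" "d \<in> A" "p \<in> cdom c" "p \<in> cdom d"
  shows "(\<lambda>x. cmap d (cinv c x)) differentiable (at (cmap c p))"
  using assms by (intro smooth_on_differentiable[OF transition_smooth[OF assms(1-3)]]) auto

lemma Dr_identity:
  assumes "open S" "x \<in> S" "\<And>y. y \<in> S \<Longrightarrow> f y = y"
  shows "Dr f x u = u"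
  using Dr_cong[OF assms] by simp

text \<open>\<open>F\<close> takes values in a vector space, so that the change of the source chart
  is isolated; changing the target is a plain chain rule.\<close>

lemma rep_change_source:
  assumes A: "smooth_atlas A" "c \<in> A" "c' \<in> A" "p \<in> cdom c" "p \<in> cdom c'"
    and f: "(\<lambda>x. F (cinv c x)) differentiable (at (cmap c p))"
  shows "Dr (\<lambda>x. F (cinv c' x)) (cmap c' p) u =
     Dr (\<lambda>x. F (cinv c x)) (cmap c p) (Dr (\<lambda>x. cmap c (cinv c' x)) (cmap c' p) u)"
proof -
  note ch = atlas_chart[OF A(1,2)] atlas_chart[OF A(1,3)]
  let ?O = "cmap c' ` (cdom c' \<inter> cdom c)"
  have *: "Dr (\<lambda>x. F (cinv c' x)) (cmap c' p) = Dr (\<lambda>x. F (cinv c (cmap c (cinv c' x)))) (cmap c' p)"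
    using A(4,5) by (intro Dr_cong[OF chart_image_open[OF ch(2) chart_open(1)[OF ch(1)]]])
      (auto simp: chart_inverse[OF ch(1)] chart_inverse[OF ch(2)])
  show ?thesis
    unfolding *
    using Dr_compose[OF transition_differentiable[OF A(1,3,2,5,4)], of "\<lambda>x. F (cinv c x)"] f A(5)
    by (simp add: chart_inverse[OF ch(2)])
qed

lemma coord_inverse:
  assumes A: "smooth_atlas A" "c \<in> A" "p \<in> cdom c"
  shows "coord A c p (chart_vec A c (cmap c p) u) = u"
    and "chart_vec A c (cmap c p) (coord A c p u) = u"
proof -
  let ?c' = "chart_at A p"
  note ch = chart_at_in[OF A(1)]
  note isc = atlas_chart[OF A(1,2)] atlas_chart[OF A(1) ch(1)[of p]]
  have cv: "chart_vec A c (cmap c p) = Dr (\<lambda>x. cmap ?c' (cinv c x)) (cmap c p)"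
    using A by (intro ext) (simp add: chart_vec_def mderiv_def chart_at_vector vector_chart o_def chart_inverse[OF isc(1)])
  have 1: "Dr (\<lambda>x. cmap c (cinv ?c' x)) (cmap ?c' p) (Dr (\<lambda>x. cmap ?c' (cinv c x)) (cmap c p) u) =
      Dr (\<lambda>x. cmap c (cinv c x)) (cmap c p) u" for u
    by (rule rep_change_source[symmetric]) (use A ch in \<open>auto intro: transition_differentiable\<close>)
  have 2: "Dr (\<lambda>x. cmap ?c' (cinv c x)) (cmap c p) (Dr (\<lambda>x. cmap c (cinv ?c' x)) (cmap ?c' p) u) =
      Dr (\<lambda>x. cmap ?c' (cinv ?c' x)) (cmap ?c' p) u" for u
    by (rule rep_change_source[symmetric]) (use A ch in \<open>auto intro: transition_differentiable\<close>)
  have 3: "Dr (\<lambda>x. cmap d (cinv d x)) (cmap d p) u = u" if "is_chart d" "p \<in> cdom d" for d :: "('a, 'b) chart" and u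
    using that by (intro Dr_identity[OF chart_open(2)]) (auto simp: chart_inverse)
  show "coord A c p (chart_vec A c (cmap c p) u) = u"
    unfolding cv coord_def 1 by (rule 3) (use isc A in auto)
  show "chart_vec A c (cmap c p) (coord A c p u) = u"
    unfolding cv coord_def 2 by (rule 3) (use isc ch in auto)
qed

lemma coord_chart_at:
  assumes "smooth_atlas A"
  shows "coord A (chart_at A p) p u = u"
  unfolding coord_def using chart_at_in[OF assms, of p] atlas_chart[OF assms chart_at_in(1)[OF assms, of p]]
  by (intro Dr_identity[OF chart_open(2)]) (auto simp: chart_inverse)

lemma chart_vec_chart_at:
  assumes "smooth_atlas A"
  shows "chart_vec A (chart_at A p) (cmap (chart_at A p) p) u = u"
  using coord_inverse(2)[OF assms chart_at_in[OF assms], of p u] coord_chart_at[OF assms] by simp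

lemma coord_linear:
  assumes "smooth_atlas A" "c \<in> A" "p \<in> cdom c"
  shows "linear (coord A c p)"
  unfolding coord_def
  using assms chart_at_in[OF assms(1)] by (intro linear_Dr transition_differentiable) auto

lemma chart_vec_linear:
  assumes A: "smooth_atlas A" "c \<in> A" "x \<in> cim c"
  shows "linear (chart_vec A c x)"
proof -
  obtain p where p: "p \<in> cdom c" "x = cmap c p" using A by blast
  have l: "linear (coord A c p)" by (rule coord_linear[OF A(1,2) p(1)])
  note inv = coord_inverse[OF A(1,2) p(1)]
  show ?thesis unfolding p(2)
    by (rule linearI) (metis inv linear_add[OF l], metis inv linear_scale[OF l])
qed

lemma chart_vec_field_comp:
  assumes "smooth_atlas A" "c \<in> A" "x \<in> cim c"
  shows "chart_vec A c x (field_comp A c V x) = V (cinv c x)"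
  using coord_inverse(2)[OF assms(1,2), of "cinv c x" "V (cinv c x)"] assms
  by (simp add: field_comp_coord chart_inverse[OF atlas_chart[OF assms(1,2)]])

text \<open>Frees differentials from the preferred charts built into \<open>mderiv\<close>:
  computations may use whatever charts of the two atlases are convenient.\<close>

lemma coord_mderiv_eq:
  assumes A: "smooth_atlas A" "c \<in> A" "p \<in> cdom c" and B: "smooth_atlas B" "d \<in> B" "f p \<in> cdom d"
    and f: "smooth_map_on A B W f" "open W" "p \<in> W"
  shows "coord B d (f p) (mderiv A B f p u) = Dr (\<lambda>x. cmap d (f (cinv c x))) (cmap c p) (coord A c p u)"
proof -
  let ?c' = "chart_at A p" and ?d' = "chart_at B (f p)"
  note cA = chart_at_in[OF A(1)] and cB = chart_at_in[OF B(1)]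
  note isA = atlas_chart[OF A(1)] and isB = atlas_chart[OF B(1)]
  have dc': "(\<lambda>x. cmap ?d' (f (cinv ?c' x))) differentiable (at (cmap ?c' p))"
    by (rule rep_differentiable[OF f(1)]) (use cA cB f in auto)
  have dc: "(\<lambda>x. cmap d (f (cinv c x))) differentiable (at (cmap c p))"
    by (rule rep_differentiable[OF f(1)]) (use A B f in auto)
  have e: "cinv ?c' (cmap ?c' p) = p" by (simp add: chart_inverse[OF isA[OF cA(1)]] cA)
  have "Dr (\<lambda>x. cmap d (cinv ?d' (cmap ?d' (f (cinv ?c' x))))) (cmap ?c' p) =
      (\<lambda>u. coord B d (f p) (mderiv A B f p u))"
    unfolding coord_def mderiv_def
    using Dr_compose[OF dc', of "\<lambda>x. cmap d (cinv ?d' x)"] transition_differentiable[OF B(1) cB(1) B(2) cB(2) B(3)]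
    by (simp add: e o_def)
  moreover have "Dr (\<lambda>x. cmap d (cinv ?d' (cmap ?d' (f (cinv ?c' x))))) (cmap ?c' p) =
      Dr (\<lambda>x. cmap d (f (cinv ?c' x))) (cmap ?c' p)"
    using f(3) cA cB
    by (intro Dr_cong[OF rep_open[OF f(1,2) isA[OF cA(1)[of p]] isB[OF cB(1)[of "f p"]]]])
      (auto simp: chart_inverse[OF isA[OF cA(1)]] chart_inverse[OF isB[OF cB(1)]])
  moreover have "Dr (\<lambda>x. cmap d (f (cinv ?c' x))) (cmap ?c' p) u =
     Dr (\<lambda>x. cmap d (f (cinv c x))) (cmap c p) (coord A c p u)" for u
    unfolding coord_def
    by (rule rep_change_source[where F = "\<lambda>x. cmap d (f x)"]) (use A cA dc in auto)
  ultimately show ?thesis by metis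
qed

lemma mderiv_chart_vec:
  assumes A: "smooth_atlas A" "c \<in> A" "x \<in> cim c" and B: "smooth_atlas B" "d \<in> B" "f (cinv c x) \<in> cdom d"
    and f: "smooth_map A B f"
  shows "mderiv A B f (cinv c x) (chart_vec A c x u) =
     chart_vec B d (cmap d (f (cinv c x))) (Dr (\<lambda>x. cmap d (f (cinv c x))) x u)"
proof -
  note ch = chart_inverse[OF atlas_chart[OF A(1,2)]]
  have p: "cinv c x \<in> cdom c" "cmap c (cinv c x) = x" using A ch by auto
  show ?thesis
    using coord_mderiv_eq[OF A(1,2) p(1) B f open_UNIV UNIV_I, of "chart_vec A c x u"]
      coord_inverse(2)[OF B, of "mderiv A B f (cinv c x) (chart_vec A c x u)"]
      coord_inverse(1)[OF A(1,2) p(1), of u]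
    by (simp add: p(2))
qed

lemma cinv_prod:
  fixes c :: "('m::topological_space, 'e::real_normed_vector) chart"
    and d :: "('n::topological_space, 'f::real_normed_vector) chart"
  assumes "is_chart c" "is_chart d" "x \<in> cim c" "y \<in> cim d"
  shows "cinv (cdom c \<times> cdom d, map_prod (cmap c) (cmap d)) (x, y) = (cinv c x, cinv d y)"
  unfolding cinv_def
proof (rule inv_into_f_eq)
  show "inj_on (cmap (cdom c \<times> cdom d, map_prod (cmap c) (cmap d))) (cdom (cdom c \<times> cdom d, map_prod (cmap c) (cmap d)))"
    using map_prod_inj_on[OF chart_inj[OF assms(1)] chart_inj[OF assms(2)]] by simp
qed (use assms chart_inverse(2,3)[OF assms(1,3)] chart_inverse(2,3)[OF assms(2,4)] in \<open>auto simp: cinv_def[symmetric]\<close>)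

text \<open>Unpacks smoothness for a product atlas into joint smoothness in two variables, the form
  used for the multiplication and for the action.\<close>

lemma prod_rep:
  assumes A: "smooth_atlas A" "c \<in> A" and B: "smooth_atlas B" "d \<in> B" and C: "smooth_atlas C" "k \<in> C"
    and f: "smooth_map (prod_atlas A B) C (\<lambda>(a, b). h a b)"
  defines "S \<equiv> {(x, y). x \<in> cim c \<and> y \<in> cim d \<and> h (cinv c x) (cinv d y) \<in> cdom k}"
  shows "open S" "smooth_on S (\<lambda>(x, y). cmap k (h (cinv c x) (cinv d y)))"
proof -
  let ?cd = "(cdom c \<times> cdom d, map_prod (cmap c) (cmap d))"
  note isc = atlas_chart[OF A] atlas_chart[OF B] atlas_chart[OF C]
  have cont: "continuous_on (cim c \<times> cim d) (\<lambda>z. case (cinv c (fst z), cinv d (snd z)) of (a, b) \<Rightarrow> h a b)"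
  proof -
    have c: "continuous_on UNIV (\<lambda>(a, b). h a b)" using f by (simp add: smooth_map_on_def)
    have "continuous_on (cim c \<times> cim d) (\<lambda>z. cinv c (fst z))"
      by (rule continuous_on_compose2[OF chart_continuous(2)[OF isc(1)] continuous_on_fst[OF continuous_on_id]]) auto
    moreover have "continuous_on (cim c \<times> cim d) (\<lambda>z. cinv d (snd z))"
      by (rule continuous_on_compose2[OF chart_continuous(2)[OF isc(2)] continuous_on_snd[OF continuous_on_id]]) auto
    ultimately have "continuous_on (cim c \<times> cim d) (\<lambda>z. (cinv c (fst z), cinv d (snd z)))"
      by (rule continuous_on_Pair)
    from continuous_on_compose2[OF c this] show ?thesis by simp
  qed
  have "open ((cim c \<times> cim d) \<inter> (\<lambda>z. case (cinv c (fst z), cinv d (snd z)) of (a, b) \<Rightarrow> h a b) -` cdom k)"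
    by (rule continuous_open_preimage[OF cont open_Times[OF chart_open(2)[OF isc(1)] chart_open(2)[OF isc(2)]] chart_open(1)[OF isc(3)]])
  moreover have "(cim c \<times> cim d) \<inter> (\<lambda>z. case (cinv c (fst z), cinv d (snd z)) of (a, b) \<Rightarrow> h a b) -` cdom k = S"
    unfolding S_def by auto
  ultimately show op: "open S" by simp
  have "?cd \<in> prod_atlas A B" unfolding prod_atlas_def using A B by force
  from rep_smooth[OF f this C(2)]
  have sm: "smooth_on (cmap ?cd ` (cdom ?cd \<inter> UNIV \<inter> (\<lambda>(a, b). h a b) -` cdom k))
     (\<lambda>x. cmap k ((\<lambda>(a, b). h a b) (cinv ?cd x)))" .
  have sub: "S \<subseteq> cmap ?cd ` (cdom ?cd \<inter> UNIV \<inter> (\<lambda>(a, b). h a b) -` cdom k)"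
  proof
    fix z assume "z \<in> S"
    then obtain x y where z: "z = (x, y)" "x \<in> cim c" "y \<in> cim d" "h (cinv c x) (cinv d y) \<in> cdom k"
      unfolding S_def by blast
    then have "z = cmap ?cd (cinv c x, cinv d y)"
      by (simp add: chart_inverse(2)[OF isc(1)] chart_inverse(2)[OF isc(2)])
    moreover have "(cinv c x, cinv d y) \<in> cdom ?cd \<inter> UNIV \<inter> (\<lambda>(a, b). h a b) -` cdom k"
      using z by (simp add: chart_inverse(3)[OF isc(1)] chart_inverse(3)[OF isc(2)])
    ultimately show "z \<in> cmap ?cd ` (cdom ?cd \<inter> UNIV \<inter> (\<lambda>(a, b). h a b) -` cdom k)"
      by (rule image_eqI)
  qed
  have "smooth_on S (\<lambda>x. cmap k ((\<lambda>(a, b). h a b) (cinv ?cd x)))"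
    by (rule smooth_on_subset[OF sm sub])
  then show "smooth_on S (\<lambda>(x, y). cmap k (h (cinv c x) (cinv d y)))"
    by (rule smooth_on_cong[OF op, THEN iffD1, rotated])
      (auto simp: S_def cinv_prod[OF isc(1,2)])
qed

text \<open>\<open>chart_vec\<close> is the derivative of a transition map, which is complex linear
  by \<open>complex_atlas\<close>.\<close>

lemma chart_vec_i:
  assumes "complex_atlas A" "c \<in> A" "x \<in> cim c"
  shows "chart_vec A c x (\<i> *s u) = \<i> *s chart_vec A c x u"
proof -
  have A: "smooth_atlas A" using assms by (simp add: complex_atlas_def)
  let ?c' = "chart_at A (cinv c x)"
  note ch = chart_inverse[OF atlas_chart[OF A assms(2)]]
  have "chart_vec A c x = Dr (cmap ?c' \<circ> cinv c) x"
    by (intro ext) (simp add: chart_vec_def mderiv_def chart_at_vector vector_chart o_def)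
  moreover have "x \<in> cmap c ` (cdom c \<inter> cdom ?c')"
    using assms(3) ch chart_at_in(2)[OF A, of "cinv c x"] by (intro image_eqI[of _ _ "cinv c x"]) auto
  ultimately show ?thesis
    using assms chart_at_in(1)[OF A] unfolding complex_atlas_def by metis
qed

lemma form_comp_kaehler:
  assumes "complex_atlas A" "c \<in> A" "x \<in> cim c"
  shows "form_comp A c (kaehler_form g) x u v = form_comp A c g x (\<i> *s u) v"
  by (simp add: form_comp_def kaehler_form_def chart_vec_i[OF assms])

lemma linear_i: "linear ((*s) \<i> :: complex ^ 'n \<Rightarrow> complex ^ 'n)"
  by (rule linearI) (simp_all add: vec_eq_iff algebra_simps)

lemma local_kaehler_chart:
  fixes A :: "('m::topological_space, complex ^ 'n) chart set"
  assumes K: "kaehler_manifold A g" and c: "c \<in> A"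
  shows "local_kaehler (cim c) (form_comp A c g) ((*s) \<i>)"
proof (rule local_kaehler.intro)
  have A: "smooth_atlas A" "complex_atlas A" using K by (auto simp: kaehler_manifold_def complex_atlas_def)
  have R: "riemannian_metric A g" using K by (simp add: kaehler_manifold_def)
  note isc = atlas_chart[OF A(1) c]
  show "open (cim c)" by (rule chart_open(2)[OF isc])
  fix x u v w :: "complex ^ 'n"
  have bg: "bilinear (g p)" for p using R by (simp add: riemannian_metric_def)
  show "smooth_on (cim c) (\<lambda>x. form_comp A c g x u v)" using R c by (simp add: riemannian_metric_def)
  show "linear ((*s) \<i> :: complex ^ 'n \<Rightarrow> _)" by (rule linear_i)
  show "\<i> *s (\<i> *s u) = - u"
    by (simp add: vec_eq_iff mult.assoc[symmetric])
  assume x: "x \<in> cim c"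
  have l: "linear (chart_vec A c x)" by (rule chart_vec_linear[OF A(1) c x])
  show "bilinear (form_comp A c g x)"
    unfolding bilinear_def form_comp_def
    using bilinear_radd[OF bg] bilinear_ladd[OF bg] bilinear_rmul[OF bg] bilinear_lmul[OF bg]
    by (auto intro!: linearI simp: linear_add[OF l] linear_scale[OF l])
  show "form_comp A c g x u v = form_comp A c g x v u"
    using R by (simp add: riemannian_metric_def form_comp_def)
  show "form_comp A c g x u u > 0" if "u \<noteq> 0"
  proof -
    have "cinv c x \<in> cdom c" "cmap c (cinv c x) = x" using x chart_inverse[OF isc] by auto
    then have "chart_vec A c x u \<noteq> 0"
      using coord_inverse(1)[OF A(1) c, of "cinv c x" u] linear_0[OF coord_linear[OF A(1) c]] that by metis
    then show ?thesis using R by (simp add: riemannian_metric_def form_comp_def)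
  qed
  show "form_comp A c g x (\<i> *s u) (\<i> *s v) = form_comp A c g x u v"
    using K by (simp add: form_comp_def chart_vec_i[OF A(2) c x] kaehler_manifold_def)
  have "Dr (\<lambda>y. form_comp A c (kaehler_form g) y v w) x = Dr (\<lambda>y. form_comp A c g y (\<i> *s v) w) x" for v w
    by (rule Dr_cong[OF chart_open(2)[OF isc] x]) (rule form_comp_kaehler[OF A(2) c])
  then show "Dr (\<lambda>y. form_comp A c g y (\<i> *s v) w) x u + Dr (\<lambda>y. form_comp A c g y (\<i> *s w) u) x v +
      Dr (\<lambda>y. form_comp A c g y (\<i> *s u) v) x w = 0"
    using K c x unfolding kaehler_manifold_def closed_2form_def by metis
qed

section \<open>Partial derivatives and families of local isometries\<close>

lemma has_derivative_partial:
  assumes "F differentiable (at (s, x))"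
  shows "((\<lambda>x. F (s, x)) has_derivative (\<lambda>u. Dr F (s, x) (0, u))) (at x)"
    and "((\<lambda>s. F (s, x)) has_derivative (\<lambda>v. Dr F (s, x) (v, 0))) (at s)"
proof -
  have 1: "((\<lambda>x. (s, x)) has_derivative (\<lambda>u. (0, u))) (at x)"
    and 2: "((\<lambda>s. (s, x)) has_derivative (\<lambda>v. (v, 0))) (at s)"
    by (auto intro!: derivative_eq_intros)
  show "((\<lambda>x. F (s, x)) has_derivative (\<lambda>u. Dr F (s, x) (0, u))) (at x)"
    using diff_chain_at[OF 1 Dr_works[OF assms]] by (simp add: o_def)
  show "((\<lambda>s. F (s, x)) has_derivative (\<lambda>v. Dr F (s, x) (v, 0))) (at s)"
    using diff_chain_at[OF 2 Dr_works[OF assms]] by (simp add: o_def)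
qed

lemma Dr_partial:
  assumes "F differentiable (at (s, x))"
  shows "Dr (\<lambda>x. F (s, x)) x u = Dr F (s, x) (0, u)"
    and "Dr (\<lambda>s. F (s, x)) s v = Dr F (s, x) (v, 0)"
  by (simp_all add: Dr_eq[OF has_derivative_partial(1)[OF assms]] Dr_eq[OF has_derivative_partial(2)[OF assms]])

lemma smooth_on_slice:
  assumes "open U" "smooth_on S F" "open S" "\<And>x. x \<in> U \<Longrightarrow> (s, x) \<in> S"
  shows "smooth_on U (\<lambda>x::'a::euclidean_space. F (s::'b::euclidean_space, x))"
  by (rule smooth_on_compose[OF assms(1,3) smooth_on_Pair[OF assms(1) smooth_on_const
        smooth_on_bounded_linear[OF bounded_linear_ident]] assms(2,4)])

text \<open>Along the parameters \<open>s0 + t *\<^sub>R X\<close> the transported metric does not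
  depend on \<open>t\<close>; its derivative at 0 is the Killing equation. Only first order at
  \<open>s0\<close> matters, so a line straight in the parameters does the work of a one-parameter
  group.\<close>

lemma (in local_kaehler) killing_of_flow:
  fixes F :: "'f::euclidean_space \<times> 'e \<Rightarrow> 'e"
  assumes O: "open O'" "\<And>x. x \<in> U \<Longrightarrow> (s0, x) \<in> O'" and F: "smooth_on O' F"
    and F0: "\<And>x. x \<in> U \<Longrightarrow> F (s0, x) = x"
    and iso: "\<And>s x u v. (s, x) \<in> O' \<Longrightarrow> x \<in> U \<Longrightarrow> F (s, x) \<in> U \<and>
       G (F (s, x)) (Dr (\<lambda>x. F (s, x)) x u) (Dr (\<lambda>x. F (s, x)) x v) = G x u v"
  shows "killing (\<lambda>x. Dr F (s0, x) (X, 0))"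
  unfolding killing_def
proof (intro conjI ballI allI)
  let ?\<xi> = "\<lambda>x. Dr F (s0, x) (X, 0)"
  have Fd: "F differentiable (at z)" if "z \<in> O'" for z
    by (rule smooth_on_differentiable[OF F that])
  have F2: "(\<lambda>z. Dr F z w) differentiable (at z)" if "z \<in> O'" for z w
    by (rule smooth_on_differentiable[OF smooth_on_Dr[OF F] that])
  show "smooth_on U ?\<xi>"
    by (rule smooth_on_slice[OF open_U smooth_on_Dr[OF F] O])
  fix x u v assume x: "x \<in> U"
  define E where "E t = (s0 + t *\<^sub>R X, x)" for t :: real
  have E0: "E 0 = (s0, x)" by (simp add: E_def)
  have Ed: "(E has_derivative (\<lambda>h. (h *\<^sub>R X, 0))) (at t)" for t
    unfolding E_def by (auto intro!: derivative_eq_intros)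
  have "continuous_on UNIV E" unfolding E_def by (intro continuous_intros)
  then have T: "open (E -` O')" "0 \<in> E -` O'"
    using O x E0 by (auto intro: open_vimage)
  have DE: "(\<lambda>t. H (E t)) differentiable (at 0)" "Dr (\<lambda>t. H (E t)) 0 1 = Dr H (s0, x) (X, 0)"
    if "H differentiable (at (s0, x))" for H :: "'f \<times> 'e \<Rightarrow> 'c::real_normed_vector"
    using differentiable_chain_at[OF differentiableI[OF Ed], of H 0]
      Dr_compose[OF differentiableI[OF Ed], of H 0] that
    by (simp_all add: o_def E0 Dr_eq[OF Ed])
  define y where "y t = F (E t)" for t
  define V where "V u t = Dr F (E t) (0, u)" for u t
  have y0: "y 0 = x" using F0 x by (simp add: y_def E0)
  have yd: "y differentiable (at 0)" "Dr y 0 1 = ?\<xi> x"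
    unfolding y_def by (rule DE Fd O x)+
  have V0: "V u 0 = u" for u
    unfolding V_def E0 Dr_partial(1)[OF Fd[OF O(2)[OF x]], symmetric]
    by (rule Dr_identity[OF open_U x F0])
  have Vd: "V u differentiable (at 0)" "Dr (V u) 0 1 = Dr ?\<xi> x u" for u
  proof -
    note sx = O(2)[OF x]
    show "V u differentiable (at 0)" unfolding V_def by (rule DE F2 sx)+
    have "Dr (V u) 0 1 = Dr (\<lambda>z. Dr F z (0, u)) (s0, x) (X, 0)"
      unfolding V_def by (rule DE F2 sx)+
    \<comment> \<open>Mixed partial derivatives commute: the \<open>t\<close>-derivative of the
      differential of \<open>F\<close> is the differential of the generator.\<close>
    also have "\<dots> = Dr (\<lambda>z. Dr F z (X, 0)) (s0, x) (0, u)"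
      by (rule Dr_symmetric[OF O(1) sx F])
    also have "\<dots> = Dr ?\<xi> x u"
      by (rule Dr_partial(1)[OF F2[OF sx], symmetric])
    finally show "Dr (V u) 0 1 = Dr ?\<xi> x u" .
  qed
  have G: "y t \<in> U \<and> G (y t) (V u t) (V v t) = G x u v" if "t \<in> E -` O'" for t
  proof -
    have "(s0 + t *\<^sub>R X, x) \<in> O'" using that by (simp add: E_def)
    from iso[OF this x, of u v] show ?thesis
      by (simp add: y_def V_def E_def Dr_partial(1)[OF Fd[OF \<open>(s0 + t *\<^sub>R X, x) \<in> O'\<close>]])
  qed
  have Gy: "(\<lambda>t. G (y t) a b) differentiable (at 0)" "Dr (\<lambda>t. G (y t) a b) 0 1 = Dr (\<lambda>y. G y a b) x (?\<xi> x)" for a b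
    using differentiable_chain_at[OF yd(1), of "\<lambda>y. G y a b"] Dr_compose[OF yd(1), of "\<lambda>y. G y a b"] yd
      G_diff'[OF x] by (simp_all add: o_def y0)
  have "((\<lambda>t. G (y t) (V u t) (V v t)) has_derivative
     (\<lambda>h. Dr (\<lambda>t. G (y t) (V u 0) (V v 0)) 0 h + G (y 0) (Dr (V u) 0 h) (V v 0) + G (y 0) (V u 0) (Dr (V v) 0 h))) (at 0)"
    using G by (intro bilinear_family_has_derivative[OF T] Gy Vd bil) blast
  moreover have "((\<lambda>t. G (y t) (V u t) (V v t)) has_derivative (\<lambda>h. 0)) (at 0)"
    by (rule has_derivative_cong_openI[OF has_derivative_const[of "G x u v"] T]) (use G in blast)
  ultimately have "Dr (\<lambda>t. G (y t) (V u 0) (V v 0)) 0 1 + G (y 0) (Dr (V u) 0 1) (V v 0) + G (y 0) (V u 0) (Dr (V v) 0 1) = 0"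
    by (metis (no_types, lifting) has_derivative_unique)
  then show "Dr (\<lambda>y. G y u v) x (?\<xi> x) + G x (Dr ?\<xi> x u) v + G x u (Dr ?\<xi> x v) = 0"
    by (simp add: V0 y0 Vd(2) Gy(2))
qed


section \<open>Differentials of maps between manifolds\<close>

lemma has_derivative_cong_ev:
  assumes "(g has_derivative f') (at x)" "eventually (\<lambda>y. f y = g y) (nhds x)"
  shows "(f has_derivative f') (at x)"
proof -
  obtain S where "open S" "x \<in> S" "\<And>y. y \<in> S \<Longrightarrow> f y = g y"
    using assms(2) unfolding eventually_nhds by blast
  then show ?thesis by (rule has_derivative_cong_openI[OF assms(1)])
qed

lemma Dr_cong_ev:
  assumes "eventually (\<lambda>y. f y = g y) (nhds x)"
  shows "Dr f x = Dr g x"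
proof -
  obtain S where "open S" "x \<in> S" "\<And>y. y \<in> S \<Longrightarrow> f y = g y"
    using assms unfolding eventually_nhds by blast
  then show ?thesis by (rule Dr_cong)
qed

lemma eventually_in_open:
  assumes "isCont h x" "open S" "h x \<in> S"
  shows "eventually (\<lambda>y. h y \<in> S) (nhds x)"
proof -
  have "filterlim h (nhds (h x)) (nhds x)"
    using assms(1) by (simp add: isCont_def tendsto_at_iff_tendsto_nhds)
  then show ?thesis using assms(2,3) by (rule topological_tendstoD)
qed

text \<open>If \<open>m\<close> is a local group law with unit \<open>s\<^sub>0\<close> and \<open>F\<close> a local action of it, differentiating
  \<open>F(m(s,t),x) = F(s,F(t,x))\<close> in \<open>t\<close> and then in \<open>s\<close> at the unit gives the following identity; its
  first term on the left is symmetric in \<open>X\<close>, \<open>Y\<close>.\<close>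

lemma local_action_second_derivative:
  fixes F :: "'f::euclidean_space \<times> 'e::euclidean_space \<Rightarrow> 'e" and m :: "'f \<times> 'f \<Rightarrow> 'f"
  assumes OF: "open OF" "smooth_on OF F" and Om: "open Om" "smooth_on Om m"
    and s0: "(s0, s0) \<in> Om" "(s0, x) \<in> OF"
    and F0: "F (s0, x) = x"
    and m1: "\<And>s. (s, s0) \<in> Om \<Longrightarrow> m (s, s0) = s" and m2: "\<And>t. (s0, t) \<in> Om \<Longrightarrow> m (s0, t) = t"
    and assoc: "\<And>s t. (s, t) \<in> Om \<Longrightarrow> (t, x) \<in> OF \<Longrightarrow> (m (s, t), x) \<in> OF \<Longrightarrow> (s, F (t, x)) \<in> OF \<Longrightarrow>
       F (m (s, t), x) = F (s, F (t, x))"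
  shows "Dr (\<lambda>z. Dr F z (Y, 0)) (s0, x) (X, 0) + Dr F (s0, x) (Dr (\<lambda>s. Dr m (s, s0) (0, Y)) s0 X, 0) =
     Dr (\<lambda>y. Dr F (s0, y) (X, 0)) x (Dr F (s0, x) (Y, 0))"
proof -
  have Fd: "F differentiable (at z)" if "z \<in> OF" for z
    by (rule smooth_on_differentiable[OF OF(2) that])
  have F2: "(\<lambda>z. Dr F z w) differentiable (at z)" if "z \<in> OF" for z w
    by (rule smooth_on_differentiable[OF smooth_on_Dr[OF OF(2)] that])
  have md: "m differentiable (at z)" if "z \<in> Om" for z
    by (rule smooth_on_differentiable[OF Om(2) that])
  have mm2: "(\<lambda>z. Dr m z w) differentiable (at z)" if "z \<in> Om" for z w
    by (rule smooth_on_differentiable[OF smooth_on_Dr[OF Om(2)] that])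
  have ev1: "eventually (\<lambda>t. (s, t) \<in> W) (nhds t0)" if "open W" "(s, t0) \<in> W"
    for W :: "('f \<times> 'f) set" and s t0
    by (rule eventually_in_open[OF _ that(1)]) (use that in \<open>auto intro!: continuous_intros\<close>)
  have ev2: "eventually (\<lambda>s. (s, y) \<in> W) (nhds s')" if "open W" "(s', y) \<in> W"
    for W :: "('f \<times> 'a::topological_space) set" and s' y
    by (rule eventually_in_open[OF _ that(1)]) (use that in \<open>auto intro!: continuous_intros\<close>)
  let ?w = "Dr F (s0, x) (Y, 0)"
  \<comment> \<open>The differentiation in \<open>t\<close> at \<open>s0\<close>, with
    \<open>s\<close> still free, so that the result can be differentiated in
    \<open>s\<close>.\<close>
  have step1: "Dr F (s, x) (Dr m (s, s0) (0, Y), 0) = Dr F (s, x) (0, ?w)"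
    if s: "(s, s0) \<in> Om" "(s, x) \<in> OF" for s
  proof -
    have mt: "((\<lambda>t. (m (s, t), x)) has_derivative (\<lambda>v. (Dr m (s, s0) (0, v), 0))) (at s0)"
      by (intro has_derivative_Pair has_derivative_partial(1) has_derivative_const md s)
    have Ft: "((\<lambda>t. (s, F (t, x))) has_derivative (\<lambda>v. (0, Dr F (s0, x) (v, 0)))) (at s0)"
      by (intro has_derivative_Pair has_derivative_partial(2) has_derivative_const Fd s0)
    have c1: "eventually (\<lambda>t. (m (s, t), x) \<in> OF) (nhds s0)"
      by (rule eventually_in_open[OF has_derivative_continuous[OF mt] OF(1)]) (simp add: m1 s)
    have c2: "eventually (\<lambda>t. (s, F (t, x)) \<in> OF) (nhds s0)"
      by (rule eventually_in_open[OF has_derivative_continuous[OF Ft] OF(1)]) (simp add: F0 s)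
    have ev: "eventually (\<lambda>t. F (m (s, t), x) = F (s, F (t, x))) (nhds s0)"
      using ev1[OF Om(1) s(1)] ev2[OF OF(1) s0(2)] c1 c2 by eventually_elim (rule assoc)
    have e1: "((\<lambda>t. F (m (s, t), x)) has_derivative (\<lambda>v. Dr F (s, x) (Dr m (s, s0) (0, v), 0))) (at s0)"
      using diff_chain_at[OF mt, of F "Dr F (s, x)"] Dr_works[OF Fd[OF s(2)]] by (simp add: o_def m1 s)
    have e2: "((\<lambda>t. F (s, F (t, x))) has_derivative (\<lambda>v. Dr F (s, x) (0, Dr F (s0, x) (v, 0)))) (at s0)"
      using diff_chain_at[OF Ft, of F "Dr F (s, x)"] Dr_works[OF Fd[OF s(2)]] by (simp add: o_def F0)
    show ?thesis using Dr_cong_ev[OF ev] unfolding Dr_eq[OF e1] Dr_eq[OF e2] by (rule fun_cong)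
  qed
  have ev: "eventually (\<lambda>s. Dr F (s, x) (Dr m (s, s0) (0, Y), 0) = Dr F (s, x) (0, ?w)) (nhds s0)"
    using ev2[OF Om(1) s0(1)] ev2[OF OF(1) s0(2)] by eventually_elim (rule step1)
  have mY: "Dr m (s0, s0) (0, Y) = Y"
  proof -
    have "Dr m (s0, s0) (0, Y) = Dr (\<lambda>t. m (s0, t)) s0 Y"
      by (rule Dr_partial(1)[OF md[OF s0(1)], symmetric])
    also have "\<dots> = Dr (\<lambda>t. t) s0 Y"
      using ev1[OF Om(1) s0(1)] by (intro fun_cong[OF Dr_cong_ev]) (auto elim!: eventually_mono intro: m2)
    finally show ?thesis by simp
  qed
  \<comment> \<open>Here \<open>s\<close> occurs in the point and in the direction; the product rule
    yields the two terms on the left of the claim.\<close>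
  have L: "((\<lambda>s. Dr F (s, x) (Dr m (s, s0) (0, Y), 0)) has_derivative
     (\<lambda>X. Dr (\<lambda>s. Dr F (s, x) (Dr m (s0, s0) (0, Y), 0)) s0 X +
        Dr F (s0, x) (Dr (\<lambda>s. Dr m (s, s0) (0, Y)) s0 X, 0))) (at s0)"
  proof (rule linear_family_has_derivative[where L = "\<lambda>s w. Dr F (s, x) (w, 0)"])
    show "open ((\<lambda>s. (s, x)) -` OF)" using OF(1) by (intro open_vimage continuous_intros)
    show "s0 \<in> (\<lambda>s. (s, x)) -` OF" using s0 by simp
    show "linear (\<lambda>w. Dr F (s, x) (w, 0))" if "s \<in> (\<lambda>s. (s, x)) -` OF" for s
      using that by (intro has_derivative_linear[OF has_derivative_partial(2)[OF Fd]]) simp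
    show "(\<lambda>s. Dr F (s, x) (b, 0)) differentiable (at s0)" for b
      using has_derivative_partial(2)[OF F2[OF s0(2)]] by (rule differentiableI)
    show "(\<lambda>s. Dr m (s, s0) (0, Y)) differentiable (at s0)"
      using has_derivative_partial(2)[OF mm2[OF s0(1)]] by (rule differentiableI)
  qed
  have R: "((\<lambda>s. Dr F (s, x) (0, ?w)) has_derivative (\<lambda>X. Dr (\<lambda>z. Dr F z (0, ?w)) (s0, x) (X, 0))) (at s0)"
    by (rule has_derivative_partial(2)[OF F2[OF s0(2)]])
  have "Dr (\<lambda>s. Dr F (s, x) (Dr m (s, s0) (0, Y), 0)) s0 X = Dr (\<lambda>s. Dr F (s, x) (0, ?w)) s0 X"
    using Dr_cong_ev[OF ev] by simp
  then have "Dr (\<lambda>s. Dr F (s, x) (Y, 0)) s0 X + Dr F (s0, x) (Dr (\<lambda>s. Dr m (s, s0) (0, Y)) s0 X, 0) =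
     Dr (\<lambda>z. Dr F z (0, ?w)) (s0, x) (X, 0)"
    by (simp add: Dr_eq[OF L] Dr_eq[OF R] mY)
  also have "\<dots> = Dr (\<lambda>z. Dr F z (X, 0)) (s0, x) (0, ?w)"
    by (rule Dr_symmetric[OF OF(1) s0(2) OF(2)])
  also have "\<dots> = Dr (\<lambda>y. Dr F (s0, y) (X, 0)) x ?w"
    by (rule Dr_partial(1)[OF F2[OF s0(2)], symmetric])
  finally show ?thesis
    by (simp add: Dr_partial(2)[OF F2[OF s0(2)]])
qed

lemma smooth_map_continuous: "smooth_map A B f \<Longrightarrow> continuous_on UNIV f"
  by (simp add: smooth_map_on_def)

lemma smooth_mapI:
  assumes "continuous_on UNIV f"
    and "\<And>c d. c \<in> A \<Longrightarrow> d \<in> B \<Longrightarrow> smooth_on (cmap c ` (cdom c \<inter> f -` cdom d)) (\<lambda>x. cmap d (f (cinv c x)))"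
  shows "smooth_map A B f"
  using assms by (simp add: smooth_map_on_def o_def)

lemma smooth_map_slice:
  fixes A :: "('a::topological_space, 'e::euclidean_space) chart set"
    and B :: "('b::topological_space, 'f::euclidean_space) chart set"
    and C :: "('c::topological_space, 'g::euclidean_space) chart set"
  assumes A: "smooth_atlas A" and B: "smooth_atlas B" and C: "smooth_atlas C"
    and f: "smooth_map (prod_atlas A B) C (\<lambda>(a, b). h a b)"
  shows "smooth_map B C (h a)" "smooth_map A C (\<lambda>a. h a b)"
proof -
  have cont: "continuous_on UNIV (\<lambda>(a, b). h a b)" by (rule smooth_map_continuous[OF f])
  show "smooth_map B C (h a)"
  proof (rule smooth_mapI)
    show cont': "continuous_on UNIV (h a)"
    proof -
      have "continuous_on UNIV (\<lambda>y. (a, y))" by (intro continuous_intros)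
      from continuous_on_compose2[OF cont this] show ?thesis by simp
    qed
    fix c k assume ck: "c \<in> B" "k \<in> C"
    let ?a = "chart_at A a"
    note ca = chart_at_in[OF A]
    note isc = atlas_chart[OF A ca(1)[of a]] atlas_chart[OF B ck(1)] atlas_chart[OF C ck(2)]
    have "open (h a -` cdom k)"
      using cont' chart_open(1)[OF isc(3)] by (simp add: open_vimage)
    then have op: "open (cmap c ` (cdom c \<inter> h a -` cdom k))" by (rule chart_image_open[OF isc(2)])
    have "smooth_on (cmap c ` (cdom c \<inter> h a -` cdom k))
        (\<lambda>y. (\<lambda>(x, y). cmap k (h (cinv ?a x) (cinv c y))) (cmap ?a a, y))"
      using ca[of a]
      by (intro smooth_on_slice[OF op prod_rep(2)[OF A ca(1)[of a] B ck(1) C ck(2) f] prod_rep(1)[OF A ca(1)[of a] B ck(1) C ck(2) f]])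
        (auto simp: chart_inverse[OF isc(1)] chart_inverse[OF isc(2)])
    then show "smooth_on (cmap c ` (cdom c \<inter> h a -` cdom k)) (\<lambda>x. cmap k (h a (cinv c x)))"
      using ca(2)[of a] by (simp add: chart_inverse[OF isc(1)])
  qed
  show "smooth_map A C (\<lambda>a. h a b)"
  proof (rule smooth_mapI)
    show cont': "continuous_on UNIV (\<lambda>a. h a b)"
    proof -
      have "continuous_on UNIV (\<lambda>y. (y, b))" by (intro continuous_intros)
      from continuous_on_compose2[OF cont this] show ?thesis by simp
    qed
    fix c k assume ck: "c \<in> A" "k \<in> C"
    let ?b = "chart_at B b"
    note cb = chart_at_in[OF B]
    note isc = atlas_chart[OF B cb(1)[of b]] atlas_chart[OF A ck(1)] atlas_chart[OF C ck(2)]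
    let ?O = "cmap c ` (cdom c \<inter> (\<lambda>a. h a b) -` cdom k)"
    have "open ((\<lambda>a. h a b) -` cdom k)"
      using cont' chart_open(1)[OF isc(3)] by (simp add: open_vimage)
    then have op: "open ?O" by (rule chart_image_open[OF isc(2)])
    have "smooth_on ?O (\<lambda>y. (\<lambda>(x, y). cmap k (h (cinv c x) (cinv ?b y))) (y, cmap ?b b))"
      using cb[of b]
      by (intro smooth_on_compose[OF op prod_rep(1)[OF A ck(1) B cb(1)[of b] C ck(2) f]
            smooth_on_Pair[OF op smooth_on_bounded_linear[OF bounded_linear_ident] smooth_on_const]
            prod_rep(2)[OF A ck(1) B cb(1)[of b] C ck(2) f]])
        (auto simp: chart_inverse[OF isc(1)] chart_inverse[OF isc(2)])
    then show "smooth_on ?O (\<lambda>x. cmap k (h (cinv c x) b))"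
      using cb(2)[of b] by (simp add: chart_inverse[OF isc(1)])
  qed
qed

lemma smooth_map_compose:
  fixes A :: "('a::topological_space, 'e::euclidean_space) chart set"
    and B :: "('b::topological_space, 'f::euclidean_space) chart set"
    and C :: "('c::topological_space, 'g::euclidean_space) chart set"
  assumes A: "smooth_atlas A" and B: "smooth_atlas B" and C: "smooth_atlas C"
    and f: "smooth_map A B f" and h: "smooth_map B C h"
  shows "smooth_map A C (\<lambda>x. h (f x))"
proof (rule smooth_mapI)
  show cont: "continuous_on UNIV (\<lambda>x. h (f x))"
    using continuous_on_compose2[OF smooth_map_continuous[OF h] smooth_map_continuous[OF f]] by simp
  fix c k assume ck: "c \<in> A" "k \<in> C"
  note isc = atlas_chart[OF A ck(1)] atlas_chart[OF C ck(2)]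
  let ?O = "cmap c ` (cdom c \<inter> (\<lambda>x. h (f x)) -` cdom k)"
  show "smooth_on ?O (\<lambda>x. cmap k (h (f (cinv c x))))"
  proof (rule smooth_on_local)
    fix x assume "x \<in> ?O"
    then obtain p where p: "p \<in> cdom c" "h (f p) \<in> cdom k" "x = cmap c p" by auto
    let ?d = "chart_at B (f p)"
    note cd = chart_at_in[OF B, of "f p"]
    note isd = atlas_chart[OF B cd(1)]
    have of: "open (h -` cdom k)"
      using smooth_map_continuous[OF h] chart_open(1)[OF isc(2)] by (simp add: open_vimage)
    then have "open (f -` (cdom ?d \<inter> h -` cdom k))"
      by (intro open_vimage[OF open_Int[OF chart_open(1)[OF isd] of] smooth_map_continuous[OF f]])
    then have T: "open (cmap c ` (cdom c \<inter> f -` (cdom ?d \<inter> h -` cdom k)))" (is "open ?T")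
      by (rule chart_image_open[OF isc(1)])
    have fs: "smooth_on ?T (\<lambda>x. cmap ?d (f (cinv c x)))"
      by (rule smooth_on_subset[OF rep_smooth[OF f ck(1) cd(1)]]) auto
    have hs: "smooth_on (cmap ?d ` (cdom ?d \<inter> h -` cdom k)) (\<lambda>y. cmap k (h (cinv ?d y)))"
      using rep_smooth[OF h cd(1) ck(2)] by simp
    have "smooth_on ?T (\<lambda>x. cmap k (h (cinv ?d (cmap ?d (f (cinv c x))))))"
      by (rule smooth_on_compose[OF T chart_image_open[OF isd of] fs hs])
        (auto simp: chart_inverse[OF isc(1)])
    then have "smooth_on ?T (\<lambda>x. cmap k (h (f (cinv c x))))"
      by (rule smooth_on_cong[OF T, THEN iffD1, rotated])
        (auto simp: chart_inverse[OF isc(1)] chart_inverse[OF isd])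
    then have "smooth_on (?O \<inter> ?T) (\<lambda>x. cmap k (h (f (cinv c x))))"
      by (rule smooth_on_subset) auto
    moreover have "x \<in> ?T" using p cd by auto
    ultimately show "\<exists>T. open T \<and> x \<in> T \<and> smooth_on (?O \<inter> T) (\<lambda>x. cmap k (h (f (cinv c x))))"
      using T by blast
  qed
qed

lemma mderiv_differentiable:
  assumes A: "smooth_atlas A" and B: "smooth_atlas B" and f: "smooth_map A B f"
  shows "(\<lambda>x. cmap (chart_at B (f p)) (f (cinv (chart_at A p) x))) differentiable (at (cmap (chart_at A p) p))"
  by (rule rep_differentiable[OF f]) (use chart_at_in[OF A] chart_at_in[OF B] in auto)

lemma mderiv_linear:
  assumes "smooth_atlas A" "smooth_atlas B" "smooth_map A B f"
  shows "linear (mderiv A B f p)"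
  using linear_Dr[OF mderiv_differentiable[OF assms]] by (simp add: mderiv_def o_def)

lemma mderiv_compose:
  assumes A: "smooth_atlas A" and B: "smooth_atlas B" and C: "smooth_atlas C"
    and f: "smooth_map A B f" and h: "smooth_map B C h"
  shows "mderiv A C (\<lambda>x. h (f x)) p u = mderiv B C h (f p) (mderiv A B f p u)"
proof -
  let ?a = "chart_at A p" and ?b = "chart_at B (f p)" and ?c = "chart_at C (h (f p))"
  note ca = chart_at_in[OF A, of p] and cb = chart_at_in[OF B, of "f p"]
  note isa = atlas_chart[OF A ca(1)] and isb = atlas_chart[OF B cb(1)]
  have d: "(\<lambda>y. cmap ?c (h (cinv ?b y))) differentiable at (cmap ?b (f (cinv ?a (cmap ?a p))))"
    using mderiv_differentiable[OF B C h, of "f p"] ca by (simp add: chart_inverse[OF isa])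
  have "Dr (\<lambda>x. cmap ?c (h (f (cinv ?a x)))) (cmap ?a p) =
     Dr (\<lambda>x. cmap ?c (h (cinv ?b (cmap ?b (f (cinv ?a x)))))) (cmap ?a p)"
    using ca cb by (intro Dr_cong[OF rep_open[OF f open_UNIV isa isb]])
      (auto simp: chart_inverse[OF isa] chart_inverse[OF isb])
  then show ?thesis
    using Dr_compose[OF mderiv_differentiable[OF A B f, of p] d] ca
    by (simp add: mderiv_def o_def chart_inverse[OF isa])
qed

lemma mderiv_id:
  assumes "smooth_atlas A"
  shows "mderiv A A (\<lambda>x. x) p u = u"
  using coord_chart_at[OF assms, of p u] by (simp add: mderiv_def coord_def o_def)


section \<open>Semisimple compact groups\<close>

text \<open>A strictly convex invariant function has a unique minimiser on the convex hull of an orbit,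
  and this minimiser is fixed. The function used is the maximum of the norm over the orbit.\<close>

lemma compact_group_fixed_point:
  fixes \<rho> :: "'k::topological_space \<Rightarrow> 'f::euclidean_space \<Rightarrow> 'f"
  assumes comp: "compact (UNIV :: 'k set)" and lin: "\<And>a. linear (\<rho> a)"
    and hom: "\<And>a b v. \<rho> (mul a b) v = \<rho> a (\<rho> b v)" and inv: "\<And>a v. \<rho> (iv a) (\<rho> a v) = v"
    and cont: "\<And>v. continuous_on UNIV (\<lambda>a. \<rho> a v)"
  shows "\<exists>z\<in>convex hull (range (\<lambda>a. \<rho> a v)). \<forall>a. \<rho> a z = z"
proof -
  define C where "C = convex hull (range (\<lambda>a. \<rho> a v))"
  have Ccomp: "compact C" unfolding C_def
    by (intro compact_convex_hull compact_continuous_image cont comp)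
  have Cne: "C \<noteq> {}" unfolding C_def by simp
  have Cinv: "\<rho> a w \<in> C" if "w \<in> C" for a w
  proof -
    have "\<rho> a ` C = convex hull (\<rho> a ` range (\<lambda>a. \<rho> a v))"
      unfolding C_def by (rule convex_hull_linear_image[OF lin])
    also have "\<dots> \<subseteq> C" unfolding C_def by (intro hull_mono) (auto simp: hom[symmetric])
    finally show ?thesis using that by blast
  qed
  define N where "N w = (SUP a. norm (\<rho> a w))" for w
  have att: "\<exists>a. \<forall>a'. norm (\<rho> a' w) \<le> norm (\<rho> a w)" for w
    using continuous_attains_sup[OF comp, of "\<lambda>a. norm (\<rho> a w)"] continuous_on_norm[OF cont[of w]] by auto
  have bdd: "bdd_above (range (\<lambda>a. norm (\<rho> a w)))" for w
    using att[of w] by (auto intro: bdd_aboveI)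
  have Nup: "norm (\<rho> a w) \<le> N w" for a w
    unfolding N_def by (rule cSUP_upper[OF UNIV_I bdd])
  have Nle: "N w \<le> r" if "\<And>a. norm (\<rho> a w) \<le> r" for w r
    unfolding N_def by (rule cSUP_least) (use that in auto)
  have Natt: "\<exists>a. N w = norm (\<rho> a w)" for w
    using att[of w] Nup Nle by (meson antisym)
  \<comment> \<open>\<open>N\<close> is a supremum over the whole group; a Lipschitz constant, read
    off from the basis vectors, gives its continuity.\<close>
  define L where "L = (\<Sum>b\<in>Basis. N b)"
  have NL: "N w \<le> L * norm w" for w
  proof (rule Nle)
    fix a
    have "norm (\<rho> a w) = norm (\<Sum>b\<in>Basis. (w \<bullet> b) *\<^sub>R \<rho> a b)"
      by (subst linear_basis_expansion[OF lin]) simp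
    also have "\<dots> \<le> (\<Sum>b\<in>Basis. norm ((w \<bullet> b) *\<^sub>R \<rho> a b))" by (rule norm_sum)
    also have "\<dots> \<le> (\<Sum>b\<in>Basis. norm w * N b)"
      by (intro sum_mono) (simp add: mult_mono Basis_le_norm Nup)
    finally show "norm (\<rho> a w) \<le> L * norm w" by (simp add: L_def sum_distrib_left mult.commute)
  qed
  have Ntri: "N w \<le> N w' + L * norm (w - w')" for w w'
  proof (rule Nle)
    fix a
    have "norm (\<rho> a w) \<le> norm (\<rho> a w') + norm (\<rho> a (w - w'))"
      using norm_triangle_ineq[of "\<rho> a w'" "\<rho> a (w - w')"] by (simp add: linear_diff[OF lin])
    then show "norm (\<rho> a w) \<le> N w' + L * norm (w - w')"
      using Nup[of a w'] Nup[of a "w - w'"] NL[of "w - w'"] by linarith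
  qed
  have "L-lipschitz_on UNIV N"
  proof (rule lipschitz_onI)
    show "dist (N w) (N w') \<le> L * dist w w'" for w w'
      using Ntri[of w w'] Ntri[of w' w] by (simp add: dist_norm norm_minus_commute)
    show "0 \<le> L" unfolding L_def by (intro sum_nonneg) (meson Nup norm_ge_zero order_trans)
  qed
  then have "continuous_on C N"
    using lipschitz_on_continuous_on continuous_on_subset by blast
  then obtain z where z: "z \<in> C" "\<And>w. w \<in> C \<Longrightarrow> N z \<le> N w"
    using continuous_attains_inf[OF Ccomp Cne] by blast
  have uniq: "w = z" if w: "w \<in> C" "N w \<le> N z" for w
  proof -
    let ?w = "(1 / 2) *\<^sub>R z + (1 / 2) *\<^sub>R w"
    have "?w \<in> C" using z w unfolding C_def
      by (intro convexD[OF convex_convex_hull]) auto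
    then have mid: "N z \<le> N ?w" by (rule z(2))
    obtain a where a: "N ?w = norm (\<rho> a ?w)" using Natt by blast
    let ?x = "\<rho> a z" and ?y = "\<rho> a w"
    have "\<rho> a ?w = (1 / 2) *\<^sub>R (?x + ?y)" by (simp add: linear_add[OF lin] linear_scale[OF lin] scaleR_add_right)
    then have 1: "2 * N z \<le> norm (?x + ?y)" using mid a by simp
    have 2: "norm ?x \<le> N z" "norm ?y \<le> N z" using Nup[of a z] Nup[of a w] w by auto
    have nn: "0 \<le> N z" using 2(1) norm_ge_zero order_trans by blast
    \<comment> \<open>Strict convexity by the parallelogram law: some \<open>a\<close> attains the
      maximum at the midpoint, and for this \<open>a\<close> the two images must coincide.\<close>
    have "(norm (?x - ?y))\<^sup>2 = 2 * (norm ?x)\<^sup>2 + 2 * (norm ?y)\<^sup>2 - (norm (?x + ?y))\<^sup>2"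
      by (simp add: power2_norm_eq_inner inner_simps inner_commute)
    also have "\<dots> \<le> 2 * (N z)\<^sup>2 + 2 * (N z)\<^sup>2 - (2 * N z)\<^sup>2"
      using 1 2 nn by (intro diff_mono add_mono mult_left_mono power_mono) auto
    also have "\<dots> = 0" by (simp add: power2_eq_square)
    finally have "?x = ?y" by simp
    then show "w = z" by (metis inv)
  qed
  have "\<rho> a z = z" for a
  proof (rule uniq[OF Cinv[OF z(1)]])
    show "N (\<rho> a z) \<le> N z" by (rule Nle) (simp add: hom[symmetric] Nup)
  qed
  then show ?thesis using z(1) unfolding C_def by blast
qed

locale lie_grp =
  fixes B :: "('k::t2_space, 'f::euclidean_space) chart set"
    and mul :: "'k \<Rightarrow> 'k \<Rightarrow> 'k" and e :: 'k and iv :: "'k \<Rightarrow> 'k"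
  assumes lie: "lie_group B mul e iv"
begin

lemma atlas: "smooth_atlas B" and mul_smooth: "smooth_map (prod_atlas B B) B (\<lambda>(a, b). mul a b)"
  using lie by (auto simp: lie_group_def)

lemma grp: "group mul e iv" using lie by (simp add: lie_group_def)

lemma mul_assoc: "mul (mul a b) c = mul a (mul b c)"
  and mul_e: "mul e a = a" "mul a e = a" and mul_iv: "mul (iv a) a = e" "mul a (iv a) = e"
proof -
  interpret group mul e iv by (rule grp)
  show "mul (mul a b) c = mul a (mul b c)" by (rule assoc)
  show "mul e a = a" "mul a e = a" "mul (iv a) a = e" "mul a (iv a) = e" by simp_all
qed

lemma iv_mul: "iv (mul a b) = mul (iv b) (iv a)"
proof -
  interpret group mul e iv by (rule grp)
  show ?thesis by (rule inverse_distrib_swap)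
qed

text \<open>The group near its unit, in the preferred chart there: \<open>m\<close> is a local group
  law with unit \<open>s0\<close>, defined on \<open>Om\<close>.\<close>

definition b where "b = chart_at B e"
definition s0 where "s0 = cmap b e"
definition m where "m = (\<lambda>(s, t). cmap b (mul (cinv b s) (cinv b t)))"
definition Om where "Om = {(s, t). s \<in> cim b \<and> t \<in> cim b \<and> mul (cinv b s) (cinv b t) \<in> cdom b}"

lemma b: "b \<in> B" "e \<in> cdom b" unfolding b_def by (rule chart_at_in[OF atlas])+
lemma is_chart_b: "is_chart b" by (rule atlas_chart[OF atlas b(1)])
lemma s0: "cinv b s0 = e" "s0 \<in> cim b"
  unfolding s0_def using b(2) chart_inverse[OF is_chart_b] by auto

lemma m: "open Om" "smooth_on Om m"
  unfolding Om_def m_def by (rule prod_rep[OF atlas b(1) atlas b(1) atlas b(1) mul_smooth])+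

lemma m_unit: "(s, s0) \<in> Om \<Longrightarrow> m (s, s0) = s" "(s0, t) \<in> Om \<Longrightarrow> m (s0, t) = t"
  by (auto simp: Om_def m_def s0 mul_e chart_inverse[OF is_chart_b])

lemma Om_s0: "s \<in> cim b \<Longrightarrow> (s, s0) \<in> Om" "s \<in> cim b \<Longrightarrow> (s0, s) \<in> Om"
  by (auto simp: Om_def s0 mul_e chart_inverse[OF is_chart_b])

lemma open_b: "open (cim b)" by (rule chart_open(2)[OF is_chart_b])

lemma mul_left_smooth: "smooth_map B B (mul a)" and mul_right_smooth: "smooth_map B B (\<lambda>h. mul h a)"
  by (rule smooth_map_slice[OF atlas atlas atlas mul_smooth])+

section \<open>Conjugation, the adjoint representation and the Lie bracket\<close>

definition conj where "conj a h = mul (mul a h) (iv a)"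

lemma conj_smooth: "smooth_map B B (conj a)"
  unfolding conj_def
  by (rule smooth_map_compose[OF atlas atlas atlas mul_left_smooth mul_right_smooth])

lemma conj_e: "conj a e = e" by (simp add: conj_def mul_e mul_iv)
lemma conj_mul: "conj (mul a c) h = conj a (conj c h)" by (simp add: conj_def iv_mul mul_assoc)

abbreviation AdK where "AdK \<equiv> Ad B mul e iv"

lemma Ad_conj: "AdK a V = mderiv B B (conj a) e V"
  by (simp add: Ad_def conj_def[abs_def])

lemma Ad_mul: "AdK (mul a c) V = AdK a (AdK c V)"
  using mderiv_compose[OF atlas atlas atlas conj_smooth[of c] conj_smooth[of a], of e V]
  by (simp add: Ad_conj conj_e conj_mul[symmetric, abs_def])

lemma Ad_e: "AdK e V = V"
proof -
  interpret group mul e iv by (rule grp)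
  have "conj e = (\<lambda>x. x)" by (simp add: conj_def fun_eq_iff)
  then show ?thesis by (simp add: Ad_conj mderiv_id[OF atlas])
qed

lemma Ad_linear: "linear (AdK a)"
  unfolding Ad_conj by (rule mderiv_linear[OF atlas atlas conj_smooth])

lemma Ad_chart: "AdK a V = Dr (\<lambda>t. cmap b (conj a (cinv b t))) s0 V"
  by (simp add: Ad_conj mderiv_def conj_e b_def[symmetric] s0_def[symmetric] o_def)

lemma conj_chart_differentiable: "(\<lambda>t. cmap b (conj a (cinv b t))) differentiable (at s0)"
  using mderiv_differentiable[OF atlas atlas conj_smooth, where p = e] by (simp add: conj_e b_def[symmetric] s0_def[symmetric])

text \<open>The mixed second derivative of the group law at the unit, \<open>X\<close> in the first
  slot and \<open>Y\<close> in the second; its antisymmetrisation is the Lie bracket.\<close>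

definition m12 where "m12 X Y = Dr (\<lambda>s. Dr m (s, s0) (0, Y)) s0 X"

abbreviation br where "br \<equiv> lie_bracket B mul e"

lemma left_invariant_chart:
  assumes "s \<in> cim b"
  shows "field_comp B b (left_invariant_field B mul e X) s = Dr m (s, s0) (0, X)"
proof -
  have s: "cinv b s \<in> cdom b" "cmap b (cinv b s) = s"
    using chart_inverse(2,3)[OF is_chart_b assms] by auto
  have "coord B b (mul (cinv b s) e) (mderiv B B (mul (cinv b s)) e X) =
      Dr (\<lambda>t. cmap b (mul (cinv b s) (cinv b t))) (cmap b e) (coord B b e X)"
    by (rule coord_mderiv_eq[OF atlas b atlas b(1) _ mul_left_smooth open_UNIV UNIV_I]) (simp add: s mul_e)
  moreover have "coord B b e X = X" unfolding b_def by (rule coord_chart_at[OF atlas])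
  moreover have "Dr (\<lambda>t. m (s, t)) s0 X = Dr m (s, s0) (0, X)"
    by (rule Dr_partial(1)) (rule smooth_on_differentiable[OF m(2) Om_s0(1)[OF assms]])
  ultimately show ?thesis
    by (simp add: field_comp_coord left_invariant_field_def mul_e m_def s0_def)
qed

lemma left_invariant_e: "left_invariant_field B mul e X e = X"
  using mderiv_id[OF atlas, of e X] by (simp add: left_invariant_field_def mul_e[abs_def])

lemma lie_bracket_m12: "br X Y = m12 X Y - m12 Y X"
proof -
  have "Dr (field_comp B b (left_invariant_field B mul e X)) s0 = Dr (\<lambda>s. Dr m (s, s0) (0, X)) s0" for X
    by (rule Dr_cong[OF open_b s0(2)]) (rule left_invariant_chart)
  then show ?thesis
    by (simp add: lie_bracket_def field_bracket_def b_def[symmetric] s0_def[symmetric] m12_def left_invariant_e Let_def)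
qed

lemma m_differentiable: "z \<in> Om \<Longrightarrow> m differentiable (at z)"
  "z \<in> Om \<Longrightarrow> (\<lambda>z. Dr m z w) differentiable (at z)"
  by (rule smooth_on_differentiable[OF m(2)] smooth_on_differentiable[OF smooth_on_Dr[OF m(2)]], assumption)+

lemma Dr_m_s0: "Dr m (s0, s0) (V, 0) = V"
proof -
  have "Dr m (s0, s0) (V, 0) = Dr (\<lambda>s. m (s, s0)) s0 V"
    by (rule Dr_partial(2)[OF m_differentiable(1)[OF Om_s0(1)[OF s0(2)]], symmetric])
  also have "\<dots> = V"
    by (rule Dr_identity[OF open_b s0(2)]) (rule m_unit(1)[OF Om_s0(1)])
  finally show ?thesis .
qed

text \<open>Differentiate (a h a^-1) a = a h in \<open>h\<close> at the unit. The inverse of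
  \<open>a\<close> is gone, and \<open>AdK a V\<close> becomes the solution of a linear system with
  smooth coefficients.\<close>

lemma Ad_system:
  assumes s: "s \<in> cim b"
  shows "Dr m (s0, s) (AdK (cinv b s) V, 0) = Dr m (s, s0) (0, V)"
proof -
  let ?a = "cinv b s"
  let ?A = "\<lambda>t. cmap b (conj ?a (cinv b t))"
  have A0: "?A s0 = s0" by (simp add: s0(1) conj_e) (simp add: s0_def)
  have Ad: "((\<lambda>t. (?A t, s)) has_derivative (\<lambda>v. (AdK ?a v, 0))) (at s0)"
    unfolding Ad_chart
    by (intro has_derivative_Pair has_derivative_const Dr_works conj_chart_differentiable)
  have mA: "((\<lambda>t. m (?A t, s)) has_derivative (\<lambda>v. Dr m (s0, s) (AdK ?a v, 0))) (at s0)"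
    using diff_chain_at[OF Ad, of m "Dr m (s0, s)"] Dr_works[OF m_differentiable(1)[OF Om_s0(2)[OF s]]]
    by (simp add: o_def A0)
  have ms: "((\<lambda>t. m (s, t)) has_derivative (\<lambda>v. Dr m (s, s0) (0, v))) (at s0)"
    by (rule has_derivative_partial(1)[OF m_differentiable(1)[OF Om_s0(1)[OF s]]])
  have "open (conj ?a -` cdom b)"
    using smooth_map_continuous[OF conj_smooth] chart_open(1)[OF is_chart_b] by (simp add: open_vimage)
  then have op: "open (cmap b ` (cdom b \<inter> conj ?a -` cdom b))"
    by (rule chart_image_open[OF is_chart_b])
  have "Dr (\<lambda>t. m (?A t, s)) s0 = Dr (\<lambda>t. m (s, t)) s0"
  proof (rule Dr_cong[OF op])
    show "s0 \<in> cmap b ` (cdom b \<inter> conj ?a -` cdom b)"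
      unfolding s0_def using b(2) by (auto simp: conj_e)
    fix t assume "t \<in> cmap b ` (cdom b \<inter> conj ?a -` cdom b)"
    then obtain h where h: "h \<in> cdom b" "conj ?a h \<in> cdom b" "t = cmap b h" by auto
    have "mul (conj ?a h) ?a = mul ?a h" by (simp add: conj_def mul_assoc mul_iv mul_e)
    then show "m (?A t, s) = m (s, t)"
      using h by (simp add: m_def chart_inverse[OF is_chart_b])
  qed
  then show ?thesis by (simp add: Dr_eq[OF mA] Dr_eq[OF ms] fun_eq_iff)
qed

text \<open>The derivative of Ad at the unit is ad. The linear system for \<open>AdK\<close> has the
  identity as coefficient at \<open>s0\<close>, so differentiating it shows that
  \<open>m12 X V\<close> is \<open>m12 V X\<close> plus the derivative sought.\<close>

lemma Ad_has_derivative: "((\<lambda>s. AdK (cinv b s) V) has_derivative (\<lambda>X. br X V)) (at s0)"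
proof -
  let ?M = "\<lambda>s w. Dr m (s0, s) (w, 0)"
  let ?z = "\<lambda>s. AdK (cinv b s) V"
  have lin: "linear (?M s)" if "s \<in> cim b" for s
    by (rule has_derivative_linear[OF has_derivative_partial(2)[OF m_differentiable(1)[OF Om_s0(2)[OF that]]]])
  have Md: "((\<lambda>s. ?M s w) has_derivative (\<lambda>X. Dr (\<lambda>z. Dr m z (w, 0)) (s0, s0) (0, X))) (at s0)" for w
    by (rule has_derivative_partial(1)[OF m_differentiable(2)[OF Om_s0(1)[OF s0(2)]]])
  have hd: "((\<lambda>s. Dr m (s, s0) (0, V)) has_derivative (\<lambda>X. m12 X V)) (at s0)"
    unfolding m12_def
    by (rule Dr_works[OF differentiableI[OF has_derivative_partial(2)[OF m_differentiable(2)[OF Om_s0(1)[OF s0(2)]]]]])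
  have M0: "?M s0 w = w" for w by (rule Dr_m_s0)
  have z0: "?z s0 = V" by (simp add: s0 Ad_e)
  have zd: "?z differentiable (at s0)"
  proof (rule linear_system_differentiable[OF open_b s0(2) lin])
    show "inj (?M s0)" by (simp add: M0 inj_on_def)
    show "(\<lambda>y. ?M y w) differentiable (at s0)" for w using Md by (rule differentiableI)
    show "(\<lambda>s. Dr m (s, s0) (0, V)) differentiable (at s0)" using hd by (rule differentiableI)
  qed (auto intro: Ad_system)
  have "((\<lambda>s. ?M s (?z s)) has_derivative (\<lambda>X. Dr (\<lambda>s. ?M s (?z s0)) s0 X + ?M s0 (Dr ?z s0 X))) (at s0)"
    by (rule linear_family_has_derivative[OF open_b s0(2) lin differentiableI[OF Md] zd])
  then have "((\<lambda>s. Dr m (s, s0) (0, V)) has_derivative (\<lambda>X. Dr (\<lambda>s. ?M s (?z s0)) s0 X + ?M s0 (Dr ?z s0 X))) (at s0)"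
    by (rule has_derivative_cong_openI[OF _ open_b s0(2)]) (rule Ad_system[symmetric])
  then have "m12 X V = Dr (\<lambda>s. ?M s V) s0 X + Dr ?z s0 X" for X
    using Dr_eq[OF hd] by (simp add: Dr_eq z0 M0 fun_eq_iff)
  moreover have "Dr (\<lambda>s. ?M s V) s0 X = m12 V X" for X
  proof -
    have "Dr (\<lambda>s. ?M s V) s0 X = Dr (\<lambda>z. Dr m z (V, 0)) (s0, s0) (0, X)" by (simp add: Dr_eq[OF Md])
    also have "\<dots> = Dr (\<lambda>z. Dr m z (0, X)) (s0, s0) (V, 0)"
      by (rule Dr_symmetric[OF m(1) Om_s0(1)[OF s0(2)] m(2)])
    also have "\<dots> = m12 V X" unfolding m12_def
      by (rule Dr_partial(2)[OF m_differentiable(2)[OF Om_s0(1)[OF s0(2)]], symmetric])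
    finally show ?thesis .
  qed
  ultimately have "Dr ?z s0 X = br X V" for X by (simp add: lie_bracket_m12 algebra_simps)
  then have "Dr ?z s0 = (\<lambda>X. br X V)" by (simp add: fun_eq_iff)
  then show ?thesis using Dr_works[OF zd] by simp
qed

text \<open>Ad(h) = Ad(h a^-1) Ad(a) carries the result from the unit to \<open>a\<close>. Only the
  shape of the derivative matters, a bracket with \<open>AdK a V\<close>, so the other entry stays
  existential.\<close>

lemma Ad_has_derivative_at:
  assumes d: "d \<in> B" "a \<in> cdom d"
  shows "\<exists>\<phi>. ((\<lambda>x. AdK (cinv d x) V) has_derivative (\<lambda>u. br (\<phi> u) (AdK a V))) (at (cmap d a))"
proof -
  note isd = atlas_chart[OF atlas d(1)]
  let ?r = "\<lambda>h. mul h (iv a)"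
  let ?\<phi> = "\<lambda>x. cmap b (?r (cinv d x))"
  have ra: "?r a = e" by (simp add: mul_iv)
  have \<phi>d: "?\<phi> differentiable (at (cmap d a))"
    by (rule rep_differentiable[OF mul_right_smooth d(1) b(1) d(2)]) (simp_all add: ra b)
  have \<phi>a: "?\<phi> (cmap d a) = s0" using d by (simp add: chart_inverse[OF isd] ra s0_def)
  have "(((\<lambda>s. AdK (cinv b s) (AdK a V)) \<circ> ?\<phi>) has_derivative ((\<lambda>X. br X (AdK a V)) \<circ> Dr ?\<phi> (cmap d a))) (at (cmap d a))"
    by (rule diff_chain_at[OF Dr_works[OF \<phi>d]]) (unfold \<phi>a, rule Ad_has_derivative)
  then have D: "((\<lambda>x. AdK (cinv b (?\<phi> x)) (AdK a V)) has_derivative (\<lambda>u. br (Dr ?\<phi> (cmap d a) u) (AdK a V))) (at (cmap d a))"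
    by (simp add: o_def)
  have op: "open (cmap d ` (cdom d \<inter> UNIV \<inter> ?r -` cdom b))"
    by (rule rep_open[OF mul_right_smooth open_UNIV isd is_chart_b])
  have "((\<lambda>x. AdK (cinv d x) V) has_derivative (\<lambda>u. br (Dr ?\<phi> (cmap d a) u) (AdK a V))) (at (cmap d a))"
  proof (rule has_derivative_cong_openI[OF D op])
    show "cmap d a \<in> cmap d ` (cdom d \<inter> UNIV \<inter> ?r -` cdom b)" using d b by (auto simp: ra)
    fix x assume "x \<in> cmap d ` (cdom d \<inter> UNIV \<inter> ?r -` cdom b)"
    then obtain h where h: "h \<in> cdom d" "?r h \<in> cdom b" "x = cmap d h" by auto
    have "AdK h V = AdK (?r h) (AdK a V)"
      unfolding Ad_mul[symmetric] by (simp add: mul_assoc mul_iv mul_e)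
    then show "AdK (cinv d x) V = AdK (cinv b (?\<phi> x)) (AdK a V)"
      using h by (simp add: chart_inverse[OF isd] chart_inverse[OF is_chart_b])
  qed
  then show ?thesis by (rule exI[of _ "Dr ?\<phi> (cmap d a)"])
qed

lemma Ad_continuous: "continuous_on UNIV (\<lambda>a. AdK a V)"
proof -
  have "isCont (\<lambda>a. AdK a V) a" for a
  proof -
    let ?d = "chart_at B a"
    note d = chart_at_in[OF atlas, of a]
    note isd = atlas_chart[OF atlas d(1)]
    have 1: "isCont (\<lambda>x. AdK (cinv ?d x) V) (cmap ?d a)"
      using Ad_has_derivative_at[OF d] has_derivative_continuous by blast
    have 2: "isCont (cmap ?d) a"
      using chart_continuous(1)[OF isd] chart_open(1)[OF isd] d(2) continuous_on_eq_continuous_at by blast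
    have "isCont (\<lambda>a. AdK (cinv ?d (cmap ?d a)) V) a" using isCont_o2[OF 2 1] .
    moreover have "eventually (\<lambda>a. AdK (cinv ?d (cmap ?d a)) V = AdK a V) (nhds a)"
      using chart_open(1)[OF isd] d(2) unfolding eventually_nhds by (auto simp: chart_inverse[OF isd])
    ultimately show ?thesis by (simp add: isCont_cong)
  qed
  then show ?thesis by (simp add: continuous_at_imp_continuous_on)
qed

text \<open>The derivative of \<open>l (AdK a V)\<close> in \<open>a\<close> is \<open>l\<close> of
  a bracket, so the function is locally constant on a connected group.\<close>

lemma Ad_invariant_functional:
  fixes l :: "'f \<Rightarrow> real"
  assumes conn: "connected (UNIV :: 'k set)" and lin: "linear l" and br0: "\<And>X Y. l (br X Y) = 0"
  shows "l (AdK a V) = l V"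
proof -
  have "l (AdK a V) = l (AdK e V)"
  proof (rule connected_local_const[where f = "\<lambda>a. l (AdK a V)", OF conn UNIV_I UNIV_I], rule ballI)
    fix a
    let ?d = "chart_at B a"
    note d = chart_at_in[OF atlas, of a]
    note isd = atlas_chart[OF atlas d(1)]
    let ?h = "\<lambda>x. l (AdK (cinv ?d x) V)"
    have D: "(?h has_derivative (\<lambda>u. 0)) (at x)" if "x \<in> cim ?d" for x
    proof -
      obtain c where c: "c \<in> cdom ?d" "x = cmap ?d c" using \<open>x \<in> cim ?d\<close> by auto
      obtain \<phi> where "((\<lambda>x. AdK (cinv ?d x) V) has_derivative (\<lambda>u. br (\<phi> u) (AdK c V))) (at x)"
        using Ad_has_derivative_at[OF d(1) c(1)] c(2) by blast
      from bounded_linear.has_derivative[OF _ this, of l] show ?thesis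
        using lin by (simp add: br0 linear_conv_bounded_linear)
    qed
    have "cmap ?d a \<in> cim ?d" using d by simp
    then obtain r where r: "r > 0" "ball (cmap ?d a) r \<subseteq> cim ?d"
      using chart_open(2)[OF isd] openE by blast
    have const: "?h x = ?h (cmap ?d a)" if "x \<in> ball (cmap ?d a) r" for x
    proof (rule has_derivative_zero_unique[OF convex_ball _ that])
      show "(?h has_derivative (\<lambda>u. 0)) (at y within ball (cmap ?d a) r)" if "y \<in> ball (cmap ?d a) r" for y
        by (rule has_derivative_at_withinI[OF D]) (use r that in blast)
      show "cmap ?d a \<in> ball (cmap ?d a) r" using r by simp
    qed
    have 2: "isCont (cmap ?d) a"
      using chart_continuous(1)[OF isd] chart_open(1)[OF isd] d(2) continuous_on_eq_continuous_at by blast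
    have "eventually (\<lambda>c. cmap ?d c \<in> ball (cmap ?d a) r) (nhds a)"
      by (rule eventually_in_open[OF 2]) (use r in auto)
    moreover have "eventually (\<lambda>c. c \<in> cdom ?d) (nhds a)"
      using chart_open(1)[OF isd] d(2) by (rule eventually_nhds_in_open)
    ultimately have "eventually (\<lambda>c. l (AdK a V) = l (AdK c V)) (nhds a)"
    proof eventually_elim
      case (elim c)
      then show ?case using const[of "cmap ?d c"] d(2) by (simp add: chart_inverse[OF isd])
    qed
    then show "eventually (\<lambda>c. l (AdK a V) = l (AdK c V)) (at a within UNIV)"
      by (simp add: eventually_nhds_conv_at)
  qed
  then show ?thesis by (simp add: Ad_e)
qed

lemma semisimple_functional_zero:
  fixes l :: "'f \<Rightarrow> real"
  assumes comp: "compact (UNIV :: 'k set)" and conn: "connected (UNIV :: 'k set)"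
    and ss: "semisimple_lie_algebra br" and lin: "linear l" and br0: "\<And>X Y. l (br X Y) = 0"
  shows "l V = 0"
proof (rule ccontr)
  assume V: "l V \<noteq> 0"
  obtain z where z: "z \<in> convex hull (range (\<lambda>a. AdK a V))" "\<And>a. AdK a z = z"
    using compact_group_fixed_point[OF comp, of AdK mul iv V] Ad_linear Ad_mul Ad_continuous
    by (metis Ad_e mul_iv(1))
  \<comment> \<open>This affine hyperplane contains the orbit of \<open>V\<close>, hence also the
    fixed vector, which therefore is not zero.\<close>
  have "convex {w. l w = l V}"
    unfolding convex_def by (auto simp: linear_add[OF lin] linear_scale[OF lin] distrib_right[symmetric])
  then have "convex hull (range (\<lambda>a. AdK a V)) \<subseteq> {w. l w = l V}"
    by (intro hull_minimal) (auto simp: Ad_invariant_functional[OF conn lin br0])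
  then have "l z = l V" using z by blast
  then have z0: "z \<noteq> 0" using V linear_0[OF lin] by auto
  \<comment> \<open>Differentiating \<open>AdK a z = z\<close> at the unit shows that
    \<open>z\<close> is central.\<close>
  have bz: "br X z = 0" for X
    using Dr_eq[OF Ad_has_derivative[of z]] by (simp add: z(2) fun_eq_iff)
  have anti: "br X Y = - br Y X" for X Y by (simp add: lie_bracket_m12)
  have br_lin: "linear (\<lambda>X. br X Y)" for Y by (rule has_derivative_linear[OF Ad_has_derivative])
  have zY: "br (c *\<^sub>R z) Y = 0" for c Y
    using linear_scale[OF br_lin, of c z Y] anti[of z Y] bz by simp
  have I: "lie_ideal br (span {z})"
    unfolding lie_ideal_def
  proof (intro conjI ballI allI)
    show "br X Y \<in> span {z}" if "X \<in> span {z}" for X Y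
      using that by (auto simp: span_singleton zY intro: image_eqI[of _ _ 0])
  qed (rule subspace_span)
  have "{br X Y |X Y. X \<in> span {z} \<and> Y \<in> span {z}} \<subseteq> {0}"
    by (auto simp: span_singleton zY)
  from span_mono[OF this] have "span {br X Y |X Y. X \<in> span {z} \<and> Y \<in> span {z}} \<subseteq> {0}" by simp
  then have "derived_series br (span {z}) (Suc 0) = {0}"
    using span_zero by (simp only: derived_series.simps) blast
  then have "span {z} = {0}" using ss I unfolding semisimple_lie_algebra_def by blast
  then show False using z0 span_base[of z "{z}"] by auto
qed

end


section \<open>Fundamental fields of a Hamiltonian isometric action\<close>

locale kaehler_action = lie_grp B mul e iv
  for B :: "('k::{t2_space, second_countable_topology}, 'f::euclidean_space) chart set" and mul e iv +
  fixes A :: "('m::{t2_space, second_countable_topology}, complex ^ 'n) chart set"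
    and g :: "'m \<Rightarrow> complex ^ 'n \<Rightarrow> complex ^ 'n \<Rightarrow> real"
    and act :: "'k \<Rightarrow> 'm \<Rightarrow> 'm"
  assumes K: "kaehler_manifold A g"
    and iso_act: "isometric_action B mul e A g act"
    and ham_act: "hamiltonian_action B mul e iv A (kaehler_form g) act"
begin

lemma atlas_A: "smooth_atlas A" and complex_A: "complex_atlas A" and metric: "riemannian_metric A g"
  using K by (auto simp: kaehler_manifold_def complex_atlas_def)

lemma act_e: "act e p = p" and act_mul: "act (mul a a') p = act a (act a' p)"
  and act_smooth: "smooth_map (prod_atlas B A) A (\<lambda>(a, p). act a p)"
  and act_isometry: "isometry A g (act a)"
  using iso_act by (simp_all add: isometric_action_def)

lemma act_iv: "act (iv a) (act a p) = p" "act a (act (iv a) p) = p"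
  by (simp_all add: act_mul[symmetric] mul_iv act_e)

lemma act_smooth1: "smooth_map A A (act a)" and act_smooth2: "smooth_map B A (\<lambda>a. act a p)"
  by (rule smooth_map_slice[OF atlas atlas_A atlas_A act_smooth])+

abbreviation fund :: "'f \<Rightarrow> 'm \<Rightarrow> complex ^ 'n" where
  "fund \<equiv> fundamental_field B e A act"

abbreviation \<omega> where "\<omega> \<equiv> kaehler_form g"

text \<open>The action near the unit, in the chart \<open>b\<close> of the group and the chart
  \<open>c\<close> of the manifold; \<open>s\<close> is a group coordinate, not a time. Its
  derivative in \<open>s\<close>, called \<open>xi\<close> below, gives the components of the
  fundamental fields.\<close>

definition flow :: "('m, complex ^ 'n) chart \<Rightarrow> 'f \<times> (complex ^ 'n) \<Rightarrow> complex ^ 'n" where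
  "flow c = (\<lambda>(s, x). cmap c (act (cinv b s) (cinv c x)))"

definition flow_dom :: "('m, complex ^ 'n) chart \<Rightarrow> ('f \<times> (complex ^ 'n)) set" where
  "flow_dom c = {(s, x). s \<in> cim b \<and> x \<in> cim c \<and> act (cinv b s) (cinv c x) \<in> cdom c}"

definition xi :: "('m, complex ^ 'n) chart \<Rightarrow> 'f \<Rightarrow> complex ^ 'n \<Rightarrow> complex ^ 'n" where
  "xi c X x = Dr (flow c) (s0, x) (X, 0)"

lemma fund_mderiv: "fund X p = mderiv B A (\<lambda>a. act a p) e X"
  by (simp add: fundamental_field_def)

lemma fund_linear: "linear (\<lambda>X. fund X p)"
  unfolding fund_mderiv by (rule mderiv_linear[OF atlas atlas_A act_smooth2])

context
  fixes c :: "('m, complex ^ 'n) chart"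
  assumes c: "c \<in> A"
begin

lemma is_chart_c: "is_chart c" by (rule atlas_chart[OF atlas_A c])

lemma flow_smooth: "open (flow_dom c)" "smooth_on (flow_dom c) (flow c)"
  unfolding flow_dom_def flow_def by (rule prod_rep[OF atlas b(1) atlas_A c atlas_A c act_smooth])+

lemma flow_e: "x \<in> cim c \<Longrightarrow> (s0, x) \<in> flow_dom c" "x \<in> cim c \<Longrightarrow> flow c (s0, x) = x"
  using chart_inverse[OF is_chart_c] by (auto simp: flow_dom_def flow_def s0 act_e)

lemma flow_differentiable: "z \<in> flow_dom c \<Longrightarrow> flow c differentiable (at z)"
  by (rule smooth_on_differentiable[OF flow_smooth(2)])

lemma field_comp_fund:
  assumes x: "x \<in> cim c"
  shows "field_comp A c (fund X) x = xi c X x"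
proof -
  have p: "cinv c x \<in> cdom c" "cmap c (cinv c x) = x"
    using chart_inverse(2,3)[OF is_chart_c x] by auto
  have "coord A c (act e (cinv c x)) (mderiv B A (\<lambda>a. act a (cinv c x)) e X) =
      Dr (\<lambda>s. cmap c (act (cinv b s) (cinv c x))) (cmap b e) (coord B b e X)"
    by (rule coord_mderiv_eq[OF atlas b atlas_A c _ act_smooth2 open_UNIV UNIV_I]) (simp add: p act_e)
  moreover have "coord B b e X = X" unfolding b_def by (rule coord_chart_at[OF atlas])
  moreover have "Dr (\<lambda>s. flow c (s, x)) s0 X = Dr (flow c) (s0, x) (X, 0)"
    by (rule Dr_partial(2)[OF flow_differentiable[OF flow_e(1)[OF x]]])
  ultimately show ?thesis
    by (simp add: field_comp_coord fund_mderiv act_e flow_def s0_def xi_def)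
qed

interpretation loc: local_kaehler "cim c" "form_comp A c g" "(*s) \<i>"
  by (rule local_kaehler_chart[OF K c])

lemma xi_linear: "x \<in> cim c \<Longrightarrow> linear (\<lambda>X. xi c X x)"
  unfolding xi_def using flow_differentiable[OF flow_e(1)]
  by (rule has_derivative_linear[OF has_derivative_partial(2)])

lemma xi_killing: "loc.killing (xi c X)"
  unfolding xi_def[abs_def]
proof (rule loc.killing_of_flow[OF flow_smooth(1) flow_e(1) flow_smooth(2) flow_e(2)])
  fix s x u v assume sx: "(s, x) \<in> flow_dom c" and x: "x \<in> cim c"
  let ?a = "cinv b s" and ?p = "cinv c x"
  have ap: "act ?a ?p \<in> cdom c" using sx by (simp add: flow_dom_def)
  then have F: "flow c (s, x) \<in> cim c" "cinv c (flow c (s, x)) = act ?a ?p"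
    by (auto simp: flow_def chart_inverse[OF is_chart_c])
  have D: "mderiv A A (act ?a) ?p (chart_vec A c x w) =
      chart_vec A c (flow c (s, x)) (Dr (\<lambda>x. flow c (s, x)) x w)" for w
    using mderiv_chart_vec[where f="act ?a" and c=c and x=x, OF atlas_A c x atlas_A c ap act_smooth1]
    by (simp add: flow_def)
  have "g (act ?a ?p) (mderiv A A (act ?a) ?p u') (mderiv A A (act ?a) ?p v') = g ?p u' v'" for u' v'
    using act_isometry[of ?a] by (simp add: isometry_def)
  then have "form_comp A c g (flow c (s, x)) (Dr (\<lambda>x. flow c (s, x)) x u) (Dr (\<lambda>x. flow c (s, x)) x v) =
      form_comp A c g x u v"
    unfolding form_comp_def F(2) D[symmetric] by simp
  with F(1) show "flow c (s, x) \<in> cim c \<and>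
      form_comp A c g (flow c (s, x)) (Dr (\<lambda>x. flow c (s, x)) x u) (Dr (\<lambda>x. flow c (s, x)) x v) =
      form_comp A c g x u v" ..
qed

lemma xi_smooth: "smooth_on (cim c) (xi c X)"
  using xi_killing by (simp add: loc.killing_def)

lemma xi_hamiltonian: "loc.hamiltonian (xi c X)"
proof -
  obtain \<mu> where \<mu>: "moment_map B mul e iv A \<omega> act \<mu>"
    using ham_act unfolding hamiltonian_action_def by blast
  have \<mu>s: "smooth_map A vector_atlas \<mu>"
    and \<mu>d: "blinfun_apply (mderiv A vector_atlas \<mu> p v) X = \<omega> p v (fund X p)" for p v
    using \<mu> by (auto simp: moment_map_def)
  have sm: "smooth_on (cim d) (\<lambda>x. \<mu> (cinv d x))" if "d \<in> A" for d
    using rep_smooth[OF \<mu>s that, of "(UNIV, \<lambda>x. x)"] by (simp add: vector_atlas_def)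
  \<comment> \<open>The Hamiltonian function is the component of the moment map along
    \<open>X\<close>, read in the chart.\<close>
  let ?f = "\<lambda>x. blinfun_apply (\<mu> (cinv c x)) X"
  have bl: "bounded_linear (\<lambda>L. blinfun_apply L X)" by (rule blinfun.bounded_linear_left)
  have "smooth_on (cim c) ?f"
    by (rule smooth_on_bounded_linear_compose[OF loc.open_U bl sm[OF c]])
  moreover have "Dr ?f x u = form_comp A c g x (\<i> *s u) (xi c X x)" if x: "x \<in> cim c" for x u
  proof -
    let ?p = "cinv c x" and ?d = "chart_at A (cinv c x)"
    note d = chart_at_in[OF atlas_A, of ?p]
    have p: "?p \<in> cdom c" "cmap c ?p = x" using chart_inverse(2,3)[OF is_chart_c x] by auto
    have dd: "(\<lambda>x. \<mu> (cinv d x)) differentiable (at (cmap d ?p))" if "d \<in> A" "?p \<in> cdom d" for d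
      using that by (intro smooth_on_differentiable[OF sm]) auto
    have cv: "chart_vec A c x u = Dr (\<lambda>x. cmap ?d (cinv c x)) x u"
      by (simp add: chart_vec_def mderiv_def chart_at_vector vector_chart o_def)
    have "mderiv A vector_atlas \<mu> ?p (chart_vec A c x u) =
        Dr (\<lambda>x. \<mu> (cinv ?d x)) (cmap ?d ?p) (Dr (\<lambda>x. cmap ?d (cinv c x)) (cmap c ?p) u)"
      by (simp add: cv mderiv_def chart_at_vector o_def p)
    also have "\<dots> = Dr (\<lambda>x. \<mu> (cinv c x)) (cmap c ?p) u"
      by (rule rep_change_source[symmetric, OF atlas_A d(1) c d(2) p(1) dd[OF d]])
    finally have "Dr ?f x u = \<omega> ?p (chart_vec A c x u) (fund X ?p)"
      using Dr_bounded_linear_compose[OF bl, of "\<lambda>x. \<mu> (cinv c x)" x u] dd[OF c p(1)]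
      by (simp add: \<mu>d[symmetric] p)
    also have "fund X ?p = chart_vec A c x (xi c X x)"
      using chart_vec_field_comp[OF atlas_A c x, of "fund X"] by (simp add: field_comp_fund[OF x])
    also have "\<omega> ?p (chart_vec A c x u) (chart_vec A c x (xi c X x)) = form_comp A c g x (\<i> *s u) (xi c X x)"
      unfolding form_comp_kaehler[OF complex_A c x, symmetric] by (simp add: form_comp_def)
    finally show ?thesis .
  qed
  ultimately show ?thesis unfolding loc.hamiltonian_def by blast
qed

lemma flow_assoc:
  assumes "(s, t) \<in> Om" "(t, x) \<in> flow_dom c"
  shows "flow c (m (s, t), x) = flow c (s, flow c (t, x))"
  using assms by (auto simp: Om_def flow_dom_def flow_def m_def act_mul
      chart_inverse[OF is_chart_b] chart_inverse[OF is_chart_c])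

text \<open>The right-hand side is minus the bracket of the fundamental fields, the usual sign for a
  left action. Subtracting the second-order identities for (X, Y) and (Y, X) removes the term that
  is symmetric in them.\<close>

lemma xi_bracket:
  assumes x: "x \<in> cim c"
  shows "xi c (br X Y) x = Dr (xi c X) x (xi c Y x) - Dr (xi c Y) x (xi c X x)"
proof -
  have E: "Dr (\<lambda>z. Dr (flow c) z (Y, 0)) (s0, x) (X, 0) + xi c (m12 X Y) x = Dr (xi c X) x (xi c Y x)" for X Y
    using local_action_second_derivative[OF flow_smooth m Om_s0(1)[OF s0(2)] flow_e(1)[OF x] flow_e(2)[OF x] m_unit flow_assoc, of Y X]
    by (simp add: m12_def xi_def[abs_def])
  have "Dr (\<lambda>z. Dr (flow c) z (Y, 0)) (s0, x) (X, 0) = Dr (\<lambda>z. Dr (flow c) z (X, 0)) (s0, x) (Y, 0)"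
    by (rule Dr_symmetric[OF flow_smooth(1) flow_e(1)[OF x] flow_smooth(2)])
  then show ?thesis
    unfolding lie_bracket_m12 linear_diff[OF xi_linear[OF x]] E[symmetric] by simp
qed

end

section \<open>Covariant derivatives of fundamental fields on the manifold, and the trace
  identity\<close>

definition nabla :: "'f \<Rightarrow> 'm \<Rightarrow> complex ^ 'n \<Rightarrow> complex ^ 'n" where
  "nabla X p u = cov_deriv A g (fund X) p u"

lemma chart_p: "chart_at A p \<in> A" "p \<in> cdom (chart_at A p)"
  "cmap (chart_at A p) p \<in> cim (chart_at A p)" "cinv (chart_at A p) (cmap (chart_at A p) p) = p"
  using chart_at_in[OF atlas_A, of p] chart_inverse(1)[OF atlas_chart[OF atlas_A chart_at_in(1)[OF atlas_A, of p]]]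
  by auto

lemma loc_kaehler: "local_kaehler (cim (chart_at A p)) (form_comp A (chart_at A p) g) ((*s) \<i>)"
  by (rule local_kaehler_chart[OF K chart_p(1)])

lemma christoffel_Gam: "christoffel A g c = local_kaehler.Gam (form_comp A c g)"
  if "c \<in> A"
  by (rule ext) (simp add: christoffel_def local_kaehler.Gam_def[OF local_kaehler_chart[OF K that]])

lemma form_comp_p: "form_comp A (chart_at A p) g (cmap (chart_at A p) p) u v = g p u v"
  by (simp add: form_comp_def chart_vec_chart_at[OF atlas_A] chart_p)

lemma xi_p: "xi (chart_at A p) X (cmap (chart_at A p) p) = fund X p"
proof -
  have "fund X p = chart_vec A (chart_at A p) (cmap (chart_at A p) p) (field_comp A (chart_at A p) (fund X) (cmap (chart_at A p) p))"
    using chart_vec_field_comp[OF atlas_A chart_p(1) chart_p(3), where V = "fund X"] chart_p(4) by simp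
  then show ?thesis
    by (simp add: chart_vec_chart_at[OF atlas_A] field_comp_fund[OF chart_p(1) chart_p(3)])
qed

lemma cov_deriv_eq:
  "cov_deriv A g V p u = Dr (field_comp A (chart_at A p) V) (cmap (chart_at A p) p) u +
    local_kaehler.Gam (form_comp A (chart_at A p) g) (cmap (chart_at A p) p) u (V p)"
  by (simp add: cov_deriv_def Let_def christoffel_Gam[OF chart_p(1)])

lemma nabla_nab:
  "nabla X p = local_kaehler.nab (form_comp A (chart_at A p) g) (xi (chart_at A p) X) (cmap (chart_at A p) p)"
proof -
  let ?c = "chart_at A p" and ?x = "cmap (chart_at A p) p"
  interpret local_kaehler "cim ?c" "form_comp A ?c g" "(*s) \<i>" by (rule loc_kaehler)
  have "Dr (field_comp A ?c (fund X)) ?x = Dr (xi ?c X) ?x"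
    by (rule Dr_cong[OF open_U chart_p(3)]) (rule field_comp_fund[OF chart_p(1)])
  then show ?thesis by (simp add: fun_eq_iff nabla_def cov_deriv_eq nab_def xi_p)
qed

lemma nabla_i: "nabla X p (\<i> *s u) = \<i> *s nabla X p u"
proof -
  let ?c = "chart_at A p" and ?x = "cmap (chart_at A p) p"
  interpret local_kaehler "cim ?c" "form_comp A ?c g" "(*s) \<i>" by (rule loc_kaehler)
  show ?thesis
    using nab_J[OF xi_killing[OF chart_p(1)] xi_hamiltonian[OF chart_p(1)] chart_p(3)]
    by (simp add: nabla_nab)
qed

lemma nabla_linear: "linear (nabla X p)"
proof -
  let ?c = "chart_at A p" and ?x = "cmap (chart_at A p) p"
  interpret local_kaehler "cim ?c" "form_comp A ?c g" "(*s) \<i>" by (rule loc_kaehler)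
  show ?thesis unfolding nabla_nab
    by (rule nab_linear[OF chart_p(3) killing_differentiable[OF xi_killing[OF chart_p(1)] chart_p(3)]])
qed

lemma nabla_linear_X: "linear (\<lambda>X. nabla X p u)"
proof -
  let ?c = "chart_at A p" and ?x = "cmap (chart_at A p) p"
  interpret local_kaehler "cim ?c" "form_comp A ?c g" "(*s) \<i>" by (rule loc_kaehler)
  note xd = killing_differentiable[OF xi_killing[OF chart_p(1)] chart_p(3)]
  note lin = xi_linear[OF chart_p(1)]
  have 1: "Dr (xi ?c (X + Y)) ?x = (\<lambda>u. Dr (xi ?c X) ?x u + Dr (xi ?c Y) ?x u)" for X Y
    by (rule Dr_eq, rule has_derivative_cong_openI[OF has_derivative_add[OF Dr_works[OF xd] Dr_works[OF xd]] open_U chart_p(3)])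
      (simp add: linear_add[OF lin])
  have 2: "Dr (xi ?c (r *\<^sub>R X)) ?x = (\<lambda>u. r *\<^sub>R Dr (xi ?c X) ?x u)" for r X
    by (rule Dr_eq, rule has_derivative_cong_openI[OF has_derivative_scaleR_right[OF Dr_works[OF xd]] open_U chart_p(3)])
      (simp add: linear_scale[OF lin])
  show ?thesis
    unfolding nabla_nab nab_def
    by (rule linearI) (simp_all add: 1 2 linear_add[OF lin[OF chart_p(3)]] linear_scale[OF lin[OF chart_p(3)]]
        linear_add[OF Gam_linear[OF chart_p(3)]] linear_scale[OF Gam_linear[OF chart_p(3)]] algebra_simps)
qed

lemma ricci_tr:
  "ricci A g p v w = tr (\<lambda>u. local_kaehler.Riem (form_comp A (chart_at A p) g) (cmap (chart_at A p) p) u v w)"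
proof -
  let ?c = "chart_at A p" and ?x = "cmap (chart_at A p) p"
  interpret local_kaehler "cim ?c" "form_comp A ?c g" "(*s) \<i>" by (rule loc_kaehler)
  show ?thesis
    by (simp add: ricci_def tr_def curvature_def Let_def Riem_def christoffel_Gam[OF chart_p(1)])
qed

lemma trace_nabla_bracket:
  "tr (\<lambda>w. \<i> *s nabla (br X Y) p w) =
     ricci A g p (fund X p) (\<i> *s fund Y p) - ricci A g p (fund Y p) (\<i> *s fund X p)"
proof -
  let ?c = "chart_at A p" and ?x = "cmap (chart_at A p) p"
  interpret local_kaehler "cim ?c" "form_comp A ?c g" "(*s) \<i>" by (rule loc_kaehler)
  note k = xi_killing[OF chart_p(1)] xi_hamiltonian[OF chart_p(1)]
  show ?thesis
    using trace_nab_bracket[OF k k chart_p(3) xi_bracket[OF chart_p(1)]]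
    by (simp add: ricci_tr nabla_nab xi_p)
qed

text \<open>For Ric = k g the two Ricci terms of a bracket add up to -2k times \<omega> of the
  fundamental vectors at \<open>p\<close>, so the functional vanishes on all brackets.\<close>

lemma trace_nabla_zero:
  assumes "compact (UNIV :: 'k set)" "connected (UNIV :: 'k set)" "semisimple_lie_algebra br"
    and E: "einstein_metric A g" and \<omega>0: "\<And>X Y. \<omega> p (fund X p) (fund Y p) = 0"
  shows "tr (\<lambda>w. \<i> *s nabla X p w) = 0"
proof (rule semisimple_functional_zero[OF assms(1-3)])
  have "linear (\<lambda>X. (\<i> *s nabla X p d) \<bullet> d)" for d
    by (rule linearI) (simp_all add: linear_add[OF nabla_linear_X] linear_scale[OF nabla_linear_X]
        linear_add[OF linear_i] linear_scale[OF linear_i] inner_add_left)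
  then show "linear (\<lambda>X. tr (\<lambda>w. \<i> *s nabla X p w))"
    unfolding tr_def by (intro linear_compose_sum) auto
  obtain k where k: "\<And>u v. ricci A g p u v = k * g p u v"
    using E unfolding einstein_metric_def by blast
  have sym: "g p u v = g p v u" for u v using metric by (simp add: riemannian_metric_def)
  show "tr (\<lambda>w. \<i> *s nabla (br X Y) p w) = 0" for X Y
    unfolding trace_nabla_bracket k
    using \<omega>0[of X Y] \<omega>0[of Y X] by (simp add: kaehler_form_def sym[of _ "\<i> *s _"])
qed

end


section \<open>Maps of constant rank\<close>

text \<open>A basis of \<open>R\<close> can be started with the kernel vector \<open>v\<close>,
  which contributes nothing to the image.\<close>

lemma dim_kernel_less:
  fixes P :: "'a::euclidean_space \<Rightarrow> 'b::euclidean_space"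
  assumes P: "linear P" and R: "subspace R" and v: "v \<in> R" "P v = 0" "v \<noteq> 0"
  shows "dim (P ` R) < dim R"
proof -
  have "{v} \<subseteq> R" "independent {v}" using v by auto
  then obtain B where B: "{v} \<subseteq> B" "B \<subseteq> R" "independent B" "R \<subseteq> span B"
    by (rule maximal_independent_subset_extend)
  have fin: "finite B" using B(3) by (rule independent_imp_finite)
  have card: "card B = dim R" using B(2-4) by (intro basis_card_eq_dim) auto
  have "P ` R \<subseteq> span (P ` (B - {v}))"
  proof -
    have "P ` R \<subseteq> P ` span B" using B(4) by blast
    also have "\<dots> = span (P ` B)" by (rule span_linear_image[OF P, symmetric])
    also have "P ` B = insert 0 (P ` (B - {v}))" using B(1) v(2) by force
    also have "span \<dots> = span (P ` (B - {v}))" by (rule span_insert_0)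
    finally show ?thesis .
  qed
  then have "dim (P ` R) \<le> card (P ` (B - {v}))" using fin by (intro dim_le_card) auto
  also have "\<dots> \<le> card (B - {v})" using fin by (intro card_image_le) auto
  also have "\<dots> < dim R" using B(1) fin card by (metis card_Diff1_less insert_subset)
  finally show ?thesis .
qed

text \<open>The constant rank theorem, in the form that \<open>\<Phi>\<close> is locally a graph over the image of its
  differential. With \<open>L\<^sub>0\<close> the differential at \<open>s\<^sub>0\<close> and \<open>T\<close> a generalised inverse of it, the map
  \<open>\<Theta> s = T (\<Phi> s) + s - T (L\<^sub>0 s)\<close> is a local diffeomorphism with \<open>L\<^sub>0 \<circ> \<Theta> = L\<^sub>0 \<circ> T \<circ> \<Phi>\<close>.\<close>

lemma constant_rank_graph:
  fixes \<Phi> :: "'f::euclidean_space \<Rightarrow> 'e::euclidean_space"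
  assumes V0: "open V0" "s0 \<in> V0" and \<Phi>: "smooth_on V0 \<Phi>"
    and rank: "\<And>s. s \<in> V0 \<Longrightarrow> dim (range (Dr \<Phi> s)) \<le> dim (range (Dr \<Phi> s0))"
  obtains N and P :: "'e \<Rightarrow> 'e" where "open N" "s0 \<in> N" "N \<subseteq> V0" "linear P" "dim (range P) \<le> dim (range (Dr \<Phi> s0))"
    "\<And>s s'. s \<in> N \<Longrightarrow> s' \<in> N \<Longrightarrow> P (\<Phi> s) = P (\<Phi> s') \<Longrightarrow> \<Phi> s = \<Phi> s'"
proof -
  define L0 where "L0 = Dr \<Phi> s0"
  have \<Phi>d: "(\<Phi> has_derivative Dr \<Phi> s) (at s)" if "s \<in> V0" for s
    by (rule smooth_on_has_derivative[OF \<Phi> that])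
  have lin\<Phi>: "linear (Dr \<Phi> s)" if "s \<in> V0" for s
    by (rule linear_Dr[OF smooth_on_differentiable[OF \<Phi> that]])
  have L0: "linear L0" unfolding L0_def by (rule lin\<Phi>[OF V0(2)])
  obtain T where T: "linear T" "\<And>w. w \<in> range L0 \<Longrightarrow> L0 (T w) = w"
    using linear_exists_right_inverse_on[OF L0 subspace_UNIV] by auto
  define P where "P w = L0 (T w)" for w
  have P: "linear P" unfolding P_def using linear_compose[OF T(1) L0] by (simp add: o_def)
  have PL0: "P (L0 u) = L0 u" for u unfolding P_def by (rule T(2)) simp
  define \<Theta> where "\<Theta> s = T (\<Phi> s) + (s - T (L0 s))" for s
  have L\<Theta>: "L0 (\<Theta> s) = P (\<Phi> s)" for s
    using PL0[of s] by (simp add: \<Theta>_def linear_add[OF L0] linear_diff[OF L0] P_def)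
  have bT: "bounded_linear T" and bTL: "bounded_linear (\<lambda>s. T (L0 s))"
    using T(1) linear_compose[OF L0 T(1)] by (simp_all add: linear_conv_bounded_linear o_def)
  define D where "D s u = T (Dr \<Phi> s u) + (u - T (L0 u))" for s u
  have \<Theta>d: "(\<Theta> has_derivative D s) (at s)" if "s \<in> V0" for s
    unfolding \<Theta>_def D_def
    by (intro has_derivative_add has_derivative_diff has_derivative_ident
        bounded_linear.has_derivative[OF bT \<Phi>d[OF that]] bounded_linear_imp_has_derivative[OF bTL])
  have bD: "bounded_linear (D s)" if "s \<in> V0" for s using \<Theta>d[OF that] by (rule has_derivative_bounded_linear)
  define f' where "f' s = Blinfun (D s)" for s
  have f': "blinfun_apply (f' s) = D s" if "s \<in> V0" for s
    unfolding f'_def by (rule bounded_linear_Blinfun_apply[OF bD[OF that]])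
  have "continuous_on V0 f'"
  proof (rule continuous_on_blinfun_componentwise)
    fix i :: 'f
    have "continuous_on V0 (\<lambda>s. D s i)" unfolding D_def
      by (intro continuous_on_add bounded_linear.continuous_on[OF bT] smooth_on_continuous_on[OF smooth_on_Dr[OF \<Phi>]] continuous_on_const)
    then show "continuous_on V0 (\<lambda>s. blinfun_apply (f' s) i)"
      by (rule continuous_on_cong[THEN iffD1, rotated 2]) (simp_all add: f')
  qed
  \<comment> \<open>At \<open>s0\<close> the derivative of \<open>\<Theta>\<close> is the identity,
    so the inverse function theorem applies.\<close>
  moreover have "id_blinfun o\<^sub>L f' s0 = id_blinfun"
    by (rule blinfun_eqI) (simp add: f'[OF V0(2)] D_def L0_def)
  moreover have "(\<Theta> has_derivative blinfun_apply (f' s)) (at s)" if "s \<in> V0" for s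
    using \<Theta>d[OF that] f'[OF that] by simp
  ultimately obtain U' V G G' where U': "open U'" "U' \<subseteq> V0" "s0 \<in> U'" and V: "open V" "\<Theta> s0 \<in> V"
    and hom: "homeomorphism U' V \<Theta> G" and Gd: "\<And>y. y \<in> V \<Longrightarrow> (G has_derivative (G' y)) (at y)"
    and G': "\<And>y. y \<in> V \<Longrightarrow> G' y = inv (blinfun_apply (f'(G y)))"
    and bij: "\<And>y. y \<in> V \<Longrightarrow> bij (blinfun_apply (f'(G y)))"
    using inverse_function_theorem[OF V0(1) _ _ V0(2), of \<Theta> f' id_blinfun] by blast
  have h: "\<And>s. s \<in> U' \<Longrightarrow> G (\<Theta> s) = s" "\<And>s. s \<in> U' \<Longrightarrow> \<Theta> s \<in> V" "\<And>y. y \<in> V \<Longrightarrow> G y \<in> U'" "\<And>y. y \<in> V \<Longrightarrow> \<Theta> (G y) = y"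
    using hom unfolding homeomorphism_def by auto
  obtain \<epsilon> where \<epsilon>: "\<epsilon> > 0" "ball (\<Theta> s0) \<epsilon> \<subseteq> V" using V openE by blast
  define N where "N = U' \<inter> \<Theta> -` ball (\<Theta> s0) \<epsilon>"
  have contU: "continuous_on U' \<Theta>" using hom by (simp add: homeomorphism_def)
  have LD: "L0 (D s u) = P (Dr \<Phi> s u)" if "s \<in> V0" for s u
    using PL0[of u] by (simp add: D_def linear_add[OF L0] linear_diff[OF L0] P_def)
  \<comment> \<open>As \<open>D s\<close> is bijective, \<open>P\<close> maps the range of the
    derivative at \<open>s\<close> onto a space containing the range of \<open>L0\<close>. The rank
    at \<open>s\<close> is not larger than at \<open>s0\<close>, so \<open>P\<close> loses no
    dimension and is injective there.\<close>
  have Pinj: "Dr \<Phi> s u = 0" if s: "s \<in> U'" and z: "P (Dr \<Phi> s u) = 0" for s u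
  proof (rule ccontr)
    assume nz: "Dr \<Phi> s u \<noteq> 0"
    have sV: "s \<in> V0" using s U' by blast
    have "bij (D s)" using bij[OF h(2)[OF s]] h(1)[OF s] f'[OF sV] by simp
    then have "range L0 \<subseteq> P ` range (Dr \<Phi> s)"
      unfolding image_subset_iff by (metis LD[OF sV] bij_pointE rangeI image_eqI)
    then have "dim (range L0) \<le> dim (P ` range (Dr \<Phi> s))" by (rule dim_subset)
    also have "\<dots> < dim (range (Dr \<Phi> s))"
      using z nz by (intro dim_kernel_less[OF P _ rangeI]) (auto intro: linear_subspace_image[OF lin\<Phi>[OF sV] subspace_UNIV])
    finally show False using rank[OF sV] by (simp add: L0_def)
  qed
  show thesis
  proof (rule that)
    show "open N" unfolding N_def by (rule continuous_open_preimage[OF contU U'(1) open_ball])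
    show "s0 \<in> N" using U' \<epsilon> by (simp add: N_def)
    show "N \<subseteq> V0" using U' by (auto simp: N_def)
    show "linear P" by (rule P)
    have "range P \<subseteq> range L0" by (auto simp: P_def)
    then show "dim (range P) \<le> dim (range (Dr \<Phi> s0))" unfolding L0_def[symmetric] by (rule dim_subset)
    fix s s' assume s: "s \<in> N" "s' \<in> N" and eq: "P (\<Phi> s) = P (\<Phi> s')"
    \<comment> \<open>The segment between the images under \<open>\<Theta>\<close> lies in a ball,
      hence in \<open>V\<close>. Its direction is annihilated by \<open>L0\<close>, so the
      derivative of \<open>\<Phi>\<close> along the preimage curve is annihilated by
      \<open>P\<close> and vanishes.\<close>
    let ?y = "\<lambda>t::real. \<Theta> s + t *\<^sub>R (\<Theta> s' - \<Theta> s)"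
    let ?w = "\<Theta> s' - \<Theta> s"
    have yV: "?y t \<in> V" if "t \<in> {0..1}" for t
    proof -
      have "?y t = (1 - t) *\<^sub>R \<Theta> s + t *\<^sub>R \<Theta> s'" by (simp add: algebra_simps)
      also have "\<dots> \<in> ball (\<Theta> s0) \<epsilon>"
        using s that by (intro convexD_alt[OF convex_ball]) (auto simp: N_def)
      finally show ?thesis using \<epsilon>(2) by blast
    qed
    have L0w: "L0 ?w = 0" using eq L\<Theta> by (simp add: linear_diff[OF L0])
    have d: "((\<lambda>t. \<Phi> (G (?y t))) has_derivative (\<lambda>h. 0)) (at t)" if t: "t \<in> {0..1}" for t
    proof -
      let ?x = "G (?y t)"
      have xU: "?x \<in> U'" by (rule h(3)[OF yV[OF t]])
      have xV: "?x \<in> V0" using xU U' by blast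
      have "(?y has_derivative (\<lambda>h. h *\<^sub>R ?w)) (at t)" by (auto intro!: derivative_eq_intros)
      from diff_chain_at[OF this Gd[OF yV[OF t]]]
      have "((\<lambda>t. G (?y t)) has_derivative (\<lambda>h. G' (?y t) (h *\<^sub>R ?w))) (at t)" by (simp add: o_def)
      from diff_chain_at[OF this \<Phi>d[OF xV]]
      have "((\<lambda>t. \<Phi> (G (?y t))) has_derivative (\<lambda>h. Dr \<Phi> ?x (G' (?y t) (h *\<^sub>R ?w)))) (at t)" by (simp add: o_def)
      moreover have "Dr \<Phi> ?x (G' (?y t) (h *\<^sub>R ?w)) = 0" for h
      proof (rule Pinj[OF xU])
        have "D ?x (G' (?y t) (h *\<^sub>R ?w)) = h *\<^sub>R ?w"
          unfolding G'[OF yV[OF t]] f'[OF xV]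
          using bij[OF yV[OF t]] unfolding f'[OF xV] by (simp add: bij_is_surj surj_f_inv_f)
        then show "P (Dr \<Phi> ?x (G' (?y t) (h *\<^sub>R ?w))) = 0"
          unfolding LD[OF xV, symmetric] by (simp add: linear_scale[OF L0] L0w)
      qed
      ultimately show ?thesis by simp
    qed
    have "\<Phi> (G (?y 0)) = \<Phi> (G (?y 1))"
      by (rule has_derivative_zero_unique[of "{0..1}" "\<lambda>t. \<Phi> (G (?y t))"])
        (auto intro: has_derivative_at_withinI[OF d])
    then show "\<Phi> s = \<Phi> s'" using s by (simp add: h N_def)
  qed
qed

text \<open>A Baire argument for finitely many closed sets, relative to \<open>L\<close>: they are
  removed one at a time, and each leaves a nonempty relatively open piece.\<close>

lemma finite_union_nowhere_dense:
  assumes "finite I" "\<And>i. i \<in> I \<Longrightarrow> closed (C i)"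
    and nd: "\<And>i G. i \<in> I \<Longrightarrow> open G \<Longrightarrow> L \<inter> G \<noteq> {} \<Longrightarrow> \<not> L \<inter> G \<subseteq> C i"
    and G: "open G" "L \<inter> G \<noteq> {}"
  shows "\<exists>G'. open G' \<and> L \<inter> G' \<noteq> {} \<and> G' \<inter> (\<Union>i\<in>I. C i) = {}"
  using assms(1-3)
proof (induction I rule: finite_induct)
  case empty
  then show ?case using G by auto
next
  case (insert i I)
  then obtain G' where G': "open G'" "L \<inter> G' \<noteq> {}" "G' \<inter> (\<Union>i\<in>I. C i) = {}"
    by (metis insertCI)
  have "\<not> L \<inter> G' \<subseteq> C i" using insert.prems(2)[of i] G' by blast
  moreover have "open (G' - C i)" using G'(1) insert.prems(1)[of i] by (intro open_Diff) auto
  ultimately show ?case using G'(3) by (intro exI[of _ "G' - C i"]) auto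
qed


section \<open>Tangent spaces of orbits\<close>

text \<open>Charts adapted to a submanifold are compatible with the atlas but may lie outside it, so
  transitions are treated here for any two compatible charts.\<close>

lemma transition_inverse:
  assumes ch: "is_chart c" "is_chart d" and sm: "smooth_transition c d" "smooth_transition d c"
    and p: "p \<in> cdom c" "p \<in> cdom d"
  shows "(\<lambda>x. cmap d (cinv c x)) differentiable (at (cmap c p))"
    and "Dr (\<lambda>x. cmap d (cinv c x)) (cmap c p) (Dr (\<lambda>x. cmap c (cinv d x)) (cmap d p) u) = u"
proof -
  have dcd: "(\<lambda>x. cmap d (cinv c x)) differentiable (at (cmap c p))" 
    if "smooth_transition c d" "p \<in> cdom c" "p \<in> cdom d" for c d :: "('a, 'b) chart"
    using that by (intro smooth_on_differentiable[of "cmap c ` (cdom c \<inter> cdom d)"]) (auto simp: smooth_transition_def o_def)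
  show 1: "(\<lambda>x. cmap d (cinv c x)) differentiable (at (cmap c p))" by (rule dcd[OF sm(1) p])
  have op: "open (cmap d ` (cdom d \<inter> cdom c))" by (rule chart_image_open[OF ch(2) chart_open(1)[OF ch(1)]])
  have "Dr (\<lambda>x. cmap d (cinv c (cmap c (cinv d x)))) (cmap d p) u = u"
    using p by (intro Dr_identity[OF op]) (auto simp: chart_inverse[OF ch(1)] chart_inverse[OF ch(2)])
  then show "Dr (\<lambda>x. cmap d (cinv c x)) (cmap c p) (Dr (\<lambda>x. cmap c (cinv d x)) (cmap d p) u) = u"
    using Dr_compose[OF dcd[OF sm(2) p(2,1)], of "\<lambda>x. cmap d (cinv c x)"] 1 p
    by (simp add: chart_inverse[OF ch(2)])
qed

text \<open>The derivative is orthogonal to everything that is orthogonal to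
  \<open>S\<close>.\<close>

lemma Dr_in_subspace:
  fixes \<eta> :: "real \<Rightarrow> 'e::euclidean_space"
  assumes "subspace S" "\<eta> differentiable (at 0)" "eventually (\<lambda>t. \<eta> t \<in> S) (nhds 0)"
  shows "Dr \<eta> 0 1 \<in> S"
proof -
  have "Dr \<eta> 0 1 \<bullet> w = 0" if w: "w \<in> S\<^sup>\<bottom>" for w
  proof -
    have "((\<lambda>t. \<eta> t \<bullet> w) has_derivative (\<lambda>h. Dr \<eta> 0 h \<bullet> w)) (at 0)"
      by (rule bounded_linear.has_derivative[OF bounded_linear_inner_left Dr_works[OF assms(2)]])
    moreover have "((\<lambda>t. \<eta> t \<bullet> w) has_derivative (\<lambda>h. 0)) (at 0)"
      by (rule has_derivative_cong_ev[OF has_derivative_const[of 0]])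
        (use assms(3) w in \<open>auto elim!: eventually_mono simp: orthogonal_comp_def orthogonal_def inner_commute\<close>)
    ultimately show ?thesis using has_derivative_unique by metis
  qed
  then have "Dr \<eta> 0 1 \<in> S\<^sup>\<bottom>\<^sup>\<bottom>" by (auto simp: orthogonal_comp_def orthogonal_def inner_commute)
  then show ?thesis using orthogonal_comp_self[OF assms(1)] by simp
qed

lemma tangent_vectorE:
  assumes A: "smooth_atlas A" and v: "v \<in> tangent_space_of A L q"
  obtains \<gamma> :: "real \<Rightarrow> 'm::topological_space" where "isCont \<gamma> 0" "\<gamma> 0 = q" "eventually (\<lambda>t. \<gamma> t \<in> L) (nhds 0)"
    "(\<lambda>t. cmap (chart_at A q) (\<gamma> t)) differentiable (at 0)"
    "Dr (\<lambda>t. cmap (chart_at A q) (\<gamma> t)) 0 1 = v"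
proof -
  obtain \<gamma> and \<epsilon> :: real where \<epsilon>: "\<epsilon> > 0" and \<gamma>: "smooth_map_on vector_atlas A {-\<epsilon><..<\<epsilon>} \<gamma>"
    and \<gamma>L: "\<And>t. t \<in> {-\<epsilon><..<\<epsilon>} \<Longrightarrow> \<gamma> t \<in> L" and \<gamma>0: "\<gamma> 0 = q" and D: "v = mderiv vector_atlas A \<gamma> 0 1"
    using v unfolding tangent_space_of_def by blast
  show thesis
  proof (rule that[of \<gamma>])
    have "continuous_on {-\<epsilon><..<\<epsilon>} \<gamma>" using \<gamma> by (simp add: smooth_map_on_def)
    then show "isCont \<gamma> 0" using \<epsilon> by (simp add: continuous_on_eq_continuous_at)
    have "eventually (\<lambda>t::real. t \<in> {-\<epsilon><..<\<epsilon>}) (nhds 0)"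
      by (rule eventually_nhds_in_open) (use \<epsilon> in auto)
    then show "eventually (\<lambda>t. \<gamma> t \<in> L) (nhds 0)" by eventually_elim (rule \<gamma>L)
    show "(\<lambda>t. cmap (chart_at A q) (\<gamma> t)) differentiable (at 0)"
      using rep_differentiable[OF \<gamma>, of "(UNIV, \<lambda>x. x)" "chart_at A q" 0] chart_at_in[OF A, of q] \<epsilon>
      by (simp add: vector_atlas_def vector_chart \<gamma>0)
    show "Dr (\<lambda>t. cmap (chart_at A q) (\<gamma> t)) 0 1 = v"
      by (simp add: D mderiv_def chart_at_vector vector_chart o_def \<gamma>0)
  qed (rule \<gamma>0)
qed

text \<open>A curve in a submanifold, seen in an adapted chart \<open>c\<close>, runs in the subspace \<open>S\<close>.\<close>

lemma tangent_space_subset: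
  assumes A: "smooth_atlas A" and c: "compatible_chart A c" and q: "q \<in> cdom c" and S: "subspace S"
    and cL: "cmap c ` (cdom c \<inter> L) = cim c \<inter> S"
  shows "tangent_space_of A L q \<subseteq>
    Dr (\<lambda>x. cmap (chart_at A q) (cinv c x)) (cmap c q) ` S"
proof
  fix v assume "v \<in> tangent_space_of A L q"
  then obtain \<gamma> :: "real \<Rightarrow> _" where cont: "isCont \<gamma> 0" and \<gamma>0: "\<gamma> 0 = q" and ev3: "eventually (\<lambda>t. \<gamma> t \<in> L) (nhds 0)"
    and dd: "(\<lambda>t. cmap (chart_at A q) (\<gamma> t)) differentiable (at 0)"
    and v: "Dr (\<lambda>t. cmap (chart_at A q) (\<gamma> t)) 0 1 = v"
    by (rule tangent_vectorE[OF A])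
  let ?d = "chart_at A q"
  note d = chart_at_in[OF A, of q]
  note isd = atlas_chart[OF A d(1)]
  have isc: "is_chart c" and tr: "smooth_transition c ?d" "smooth_transition ?d c"
    using c d by (auto simp: compatible_chart_def)
  have ev1: "eventually (\<lambda>t. \<gamma> t \<in> cdom c) (nhds 0)"
    by (rule eventually_in_open[OF cont chart_open(1)[OF isc]]) (simp add: \<gamma>0 q)
  have ev2: "eventually (\<lambda>t. \<gamma> t \<in> cdom ?d) (nhds 0)"
    by (rule eventually_in_open[OF cont chart_open(1)[OF isd]]) (simp add: \<gamma>0 d)
  let ?\<eta> = "\<lambda>t. cmap c (cinv ?d (cmap ?d (\<gamma> t)))"
  have \<eta>d: "?\<eta> differentiable (at 0)"
    using differentiable_chain_at[OF dd, of "\<lambda>x. cmap c (cinv ?d x)"] transition_inverse(1)[OF isd isc tr(2,1) d(2) q]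
    by (simp add: o_def \<gamma>0)
  have "eventually (\<lambda>t. ?\<eta> t \<in> S) (nhds 0)"
    using ev1 ev2 ev3
  proof eventually_elim
    case (elim t)
    then have "?\<eta> t = cmap c (\<gamma> t)" by (simp add: chart_inverse[OF isd])
    then show ?case using cL elim by blast
  qed
  then have \<eta>S: "Dr ?\<eta> 0 1 \<in> S" by (rule Dr_in_subspace[OF S \<eta>d])
  have \<eta>0: "?\<eta> 0 = cmap c q" using d by (simp add: \<gamma>0 chart_inverse[OF isd])
  have "Dr (\<lambda>t. cmap ?d (\<gamma> t)) 0 = Dr (\<lambda>t. cmap ?d (cinv c (?\<eta> t))) 0"
  proof (rule Dr_cong_ev)
    show "eventually (\<lambda>t. cmap ?d (\<gamma> t) = cmap ?d (cinv c (?\<eta> t))) (nhds 0)"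
      using ev1 ev2 by eventually_elim (simp add: chart_inverse[OF isd] chart_inverse[OF isc])
  qed
  also have "\<dots> = (\<lambda>h. Dr (\<lambda>x. cmap ?d (cinv c x)) (cmap c q) (Dr ?\<eta> 0 h))"
    using Dr_compose[OF \<eta>d, of "\<lambda>x. cmap ?d (cinv c x)"] transition_inverse(1)[OF isc isd tr q d(2)]
    by (simp add: \<eta>0)
  finally show "v \<in> Dr (\<lambda>x. cmap ?d (cinv c x)) (cmap c q) ` S"
    using \<eta>S v by auto
qed

context kaehler_action
begin

lemma orbit_refl: "q \<in> orbit act q"
  unfolding orbit_def using act_e by (metis rangeI)

lemma orbit_act: "q \<in> orbit act p \<Longrightarrow> act a q \<in> orbit act p"
  unfolding orbit_def by (auto simp: act_mul[symmetric])

lemma orbit_eq: "q \<in> orbit act p \<Longrightarrow> orbit act q = orbit act p"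
proof -
  assume "q \<in> orbit act p"
  then obtain a where a: "q = act a p" by (auto simp: orbit_def)
  have p: "p = act (iv a) q" by (simp add: a act_iv)
  show ?thesis
    unfolding orbit_def by (auto simp: a act_mul[symmetric]) (metis a act_mul p rangeI)
qed

text \<open>The witness moves \<open>q\<close> by group elements on a line that is straight in the
  chart \<open>b\<close>; at time 0 this has the velocity that a one-parameter group would
  give.\<close>

lemma fund_tangent: "fund X q \<in> tangent_space_of A (orbit act q) q"
proof -
  let ?l = "\<lambda>t::real. s0 + t *\<^sub>R X"
  let ?\<gamma> = "\<lambda>t. act (cinv b (?l t)) q"
  have lc: "continuous_on UNIV ?l" by (intro continuous_intros)
  have "open (?l -` cim b)" by (rule open_vimage[OF open_b lc])
  moreover have "0 \<in> ?l -` cim b" using s0(2) by simp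
  ultimately obtain \<epsilon> where \<epsilon>: "\<epsilon> > 0" "ball 0 \<epsilon> \<subseteq> ?l -` cim b" using openE by blast
  have I: "{-\<epsilon><..<\<epsilon>} = ball 0 \<epsilon>" by (auto simp: ball_def dist_real_def)
  have contq: "continuous_on UNIV (\<lambda>a. act a q)" by (rule smooth_map_continuous[OF act_smooth2])
  have cont: "continuous_on {-\<epsilon><..<\<epsilon>} ?\<gamma>"
  proof (rule continuous_on_compose2[OF contq])
    show "continuous_on {-\<epsilon><..<\<epsilon>} (\<lambda>t. cinv b (?l t))"
      using \<epsilon>(2) unfolding I
      by (intro continuous_on_compose2[OF chart_continuous(2)[OF is_chart_b]] continuous_on_subset[OF lc]) auto
  qed simp
  have rep: "smooth_on ({-\<epsilon><..<\<epsilon>} \<inter> ?\<gamma> -` cdom d) (\<lambda>t. cmap d (?\<gamma> t))" if d: "d \<in> A" for d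
  proof -
    note isd = atlas_chart[OF atlas_A d]
    let ?h = "\<lambda>s. cmap d (act (cinv b s) q)"
    let ?T = "cmap b ` (cdom b \<inter> UNIV \<inter> (\<lambda>a. act a q) -` cdom d)"
    have T: "open ?T" by (rule rep_open[OF act_smooth2 open_UNIV is_chart_b isd])
    have hT: "smooth_on ?T ?h" by (rule rep_smooth[OF act_smooth2 b(1) d])
    have O: "open ({-\<epsilon><..<\<epsilon>} \<inter> ?\<gamma> -` cdom d)"
      by (rule continuous_open_preimage[OF cont open_greaterThanLessThan chart_open(1)[OF isd]])
    have bl: "bounded_linear (\<lambda>t::real. t *\<^sub>R X)" by (rule bounded_linear_scaleR_left)
    have sl: "smooth_on ({-\<epsilon><..<\<epsilon>} \<inter> ?\<gamma> -` cdom d) ?l"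
      by (rule smooth_on_add[OF O smooth_on_const smooth_on_bounded_linear[OF bl]])
    show ?thesis
    proof (rule smooth_on_compose[OF O T sl hT])
      fix t assume t: "t \<in> {-\<epsilon><..<\<epsilon>} \<inter> ?\<gamma> -` cdom d"
      then have lt: "?l t \<in> cim b" using \<epsilon>(2) unfolding I by blast
      then have "?l t = cmap b (cinv b (?l t))" "cinv b (?l t) \<in> cdom b"
        using chart_inverse[OF is_chart_b] by auto
      then show "?l t \<in> ?T" using t by (intro image_eqI[of _ _ "cinv b (?l t)"]) auto
    qed
  qed
  have sm: "smooth_map_on vector_atlas A {-\<epsilon><..<\<epsilon>} ?\<gamma>"
    using cont rep by (simp add: smooth_map_on_def vector_atlas_def vector_chart o_def)
  have D: "mderiv vector_atlas A ?\<gamma> 0 1 = fund X q"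
  proof -
    let ?d = "chart_at A q"
    let ?h = "\<lambda>s. cmap ?d (act (cinv b s) q)"
    have hd: "?h differentiable (at s0)"
      using mderiv_differentiable[OF atlas atlas_A act_smooth2[of q], where p = e]
      by (simp add: act_e b_def[symmetric] s0_def[symmetric])
    have "(?l has_derivative (\<lambda>h. h *\<^sub>R X)) (at 0)" by (auto intro!: derivative_eq_intros)
    from diff_chain_at[OF this, of ?h "Dr ?h s0"] Dr_works[OF hd]
    have "((\<lambda>t. ?h (?l t)) has_derivative (\<lambda>h. Dr ?h s0 (h *\<^sub>R X))) (at 0)" by (simp add: o_def)
    then have "Dr (\<lambda>t. ?h (?l t)) 0 1 = Dr ?h s0 X" by (simp add: Dr_eq)
    then show ?thesis
      by (simp add: mderiv_def fund_mderiv chart_at_vector vector_chart o_def s0 act_e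
          b_def[symmetric] s0_def[symmetric])
  qed
  show ?thesis
    unfolding tangent_space_of_def
  proof (rule CollectI, intro exI conjI)
    show "\<epsilon> > 0" by (rule \<epsilon>(1))
    show "smooth_map_on vector_atlas A {-\<epsilon><..<\<epsilon>} ?\<gamma>" by (rule sm)
    show "\<forall>t\<in>{-\<epsilon><..<\<epsilon>}. ?\<gamma> t \<in> orbit act q" by (simp add: orbit_def)
    show "?\<gamma> 0 = q" by (simp add: s0 act_e)
    show "fund X q = mderiv vector_atlas A ?\<gamma> 0 1" by (rule D[symmetric])
  qed
qed

text \<open>By h q = a ((a^-1 h) q), the differential of the orbit map at \<open>a\<close> factors
  through the one at the unit; its rank is nowhere larger.\<close>

lemma orbit_map_derivative:
  "mderiv B A (\<lambda>h. act h q) a W = mderiv A A (act a) q (fund (mderiv B B (mul (iv a)) a W) q)"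
proof -
  have "(\<lambda>h. act h q) = (\<lambda>h. act a (act (mul (iv a) h) q))"
    by (simp add: fun_eq_iff act_mul act_iv)
  then have "mderiv B A (\<lambda>h. act h q) a W = mderiv B A (\<lambda>h. act a (act (mul (iv a) h) q)) a W" by simp
  also have "\<dots> = mderiv A A (act a) (act (mul (iv a) a) q) (mderiv B A (\<lambda>h. act (mul (iv a) h) q) a W)"
    by (rule mderiv_compose[OF atlas atlas_A atlas_A smooth_map_compose[OF atlas atlas atlas_A mul_left_smooth act_smooth2] act_smooth1])
  also have "mderiv B A (\<lambda>h. act (mul (iv a) h) q) a W = mderiv B A (\<lambda>h. act h q) (mul (iv a) a) (mderiv B B (mul (iv a)) a W)"
    by (rule mderiv_compose[OF atlas atlas atlas_A mul_left_smooth act_smooth2])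
  finally show ?thesis by (simp add: mul_iv act_e fund_mderiv)
qed

lemma orbit_map_adapted:
  assumes c: "compatible_chart A c" and a: "a \<in> cdom b" "act a q \<in> cdom c"
  shows "((\<lambda>s. cmap c (act (cinv b s) q)) has_derivative
    (\<lambda>u. Dr (\<lambda>x. cmap c (cinv (chart_at A (act a q)) x)) (cmap (chart_at A (act a q)) (act a q))
      (mderiv B A (\<lambda>h. act h q) a (chart_vec B b (cmap b a) u)))) (at (cmap b a))"
proof -
  let ?d = "chart_at A (act a q)"
  note d = chart_at_in[OF atlas_A, of "act a q"]
  note isd = atlas_chart[OF atlas_A d(1)]
  have isc: "is_chart c" and tr: "smooth_transition c ?d" "smooth_transition ?d c"
    using c d by (auto simp: compatible_chart_def)
  let ?h = "\<lambda>s. cmap ?d (act (cinv b s) q)"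
  have hd: "?h differentiable (at (cmap b a))"
    by (rule rep_differentiable[OF act_smooth2 b(1) d(1) a(1) UNIV_I d(2)])
  have m: "mderiv B A (\<lambda>h. act h q) a (chart_vec B b (cmap b a) u) = Dr ?h (cmap b a) u" for u
    using coord_mderiv_eq[OF atlas b(1) a(1) atlas_A d(1) d(2) act_smooth2 open_UNIV UNIV_I, of "chart_vec B b (cmap b a) u"]
      coord_inverse(1)[OF atlas b(1) a(1), of u] coord_chart_at[OF atlas_A, of "act a q"] by simp
  have D: "((\<lambda>s. cmap c (cinv ?d (?h s))) has_derivative
     (\<lambda>u. Dr (\<lambda>x. cmap c (cinv ?d x)) (cmap ?d (act a q)) (Dr ?h (cmap b a) u))) (at (cmap b a))"
    using diff_chain_at[OF Dr_works[OF hd], of "\<lambda>x. cmap c (cinv ?d x)"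
        "Dr (\<lambda>x. cmap c (cinv ?d x)) (cmap ?d (act a q))"]
      Dr_works[OF transition_inverse(1)[OF isd isc tr(2,1) d(2) a(2)]] a(1)
    by (simp add: o_def chart_inverse[OF is_chart_b])
  have op: "open (cmap b ` (cdom b \<inter> UNIV \<inter> (\<lambda>h. act h q) -` cdom ?d))"
    by (rule rep_open[OF act_smooth2 open_UNIV is_chart_b isd])
  show ?thesis unfolding m
    by (rule has_derivative_cong_openI[OF D op])
      (use a d in \<open>auto simp: chart_inverse[OF is_chart_b] chart_inverse[OF isd]\<close>)
qed

text \<open>With rank below \<open>k\<close>, the image \<open>C\<close> of a small ball is a graph
  over fewer than \<open>k\<close> dimensions and has no interior in the
  \<open>k\<close>-dimensional slice. Finitely many translates of \<open>C\<close> cover the orbit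
  of a compact group, against the finite Baire argument.\<close>

lemma fund_dim_ge:
  assumes comp: "compact (UNIV :: 'k set)"
    and emb: "embedded_submanifold A k (orbit act q)"
  shows "k \<le> dim (range (\<lambda>X. fund X q))"
proof (rule ccontr)
  let ?L = "orbit act q" and ?W = "range (\<lambda>X. fund X q)"
  assume "\<not> k \<le> dim ?W"
  then have less: "dim ?W < k" by simp
  obtain c S where c: "compatible_chart A c" "q \<in> cdom c" and S: "subspace S" "dim S = k"
    and cL: "cmap c ` (cdom c \<inter> ?L) = cim c \<inter> S"
    using emb orbit_refl unfolding embedded_submanifold_def by metis
  let ?d = "chart_at A q"
  note d = chart_at_in[OF atlas_A, of q]
  note isd = atlas_chart[OF atlas_A d(1)]
  have isc: "is_chart c" and tr: "smooth_transition c ?d" "smooth_transition ?d c"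
    using c d by (auto simp: compatible_chart_def)
  let ?\<Phi> = "\<lambda>s. cmap c (act (cinv b s) q)"
  define V0 where "V0 = cmap b ` (cdom b \<inter> (\<lambda>a. act a q) -` (cdom c \<inter> cdom ?d))"
  have contq: "continuous_on UNIV (\<lambda>a. act a q)" by (rule smooth_map_continuous[OF act_smooth2])
  have "open ((\<lambda>a. act a q) -` (cdom c \<inter> cdom ?d))"
    by (rule open_vimage[OF open_Int[OF chart_open(1)[OF isc] chart_open(1)[OF isd]] contq])
  then have V0o: "open V0" unfolding V0_def by (rule chart_image_open[OF is_chart_b])
  have V0s: "s0 \<in> V0" unfolding V0_def s0_def using b(2) c(2) d(2) by (auto simp: act_e)
  have \<Phi>s: "smooth_on V0 ?\<Phi>"
  proof -
    have 1: "smooth_on V0 (\<lambda>s. cmap ?d (act (cinv b s) q))"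
      by (rule smooth_on_subset[OF rep_smooth[OF act_smooth2 b(1) d(1)]]) (auto simp: V0_def)
    have 2: "smooth_on (cmap ?d ` (cdom ?d \<inter> cdom c)) (\<lambda>x. cmap c (cinv ?d x))"
      using tr(2) by (simp add: smooth_transition_def o_def)
    have "smooth_on V0 (\<lambda>s. cmap c (cinv ?d (cmap ?d (act (cinv b s) q))))"
      by (rule smooth_on_compose[OF V0o chart_image_open[OF isd chart_open(1)[OF isc]] 1 2])
        (auto simp: V0_def chart_inverse[OF is_chart_b])
    then show ?thesis
      by (rule smooth_on_cong[OF V0o, THEN iffD1, rotated])
        (auto simp: V0_def chart_inverse[OF is_chart_b] chart_inverse[OF isd])
  qed
  let ?\<tau> = "Dr (\<lambda>x. cmap c (cinv ?d x)) (cmap ?d q)" and ?\<sigma> = "Dr (\<lambda>x. cmap ?d (cinv c x)) (cmap c q)"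
  have \<sigma>\<tau>: "?\<sigma> (?\<tau> u) = u" for u by (rule transition_inverse(2)[OF isc isd tr c(2) d(2)])
  have lin\<tau>: "linear ?\<tau>" and lin\<sigma>: "linear ?\<sigma>"
    by (rule linear_Dr[OF transition_inverse(1)[OF isd isc tr(2,1) d(2) c(2)]]
        linear_Dr[OF transition_inverse(1)[OF isc isd tr c(2) d(2)]])+
  have D0: "Dr ?\<Phi> s0 = (\<lambda>u. ?\<tau> (fund u q))"
  proof -
    have "chart_vec B b s0 u = u" for u unfolding b_def s0_def by (rule chart_vec_chart_at[OF atlas])
    then show ?thesis
      using Dr_eq[OF orbit_map_adapted[OF c(1) b(2), of q]] c(2)
      by (simp add: act_e s0_def[symmetric] fund_mderiv)
  qed
  have r1: "dim (range (Dr ?\<Phi> s0)) \<le> dim ?W"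
  proof -
    have "range (Dr ?\<Phi> s0) = ?\<tau> ` ?W" unfolding D0 by auto
    then show ?thesis using dim_image_le[OF lin\<tau>] by simp
  qed
  have r2: "dim ?W \<le> dim (range (Dr ?\<Phi> s0))"
  proof -
    have "?W = ?\<sigma> ` range (Dr ?\<Phi> s0)" unfolding D0 by (auto simp: \<sigma>\<tau> image_image)
    then show ?thesis using dim_image_le[OF lin\<sigma>] by metis
  qed
  have rank: "dim (range (Dr ?\<Phi> s)) \<le> dim (range (Dr ?\<Phi> s0))" if "s \<in> V0" for s
  proof -
    obtain a where a: "a \<in> cdom b" "act a q \<in> cdom c" "s = cmap b a"
      using \<open>s \<in> V0\<close> unfolding V0_def by auto
    let ?d' = "chart_at A (act a q)"
    note d' = chart_at_in[OF atlas_A, of "act a q"]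
    note isd' = atlas_chart[OF atlas_A d'(1)]
    have tr': "smooth_transition c ?d'" "smooth_transition ?d' c" using c d' by (auto simp: compatible_chart_def)
    let ?\<tau>' = "Dr (\<lambda>x. cmap c (cinv ?d' x)) (cmap ?d' (act a q))"
    have l1: "linear ?\<tau>'"
      by (rule linear_Dr[OF transition_inverse(1)[OF isd' isc tr'(2,1) d'(2) a(2)]])
    have l2: "linear (mderiv A A (act a) q)" by (rule mderiv_linear[OF atlas_A atlas_A act_smooth1])
    have "range (Dr ?\<Phi> s) \<subseteq> (\<lambda>w. ?\<tau>' (mderiv A A (act a) q w)) ` ?W"
      unfolding a(3) Dr_eq[OF orbit_map_adapted[OF c(1) a(1,2)]] orbit_map_derivative by auto
    then have "dim (range (Dr ?\<Phi> s)) \<le> dim ((\<lambda>w. ?\<tau>' (mderiv A A (act a) q w)) ` ?W)" by (rule dim_subset)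
    also have "\<dots> \<le> dim ?W" using dim_image_le[OF linear_compose[OF l2 l1]] by (simp add: o_def)
    finally show ?thesis using r2 by simp
  qed
  obtain N and P :: "complex ^ 'n \<Rightarrow> complex ^ 'n" where N: "open N" "s0 \<in> N" "N \<subseteq> V0"
    and P: "linear P" "dim (range P) \<le> dim (range (Dr ?\<Phi> s0))"
    and graph: "\<And>s s'. s \<in> N \<Longrightarrow> s' \<in> N \<Longrightarrow> P (?\<Phi> s) = P (?\<Phi> s') \<Longrightarrow> ?\<Phi> s = ?\<Phi> s'"
    using constant_rank_graph[OF V0o V0s \<Phi>s rank] by metis
  obtain \<rho> where \<rho>: "\<rho> > 0" "cball s0 \<rho> \<subseteq> N" using N open_contains_cball by blast
  have Nb: "N \<subseteq> cim b" using N(3) by (auto simp: V0_def)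
  define C where "C = (\<lambda>s. act (cinv b s) q) ` cball s0 \<rho>"
  have Ccomp: "compact C" unfolding C_def
  proof (rule compact_continuous_image[OF _ compact_cball])
    show "continuous_on (cball s0 \<rho>) (\<lambda>s. act (cinv b s) q)"
      using \<rho>(2) Nb by (intro continuous_on_compose2[OF contq] continuous_on_subset[OF chart_continuous(2)[OF is_chart_b]]) auto
  qed
  \<comment> \<open>The dimension \<open>k\<close> of \<open>S\<close> exceeds that of the range of
    \<open>P\<close>, so \<open>P\<close> kills a direction of \<open>S\<close>.\<close>
  obtain z where z: "z \<in> S" "P z = 0" "z \<noteq> 0"
  proof (rule ccontr)
    assume "\<not> thesis"
    then have "inj_on P S" using linear_injective_on_subspace_0[OF P(1) S(1)] that by blast
    moreover have "span S = S" using S(1) by (rule span_eq_iff[THEN iffD2])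
    ultimately have "inj_on P (span S)" by (simp only:)
    then have "dim (P ` S) = dim S" by (rule dim_image_eq[OF P(1)])
    moreover have "dim (P ` S) \<le> dim (range P)" by (rule dim_subset) auto
    ultimately show False using P(2) r1 less S(2) by simp
  qed
  \<comment> \<open>Translation by the inverse of \<open>a\<close> reduces this to \<open>C\<close>
    itself. There a small step from \<open>y0\<close> along \<open>z\<close> stays in the image of
    the orbit and keeps the value of \<open>P\<close>, which contradicts
    \<open>graph\<close>.\<close>
  have nd: "\<not> ?L \<inter> G \<subseteq> act a ` C" if G: "open G" "?L \<inter> G \<noteq> {}" for a G
  proof
    assume sub: "?L \<inter> G \<subseteq> act a ` C"
    let ?G' = "act a -` G"
    have G'o: "open ?G'" by (rule open_vimage[OF G(1) smooth_map_continuous[OF act_smooth1]])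
    have LG: "?L \<inter> ?G' \<subseteq> C"
    proof
      fix x assume x: "x \<in> ?L \<inter> ?G'"
      then have "act a x \<in> ?L \<inter> G" using orbit_act by auto
      then obtain y where "y \<in> C" "act a x = act a y" using sub by blast
      then show "x \<in> C" by (metis act_iv(1))
    qed
    obtain x1 where x1: "x1 \<in> ?L" "x1 \<in> G" using G(2) by blast
    let ?x0 = "act (iv a) x1"
    have x0: "?x0 \<in> ?L" "?x0 \<in> ?G'" using x1 orbit_act by (auto simp: act_iv)
    have CN: "x \<in> C \<Longrightarrow> \<exists>s\<in>N. cmap c x = ?\<Phi> s \<and> x \<in> cdom c" for x
    proof -
      assume "x \<in> C"
      then obtain s where s: "s \<in> N" "x = act (cinv b s) q" using \<rho>(2) by (auto simp: C_def)
      moreover have "act (cinv b s) q \<in> cdom c"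
        using s(1) N(3) by (auto simp: V0_def chart_inverse[OF is_chart_b])
      ultimately show ?thesis by blast
    qed
    have x0c: "?x0 \<in> cdom c" using CN LG x0 by blast
    let ?O = "cmap c ` (cdom c \<inter> ?G')"
    have Oo: "open ?O" by (rule chart_image_open[OF isc G'o])
    have ON: "\<exists>s\<in>N. y = ?\<Phi> s" if y: "y \<in> ?O" "y \<in> S" for y
    proof -
      obtain x where x: "x \<in> cdom c" "x \<in> ?G'" "y = cmap c x" using y(1) by auto
      then have "y \<in> cmap c ` (cdom c \<inter> ?L)" unfolding cL using y by auto
      then have "x \<in> ?L" using x inj_onD[OF chart_inj[OF isc]] by auto
      then show ?thesis using CN LG x by blast
    qed
    let ?y0 = "cmap c ?x0"
    have y0: "?y0 \<in> ?O" "?y0 \<in> S" using x0 x0c cL by blast+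
    then obtain r where r: "r > 0" "ball ?y0 r \<subseteq> ?O" using Oo openE by blast
    let ?y1 = "?y0 + (r / (2 * norm z)) *\<^sub>R z"
    have "dist ?y0 ?y1 = r / 2" using z(3) r(1) by (simp add: dist_norm)
    then have y1: "?y1 \<in> ?O" using r by (auto simp: subset_iff)
    have y1S: "?y1 \<in> S" using y0 z(1) S(1) by (intro subspace_add subspace_scale)
    obtain s s' where s: "s \<in> N" "?y0 = ?\<Phi> s" "s' \<in> N" "?y1 = ?\<Phi> s'"
      using ON[OF y0] ON[OF y1 y1S] by blast
    have "P ?y1 = P ?y0" by (simp add: linear_add[OF P(1)] linear_scale[OF P(1)] z(2))
    then have "?y1 = ?y0" using graph[OF s(3,1)] s(2,4) by simp
    then show False using z(3) r(1) by simp
  qed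
  define Q where "Q = cdom b \<inter> cmap b -` ball s0 \<rho>"
  have Qo: "open Q" unfolding Q_def
    by (rule continuous_open_preimage[OF chart_continuous(1)[OF is_chart_b] chart_open(1)[OF is_chart_b] open_ball])
  have eQ: "e \<in> Q" unfolding Q_def using b(2) \<rho>(1) by (simp add: s0_def)
  have To: "open (mul (iv a) -` Q)" for a
    by (rule open_vimage[OF Qo smooth_map_continuous[OF mul_left_smooth]])
  \<comment> \<open>The sets are the left translates of the neighbourhood \<open>Q\<close> of the
    unit.\<close>
  have "UNIV \<subseteq> (\<Union>a\<in>UNIV. mul (iv a) -` Q)" using eQ by (auto simp: mul_iv intro: exI)
  then obtain I where I: "finite I" "UNIV \<subseteq> (\<Union>a\<in>I. mul (iv a) -` Q)"
    using compactE_image[OF comp, where C = UNIV and f = "\<lambda>a. mul (iv a) -` Q"] To by metis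
  have cover: "?L \<subseteq> (\<Union>a\<in>I. act a ` C)"
  proof
    fix x assume "x \<in> ?L"
    then obtain h where h: "x = act h q" by (auto simp: orbit_def)
    obtain a where a: "a \<in> I" "mul (iv a) h \<in> Q" using I(2) by blast
    let ?h = "mul (iv a) h"
    have "act ?h q \<in> C" unfolding C_def
      using a(2) by (intro image_eqI[of _ _ "cmap b ?h"]) (auto simp: Q_def chart_inverse[OF is_chart_b])
    moreover have "x = act a (act ?h q)" by (simp add: h act_mul act_iv)
    ultimately show "x \<in> (\<Union>a\<in>I. act a ` C)" using a(1) by blast
  qed
  have cl: "closed (act a ` C)" for a
    by (intro compact_imp_closed compact_continuous_image[OF _ Ccomp]
        continuous_on_subset[OF smooth_map_continuous[OF act_smooth1]]) auto
  have "?L \<inter> UNIV \<noteq> {}" using orbit_refl by auto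
  then obtain G' where "open G'" "?L \<inter> G' \<noteq> {}" "G' \<inter> (\<Union>a\<in>I. act a ` C) = {}"
    using finite_union_nowhere_dense[where I = I and C = "\<lambda>a. act a ` C" and L = ?L and G = UNIV, OF I(1) cl nd open_UNIV]
    by blast
  then show False using cover by blast
qed

text \<open>The tangent space lies between the space of fundamental vectors, of dimension at least
  \<open>k\<close>, and a linear image of \<open>S\<close>, of dimension at most
  \<open>k\<close>.\<close>

lemma orbit_tangent_space:
  assumes comp: "compact (UNIV :: 'k set)" and emb: "embedded_submanifold A k (orbit act q)"
  shows "tangent_space_of A (orbit act q) q = range (\<lambda>X. fund X q)" "dim (range (\<lambda>X. fund X q)) = k"
proof -
  let ?L = "orbit act q" and ?W = "range (\<lambda>X. fund X q)"
  obtain c S where c: "compatible_chart A c" "q \<in> cdom c" and S: "subspace S" "dim S = k"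
    and cL: "cmap c ` (cdom c \<inter> ?L) = cim c \<inter> S"
    using emb orbit_refl unfolding embedded_submanifold_def by metis
  let ?d = "chart_at A q"
  note d = chart_at_in[OF atlas_A, of q]
  note isd = atlas_chart[OF atlas_A d(1)]
  have isc: "is_chart c" and tr: "smooth_transition c ?d" "smooth_transition ?d c"
    using c d by (auto simp: compatible_chart_def)
  let ?\<sigma> = "Dr (\<lambda>x. cmap ?d (cinv c x)) (cmap c q)"
  have lin\<sigma>: "linear ?\<sigma>" by (rule linear_Dr[OF transition_inverse(1)[OF isc isd tr c(2) d(2)]])
  have sub: "?W \<subseteq> tangent_space_of A ?L q" using fund_tangent by blast
  have sub2: "tangent_space_of A ?L q \<subseteq> ?\<sigma> ` S"
    by (rule tangent_space_subset[OF atlas_A c S(1) cL])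
  have "?W = ?\<sigma> ` S"
  proof (rule subspace_dim_equal)
    show "subspace ?W" by (rule linear_subspace_image[OF fund_linear subspace_UNIV])
    show "subspace (?\<sigma> ` S)" by (rule linear_subspace_image[OF lin\<sigma> S(1)])
    show "?W \<subseteq> ?\<sigma> ` S" using sub sub2 by blast
    show "dim (?\<sigma> ` S) \<le> dim ?W" using dim_image_le[OF lin\<sigma>, of S] fund_dim_ge[OF comp emb] S(2) by simp
  qed
  then show "tangent_space_of A ?L q = ?W" using sub sub2 by blast
  show "dim ?W = k"
    using fund_dim_ge[OF comp emb] dim_image_le[OF lin\<sigma>, of S] S(2) \<open>?W = ?\<sigma> ` S\<close> by simp
qed

end


section \<open>Second fundamental form of Lagrangian orbits\<close>

locale inner_form =
  fixes \<beta> :: "'e::euclidean_space \<Rightarrow> 'e \<Rightarrow> real"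
  assumes bil: "bilinear \<beta>" and sym: "\<beta> u v = \<beta> v u" and pos: "u \<noteq> 0 \<Longrightarrow> \<beta> u u > 0"
begin

lemma lin: "linear (\<beta> u)" "linear (\<lambda>u. \<beta> u v)"
  using bil by (simp_all add: bilinear_def)

lemma simps:
  "\<beta> (u + u') v = \<beta> u v + \<beta> u' v" "\<beta> u (v + v') = \<beta> u v + \<beta> u v'"
  "\<beta> (u - u') v = \<beta> u v - \<beta> u' v" "\<beta> u (v - v') = \<beta> u v - \<beta> u v'"
  "\<beta> (r *\<^sub>R u) v = r * \<beta> u v" "\<beta> u (r *\<^sub>R v) = r * \<beta> u v"
  "\<beta> (\<Sum>i\<in>I. f i) v = (\<Sum>i\<in>I. \<beta> (f i) v)" "\<beta> u (\<Sum>i\<in>I. f i) = (\<Sum>i\<in>I. \<beta> u (f i))"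
  "\<beta> 0 v = 0" "\<beta> u 0 = 0"
  using lin by (simp_all add: linear_add[OF lin(1)] linear_add[OF lin(2)] linear_diff[OF lin(1)] linear_diff[OF lin(2)]
    linear_scale[OF lin(1)] linear_scale[OF lin(2)] linear_sum[OF lin(1)] linear_sum[OF lin(2)] linear_0[OF lin(1)] linear_0[OF lin(2)])

lemma sum_orthonormal:
  assumes "orthonormal_basis \<beta> T E" "e \<in> E"
  shows "\<beta> (\<Sum>f\<in>E. c f *\<^sub>R f) e = c e"
proof -
  have "\<beta> (\<Sum>f\<in>E. c f *\<^sub>R f) e = (\<Sum>f\<in>E. if f = e then c f else 0)"
    using assms unfolding simps by (intro sum.cong) (auto simp: orthonormal_basis_def)
  then show ?thesis using assms by (simp add: orthonormal_basis_def)
qed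

lemma zero_on_span:
  assumes "\<And>e. e \<in> E \<Longrightarrow> \<beta> y e = 0" "z \<in> span E"
  shows "\<beta> y z = 0"
  by (rule linear_eq_0_on_span[OF lin(1) _ assms(2)]) (rule assms(1))

lemma zero_if_orthogonal:
  assumes "\<And>e. e \<in> E \<Longrightarrow> \<beta> y e = 0" "y \<in> span E"
  shows "y = 0"
  using zero_on_span[OF assms] pos[of y] by (metis less_irrefl)

lemma projection_orthogonal:
  assumes "orthonormal_basis \<beta> T E" "t \<in> T"
  shows "\<beta> (w - (\<Sum>e\<in>E. \<beta> w e *\<^sub>R e)) t = 0"
proof (rule zero_on_span)
  show "t \<in> span E" using assms by (simp add: orthonormal_basis_def)
  show "\<beta> (w - (\<Sum>e\<in>E. \<beta> w e *\<^sub>R e)) e = 0" if "e \<in> E" for e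
    by (simp add: simps(3) sum_orthonormal[OF assms(1) that])
qed

lemma projection_in:
  assumes "orthonormal_basis \<beta> T E"
  shows "(\<Sum>e\<in>E. \<beta> w e *\<^sub>R e) \<in> T"
proof -
  have "(\<Sum>e\<in>E. \<beta> w e *\<^sub>R e) \<in> span E" by (intro span_sum span_scale span_base)
  then show ?thesis using assms by (simp add: orthonormal_basis_def)
qed

lemma expansion:
  assumes "orthonormal_basis \<beta> T E" "w \<in> T"
  shows "w = (\<Sum>e\<in>E. \<beta> w e *\<^sub>R e)"
proof -
  have T: "span E = T" using assms by (simp add: orthonormal_basis_def)
  have "w - (\<Sum>e\<in>E. \<beta> w e *\<^sub>R e) = 0"
  proof (rule zero_if_orthogonal)
    show "w - (\<Sum>e\<in>E. \<beta> w e *\<^sub>R e) \<in> span E"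
      using assms(2) projection_in[OF assms(1)] unfolding T[symmetric] by (rule span_diff)
    show "\<beta> (w - (\<Sum>e\<in>E. \<beta> w e *\<^sub>R e)) e = 0" if "e \<in> E" for e
      using projection_orthogonal[OF assms(1)] span_base[OF that] T by blast
  qed
  then show ?thesis by simp
qed

text \<open>Gram-Schmidt, by induction on the spanning set; \<open>y = 0\<close> is the case of a
  vector that adds nothing to the span.\<close>

lemma orthonormal_basis_span:
  assumes "finite S"
  shows "\<exists>E. orthonormal_basis \<beta> (span S) E"
  using assms
proof (induction S rule: finite_induct)
  case empty
  show ?case by (rule exI[of _ "{}"]) (simp add: orthonormal_basis_def)
next
  case (insert x S)
  then obtain E where E: "orthonormal_basis \<beta> (span S) E" by blast
  define y where "y = x - (\<Sum>e\<in>E. \<beta> x e *\<^sub>R e)"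
  have pS: "(\<Sum>e\<in>E. \<beta> x e *\<^sub>R e) \<in> span S" by (rule projection_in[OF E])
  have sp: "span (insert x S) = span (insert y S)"
  proof -
    let ?p = "\<Sum>e\<in>E. \<beta> x e *\<^sub>R e"
    have p: "?p \<in> span (insert a S)" for a using pS span_mono[of S "insert a S"] by blast
    have "x \<in> span (insert y S)" "y \<in> span (insert x S)"
      using span_add[OF span_base[of y "insert y S"] p] span_diff[OF span_base[of x "insert x S"] p]
      by (simp_all add: y_def)
    then show ?thesis
      by (intro subset_antisym span_minimal subspace_span) (auto intro: span_base)
  qed
  show ?case
  proof (cases "y = 0")
    case True
    then show ?thesis unfolding sp using E by (auto simp: span_insert_0)
  next
    case False
    define z where "z = (1 / sqrt (\<beta> y y)) *\<^sub>R y"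
    have yy: "\<beta> y y > 0" by (rule pos[OF False])
    have ye: "\<beta> y e = 0" if "e \<in> E" for e
      unfolding y_def using projection_orthogonal[OF E] that E span_base[of e E]
      by (simp add: orthonormal_basis_def)
    have zz: "\<beta> z z = 1" unfolding z_def simps using yy by (simp add: field_simps)
    have ze: "\<beta> z e = 0" "\<beta> e z = 0" if "e \<in> E" for e
      using ye[OF that] sym[of e] by (simp_all add: z_def simps)
    have zE: "z \<notin> E" using zz ze by force
    have "span (insert z E) = span (insert y S)"
    proof -
      have ES: "span E = span S" using E by (simp add: orthonormal_basis_def)
      have yz: "y = sqrt (\<beta> y y) *\<^sub>R z" unfolding z_def using yy by simp
      have "z \<in> span (insert y S)" unfolding z_def by (intro span_scale span_base) simp
      moreover have "y \<in> span (insert z E)" by (subst yz, intro span_scale span_base) simp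
      moreover have "E \<subseteq> span (insert y S)" "S \<subseteq> span (insert z E)"
        using span_superset[of E] span_superset[of S] span_mono[of S "insert y S"] span_mono[of E "insert z E"]
        unfolding ES by blast+
      ultimately show ?thesis
        by (intro subset_antisym span_minimal subspace_span) auto
    qed
    then have "orthonormal_basis \<beta> (span (insert x S)) (insert z E)"
      unfolding sp using E zz ze zE by (auto simp: orthonormal_basis_def)
    then show ?thesis by blast
  qed
qed

lemma orthonormal_basis_exists:
  assumes "subspace T"
  shows "\<exists>E. orthonormal_basis \<beta> T E"
proof -
  obtain S where S: "S \<subseteq> T" "independent S" "T \<subseteq> span S"
    by (rule basis_exists)
  have "span S = T" using span_minimal[OF S(1) assms] S(3) by blast
  then show ?thesis using orthonormal_basis_span[OF independent_imp_finite[OF S(2)]] by simp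
qed

text \<open>The projection built from an orthonormal basis witnesses the definite description; two
  candidates differ by a vector of \<open>T\<close> that is orthogonal to \<open>T\<close>.\<close>

lemma normal_part:
  assumes "subspace T"
  shows "w - normal_part \<beta> T w \<in> T" "\<And>t. t \<in> T \<Longrightarrow> \<beta> (normal_part \<beta> T w) t = 0"
proof -
  obtain E where E: "orthonormal_basis \<beta> T E" using orthonormal_basis_exists[OF assms] by blast
  let ?z = "w - (\<Sum>e\<in>E. \<beta> w e *\<^sub>R e)"
  have z: "w - ?z \<in> T" "\<forall>t\<in>T. \<beta> ?z t = 0"
    using projection_in[OF E] projection_orthogonal[OF E] by auto
  have "normal_part \<beta> T w = ?z" unfolding normal_part_def
  proof (rule the_equality)
    fix z assume a: "w - z \<in> T \<and> (\<forall>t\<in>T. \<beta> z t = 0)"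
    have "?z - z = (w - z) - (w - ?z)" by simp
    then have "?z - z \<in> T" using subspace_diff[OF assms, of "w - z" "w - ?z"] a z(1) by metis
    then have "\<beta> (?z - z) (?z - z) = 0" using a z(2) unfolding simps(3) by simp
    then show "z = ?z" using pos[of "?z - z"] by (metis eq_iff_diff_eq_0 less_irrefl)
  qed (use z in blast)
  then show "w - normal_part \<beta> T w \<in> T" "\<And>t. t \<in> T \<Longrightarrow> \<beta> (normal_part \<beta> T w) t = 0"
    using z by auto
qed

text \<open>Expand the Euclidean basis vectors in \<open>F\<close>, exchange the sums and collect
  the Euclidean expansion of \<open>L f\<close>.\<close>

lemma tr_orthonormal:
  assumes F: "orthonormal_basis \<beta> UNIV F" and L: "linear L"
  shows "tr L = (\<Sum>f\<in>F. \<beta> (L f) f)"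
proof -
  have "tr L = (\<Sum>b\<in>Basis. (\<Sum>f\<in>F. \<beta> b f * (L f \<bullet> b)))"
    unfolding tr_def
  proof (rule sum.cong[OF refl])
    fix b :: 'e
    have "L b = L (\<Sum>f\<in>F. \<beta> b f *\<^sub>R f)" using expansion[OF F, of b] by simp
    then show "L b \<bullet> b = (\<Sum>f\<in>F. \<beta> b f * (L f \<bullet> b))"
      by (simp add: linear_sum[OF L] linear_scale[OF L] inner_sum_left)
  qed
  also have "\<dots> = (\<Sum>f\<in>F. \<Sum>b\<in>Basis. \<beta> b f * (L f \<bullet> b))" by (rule sum.swap)
  also have "\<dots> = (\<Sum>f\<in>F. \<beta> (L f) f)"
  proof (rule sum.cong[OF refl])
    fix f
    show "(\<Sum>b\<in>Basis. \<beta> b f * (L f \<bullet> b)) = \<beta> (L f) f"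
      using linear_basis_expansion[OF lin(2)[of f], of "L f"] by (simp add: mult.commute)
  qed
  finally show ?thesis .
qed

lemma orthonormal_independent:
  assumes E: "orthonormal_basis \<beta> T E"
  shows "independent E"
proof
  assume "dependent E"
  then obtain a where a: "a \<in> E" "a \<in> span (E - {a})" by (auto simp: dependent_def)
  have "\<beta> a a = 0"
    by (rule zero_on_span[OF _ a(2)]) (use E a in \<open>auto simp: orthonormal_basis_def\<close>)
  then show False using E a by (simp add: orthonormal_basis_def)
qed

end

text \<open>The Lagrangian condition makes \<open>E\<close> orthogonal to its multiple by \<i>, and
  the union has as many elements as the real dimension of the space.\<close>

lemma lagrangian_orthonormal_basis:
  fixes \<beta> :: "complex ^ 'n \<Rightarrow> complex ^ 'n \<Rightarrow> real"
  assumes "inner_form \<beta>" and J: "\<And>u v. \<beta> (\<i> *s u) (\<i> *s v) = \<beta> u v"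
    and T: "dim T = CARD('n)" and lag: "\<And>u v. u \<in> T \<Longrightarrow> v \<in> T \<Longrightarrow> \<beta> (\<i> *s u) v = 0"
    and E: "orthonormal_basis \<beta> T E"
  shows "orthonormal_basis \<beta> UNIV (E \<union> (*s) \<i> ` E)" "E \<inter> (*s) \<i> ` E = {}" "inj_on ((*s) \<i>) E"
proof -
  interpret inner_form \<beta> by (rule assms(1))
  have ET: "e \<in> T" if "e \<in> E" for e using that E span_base by (auto simp: orthonormal_basis_def)
  show inj: "inj_on ((*s) \<i>) E" by (auto simp: inj_on_def vec_eq_iff)
  have l2: "\<beta> v (\<i> *s u) = 0" if "u \<in> T" "v \<in> T" for u v using lag[OF that] sym by metis
  show disj: "E \<inter> (*s) \<i> ` E = {}"
  proof (rule ccontr)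
    assume "E \<inter> (*s) \<i> ` E \<noteq> {}"
    then obtain e where e: "e \<in> E" "\<i> *s e \<in> E" by blast
    then have "\<beta> (\<i> *s e) (\<i> *s e) = 0" using lag ET by blast
    then show False using e E by (simp add: orthonormal_basis_def)
  qed
  have fin: "finite E" and on: "\<And>u v. u \<in> E \<Longrightarrow> v \<in> E \<Longrightarrow> \<beta> u v = (if u = v then 1 else 0)"
    using E by (auto simp: orthonormal_basis_def)
  have onF: "\<beta> u v = (if u = v then 1 else 0)" if "u \<in> E \<union> (*s) \<i> ` E" "v \<in> E \<union> (*s) \<i> ` E" for u v
    using that disj inj on lag[OF ET ET] l2[OF ET ET] by (auto simp: J inj_on_def)
  then have F: "orthonormal_basis \<beta> (span (E \<union> (*s) \<i> ` E)) (E \<union> (*s) \<i> ` E)"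
    using fin by (simp add: orthonormal_basis_def)
  have "card E = CARD('n)"
    using E T dim_span_eq_card_independent[OF orthonormal_independent[OF E]] by (simp add: orthonormal_basis_def)
  then have "card (E \<union> (*s) \<i> ` E) = DIM(complex ^ 'n)"
    using fin disj by (simp add: card_Un_disjoint card_image[OF inj])
  then have "span (E \<union> (*s) \<i> ` E) = UNIV"
    using orthonormal_independent[OF F] by (metis dim_eq_full dim_span_eq_card_independent dim_span)
  then show "orthonormal_basis \<beta> UNIV (E \<union> (*s) \<i> ` E)" using F by simp
qed

section \<open>Geometry of a Lagrangian orbit\<close>

context kaehler_action
begin

lemma inner_form_g: "inner_form (g q)"
  using metric by (simp add: riemannian_metric_def inner_form_def)

lemma g_i: "g q (\<i> *s u) (\<i> *s v) = g q u v"
  using K by (simp add: kaehler_manifold_def)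

context
  fixes L :: "'m set" and p :: 'm
  assumes L: "L = orbit act p" and lag: "lagrangian_submanifold A g L"
    and comp: "compact (UNIV :: 'k set)"
begin

lemma orbit_L: "r \<in> L \<Longrightarrow> orbit act r = L"
  using L orbit_eq by blast

lemma tangent_L:
  assumes "r \<in> L"
  shows "tangent_space_of A L r = range (\<lambda>X. fund X r)" "dim (tangent_space_of A L r) = CARD('n)"
    "subspace (tangent_space_of A L r)"
proof -
  have e: "embedded_submanifold A CARD('n) (orbit act r)"
    using lag orbit_L[OF assms] by (simp add: lagrangian_submanifold_def)
  show 1: "tangent_space_of A L r = range (\<lambda>X. fund X r)"
    using orbit_tangent_space(1)[OF comp e] orbit_L[OF assms] by simp
  show "dim (tangent_space_of A L r) = CARD('n)"
    unfolding 1 by (rule orbit_tangent_space(2)[OF comp e])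
  show "subspace (tangent_space_of A L r)"
    unfolding 1 by (rule linear_subspace_image[OF fund_linear subspace_UNIV])
qed

lemma lag_L:
  assumes "r \<in> L" "u \<in> tangent_space_of A L r" "v \<in> tangent_space_of A L r"
  shows "g r (\<i> *s u) v = 0"
  using lag assms unfolding lagrangian_submanifold_def kaehler_form_def by blast

text \<open>Differentiate \<open>g(V, JY\<^sup>*) = 0\<close>, which holds along \<open>L\<close>, in the direction \<open>u\<close>.\<close>

lemma cov_deriv_normal_component:
  assumes q: "q \<in> L" and W: "open W" "q \<in> W" and V: "smooth_field_on A W V"
    and VT: "\<And>r. r \<in> L \<inter> W \<Longrightarrow> V r \<in> tangent_space_of A L r" and u: "u \<in> tangent_space_of A L q"
  shows "g q (cov_deriv A g V q u) (\<i> *s fund Y q) = - g q (V q) (\<i> *s nabla Y q u)"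
proof -
  let ?c = "chart_at A q" and ?x = "cmap (chart_at A q) q"
  interpret loc: local_kaehler "cim ?c" "form_comp A ?c g" "(*s) \<i>" by (rule loc_kaehler)
  note cA = chart_p[of q]
  note isc = atlas_chart[OF atlas_A cA(1)]
  let ?V = "field_comp A ?c V" and ?\<xi> = "xi ?c Y"
  have Vd: "?V differentiable (at ?x)"
    using V cA W(2) unfolding smooth_field_on_def
    by (intro smooth_on_differentiable[of "cmap ?c ` (cdom ?c \<inter> W)"]) auto
  have \<xi>d: "?\<xi> differentiable (at ?x)" by (rule loc.killing_differentiable[OF xi_killing[OF cA(1)] cA(3)])
  have i\<xi>: "((\<lambda>z. \<i> *s ?\<xi> z) has_derivative (\<lambda>u. \<i> *s Dr ?\<xi> ?x u)) (at ?x)"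
    by (rule bounded_linear.has_derivative[OF loc.bounded_linear_J Dr_works[OF \<xi>d]])
  let ?h = "\<lambda>z. form_comp A ?c g z (?V z) (\<i> *s ?\<xi> z)"
  have hd: "(?h has_derivative (\<lambda>u. form_comp A ?c g ?x (loc.nab ?V ?x u) (\<i> *s ?\<xi> ?x) +
      form_comp A ?c g ?x (?V ?x) (loc.nab (\<lambda>z. \<i> *s ?\<xi> z) ?x u))) (at ?x)"
    by (rule loc.G_product[OF cA(3) Vd differentiableI[OF i\<xi>]])
  \<comment> \<open>\<open>J\<close> is parallel and has constant components in the chart.\<close>
  have nabi: "loc.nab (\<lambda>z. \<i> *s ?\<xi> z) ?x u = \<i> *s nabla Y q u"
    by (simp add: loc.nab_def Dr_eq[OF i\<xi>] loc.Gam_J[OF cA(3)] nabla_nab loc.J_add)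
  have Vx: "?V ?x = V q"
    by (simp add: field_comp_coord cA coord_chart_at[OF atlas_A])
  have nabV: "loc.nab ?V ?x u = cov_deriv A g V q u"
    by (simp add: loc.nab_def cov_deriv_eq Vx)
  obtain \<gamma> :: "real \<Rightarrow> _" where cont: "isCont \<gamma> 0" and \<gamma>0: "\<gamma> 0 = q" and ev2: "eventually (\<lambda>t. \<gamma> t \<in> L) (nhds 0)"
    and yd: "(\<lambda>t. cmap ?c (\<gamma> t)) differentiable (at 0)" and yu: "Dr (\<lambda>t. cmap ?c (\<gamma> t)) 0 1 = u"
    by (rule tangent_vectorE[OF atlas_A u])
  let ?y = "\<lambda>t. cmap ?c (\<gamma> t)"
  have ev1: "eventually (\<lambda>t. \<gamma> t \<in> cdom ?c \<inter> W) (nhds 0)"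
    by (rule eventually_in_open[OF cont open_Int[OF chart_open(1)[OF isc] W(1)]]) (simp add: \<gamma>0 cA W)
  \<comment> \<open>The pairing vanishes on \<open>L\<close> only, so it is differentiated along a
    curve in \<open>L\<close> with velocity \<open>u\<close>.\<close>
  have ev: "eventually (\<lambda>t. ?h (?y t) = 0) (nhds 0)"
    using ev1 ev2
  proof eventually_elim
    case (elim t)
    let ?r = "\<gamma> t"
    have r: "?r \<in> cdom ?c" "?r \<in> L" "?r \<in> L \<inter> W" using elim by auto
    have z: "?y t \<in> cim ?c" "cinv ?c (?y t) = ?r" using r by (auto simp: chart_inverse[OF isc])
    have 1: "chart_vec A ?c (?y t) (?V (?y t)) = V ?r"
      using chart_vec_field_comp[OF atlas_A cA(1) z(1)] z(2) by simp
    have 2: "chart_vec A ?c (?y t) (\<i> *s ?\<xi> (?y t)) = \<i> *s fund Y ?r"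
      using chart_vec_field_comp[OF atlas_A cA(1) z(1), of "fund Y"] z
      by (simp add: chart_vec_i[OF complex_A cA(1) z(1)] field_comp_fund[OF cA(1) z(1)])
    have "?h (?y t) = g ?r (V ?r) (\<i> *s fund Y ?r)"
      unfolding form_comp_def 1 2 z(2) ..
    also have "\<dots> = g ?r (\<i> *s fund Y ?r) (V ?r)" using metric by (simp add: riemannian_metric_def)
    also have "\<dots> = 0"
      by (rule lag_L[OF r(2) _ VT[OF r(3)]]) (simp add: tangent_L(1)[OF r(2)])
    finally show ?case .
  qed
  have "((\<lambda>t. ?h (?y t)) has_derivative (\<lambda>k. g q (loc.nab ?V ?x (Dr ?y 0 k)) (\<i> *s fund Y q) +
      g q (V q) (loc.nab (\<lambda>z. \<i> *s ?\<xi> z) ?x (Dr ?y 0 k)))) (at 0)"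
    using diff_chain_at[OF Dr_works[OF yd], of ?h] hd by (simp add: o_def \<gamma>0 form_comp_p xi_p Vx)
  moreover have "((\<lambda>t. ?h (?y t)) has_derivative (\<lambda>k. 0)) (at 0)"
    by (rule has_derivative_cong_ev[OF has_derivative_const ev])
  ultimately have "(\<lambda>k. g q (loc.nab ?V ?x (Dr ?y 0 k)) (\<i> *s fund Y q) +
      g q (V q) (loc.nab (\<lambda>z. \<i> *s ?\<xi> z) ?x (Dr ?y 0 k))) = (\<lambda>k. 0)"
    by (rule has_derivative_unique)
  from fun_cong[OF this, of 1] show ?thesis by (simp add: yu nabV nabi)
qed

text \<open>A Lagrangian tangent space and its image under J span everything. This serves both the
  uniqueness behind \<open>second_fundamental_form\<close> and the vanishing of the mean
  curvature.\<close>

lemma normal_determined: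
  assumes q: "q \<in> L" and T: "\<And>t. t \<in> tangent_space_of A L q \<Longrightarrow> g q w t = 0"
    and N: "\<And>Y. g q w (\<i> *s fund Y q) = 0"
  shows "w = 0"
proof -
  interpret inner_form "g q" by (rule inner_form_g)
  obtain E where E: "orthonormal_basis (g q) (tangent_space_of A L q) E"
    using orthonormal_basis_exists[OF tangent_L(3)[OF q]] by blast
  have F: "orthonormal_basis (g q) UNIV (E \<union> (*s) \<i> ` E)"
    by (rule lagrangian_orthonormal_basis(1)[OF inner_form_g g_i tangent_L(2)[OF q] lag_L[OF q] E])
  have ET: "e \<in> tangent_space_of A L q" if "e \<in> E" for e
    using that E span_base by (auto simp: orthonormal_basis_def)
  show ?thesis
  proof (rule zero_if_orthogonal)
    show "w \<in> span (E \<union> (*s) \<i> ` E)" using F by (simp add: orthonormal_basis_def)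
    fix f assume "f \<in> E \<union> (*s) \<i> ` E"
    then show "g q w f = 0"
      using T ET N tangent_L(1)[OF q] by auto
  qed
qed

text \<open>All admissible extensions give the same pairings with tangent vectors and with J
  \<open>Y\<^sup>*\<close>, so the definite description is unique. It is inhabited because
  \<open>v\<close> is the value of a fundamental field, which is tangent to \<open>L\<close>
  everywhere.\<close>

lemma second_fundamental_form_L:
  assumes q: "q \<in> L" and u: "u \<in> tangent_space_of A L q" and v: "v \<in> tangent_space_of A L q"
  shows "\<And>t. t \<in> tangent_space_of A L q \<Longrightarrow> g q (second_fundamental_form A g L q u v) t = 0"
    and "g q (second_fundamental_form A g L q u v) (\<i> *s fund Y q) = - g q v (\<i> *s nabla Y q u)"
proof -
  interpret inner_form "g q" by (rule inner_form_g)
  let ?T = "tangent_space_of A L q"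
  let ?Q = "\<lambda>w. \<exists>W V. open W \<and> q \<in> W \<and> smooth_field_on A W V \<and>
     (\<forall>r\<in>L \<inter> W. V r \<in> tangent_space_of A L r) \<and> V q = v \<and>
     w = normal_part (g q) ?T (cov_deriv A g V q u)"
  have Q: "(\<forall>t\<in>?T. g q w t = 0) \<and> (\<forall>Y. g q w (\<i> *s fund Y q) = - g q v (\<i> *s nabla Y q u))" if "?Q w" for w
    using that
  proof (elim exE conjE)
    fix W V assume W: "open W" "q \<in> W" "smooth_field_on A W V"
      "\<forall>r\<in>L \<inter> W. V r \<in> tangent_space_of A L r" "V q = v"
      and w: "w = normal_part (g q) ?T (cov_deriv A g V q u)"
    note np = normal_part[OF tangent_L(3)[OF q], where w = "cov_deriv A g V q u", folded w]
    have "g q w (\<i> *s fund Y q) = - g q v (\<i> *s nabla Y q u)" for Y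
    proof -
      \<comment> \<open>The tangential part of the covariant derivative is orthogonal to J
        \<open>Y\<^sup>*\<close> because \<open>L\<close> is Lagrangian.\<close>
      have "g q (\<i> *s fund Y q) (cov_deriv A g V q u - w) = 0"
        by (rule lag_L[OF q _ np(1)]) (simp add: tangent_L(1)[OF q])
      then have "g q w (\<i> *s fund Y q) = g q (cov_deriv A g V q u) (\<i> *s fund Y q)"
        using sym[of "\<i> *s fund Y q"] by (simp add: simps(3))
      then show ?thesis
        using cov_deriv_normal_component[OF q W(1-3) _ u, of Y] W(4,5) by simp
    qed
    then show "(\<forall>t\<in>?T. g q w t = 0) \<and> (\<forall>Y. g q w (\<i> *s fund Y q) = - g q v (\<i> *s nabla Y q u))"
      using np(2) by simp
  qed
  have uniq: "w = w'" if "?Q w" "?Q w'" for w w'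
  proof -
    note Q1 = Q[OF that(1)] and Q2 = Q[OF that(2)]
    have "w - w' = 0"
    proof (rule normal_determined[OF q])
      show "g q (w - w') t = 0" if "t \<in> ?T" for t using Q1 Q2 that unfolding simps(3) by simp
      show "g q (w - w') (\<i> *s fund Y q) = 0" for Y using Q1 Q2 unfolding simps(3) by simp
    qed
    then show ?thesis by simp
  qed
  obtain X where X: "v = fund X q" using v tangent_L(1)[OF q] by auto
  have ex: "?Q (normal_part (g q) ?T (cov_deriv A g (fund X) q u))"
  proof (intro exI conjI)
    show "open (UNIV :: 'm set)" "q \<in> UNIV" by auto
    show "smooth_field_on A UNIV (fund X)"
      unfolding smooth_field_on_def
    proof
      fix c assume c: "c \<in> A"
      have "smooth_on (cim c) (field_comp A c (fund X))"
        by (rule smooth_on_cong[THEN iffD2, OF chart_open(2)[OF atlas_chart[OF atlas_A c]] field_comp_fund[OF c] xi_smooth[OF c]])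
      then show "smooth_on (cmap c ` (cdom c \<inter> UNIV)) (field_comp A c (fund X))" by simp
    qed
    show "\<forall>r\<in>L \<inter> UNIV. fund X r \<in> tangent_space_of A L r" using tangent_L(1) by auto
  qed (rule X[symmetric], rule refl)
  have "?Q (second_fundamental_form A g L q u v)"
    unfolding second_fundamental_form_def by (rule theI[of ?Q, OF ex uniq[OF _ ex]])
  from Q[OF this] show "\<And>t. t \<in> ?T \<Longrightarrow> g q (second_fundamental_form A g L q u v) t = 0"
    "g q (second_fundamental_form A g L q u v) (\<i> *s fund Y q) = - g q v (\<i> *s nabla Y q u)"
    by blast+
qed

lemma mean_curvature_L:
  assumes q: "q \<in> L" and tr0: "\<And>Y. tr (\<lambda>w. \<i> *s nabla Y q w) = 0"
  shows "mean_curvature A g L q = 0"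
proof -
  interpret inner_form "g q" by (rule inner_form_g)
  let ?T = "tangent_space_of A L q"
  define E where "E = (SOME E. orthonormal_basis (g q) ?T E)"
  have E: "orthonormal_basis (g q) ?T E"
    unfolding E_def by (rule someI_ex[OF orthonormal_basis_exists[OF tangent_L(3)[OF q]]])
  have ET: "e \<in> ?T" if "e \<in> E" for e
    using that E span_base by (auto simp: orthonormal_basis_def)
  note F = lagrangian_orthonormal_basis[OF inner_form_g g_i tangent_L(2)[OF q] lag_L[OF q] E]
  have fin: "finite E" using E by (simp add: orthonormal_basis_def)
  let ?II = "second_fundamental_form A g L q"
  have H: "mean_curvature A g L q = (\<Sum>e\<in>E. ?II e e)" by (simp add: mean_curvature_def E_def)
  show ?thesis
  proof (rule normal_determined[OF q])
    show "g q (mean_curvature A g L q) t = 0" if "t \<in> ?T" for t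
      unfolding H simps by (rule sum.neutral) (use second_fundamental_form_L(1)[OF q] ET that in blast)
    fix Y
    let ?S = "\<lambda>w. \<i> *s nabla Y q w"
    have S: "linear ?S" using linear_compose[OF nabla_linear linear_i] by (simp add: o_def)
    have "0 = (\<Sum>f\<in>E \<union> (*s) \<i> ` E. g q (?S f) f)"
      using tr_orthonormal[OF F(1) S] tr0[of Y] by simp
    also have "\<dots> = (\<Sum>e\<in>E. g q (?S e) e) + (\<Sum>e\<in>E. g q (?S (\<i> *s e)) (\<i> *s e))"
      using fin F(2,3) by (simp add: sum.union_disjoint sum.reindex o_def)
    \<comment> \<open>J is an isometry commuting with \<open>nabla\<close>, so both halves of the
      trace agree and each is 0.\<close>
    also have "(\<Sum>e\<in>E. g q (?S (\<i> *s e)) (\<i> *s e)) = (\<Sum>e\<in>E. g q (?S e) e)"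
      by (simp only: nabla_i g_i)
    finally have "(\<Sum>e\<in>E. g q (?S e) e) = 0" by simp
    moreover have "g q (mean_curvature A g L q) (\<i> *s fund Y q) = - (\<Sum>e\<in>E. g q (?S e) e)"
      unfolding H simps sum_negf[symmetric]
    proof (rule sum.cong[OF refl])
      fix e assume "e \<in> E"
      then show "g q (?II e e) (\<i> *s fund Y q) = - g q (?S e) e"
        using second_fundamental_form_L(2)[OF q ET ET] sym[of e] by simp
    qed
    ultimately show "g q (mean_curvature A g L q) (\<i> *s fund Y q) = 0" by simp
  qed
qed

end

end

theorem proposition3:
  fixes A :: "('m::{t2_space, second_countable_topology}, complex ^ 'n) chart set"
    and g :: "'m \<Rightarrow> complex ^ 'n \<Rightarrow> complex ^ 'n \<Rightarrow> real"
    and B :: "('k::{t2_space, second_countable_topology}, 'f::euclidean_space) chart set"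
    and mul :: "'k \<Rightarrow> 'k \<Rightarrow> 'k" and e :: 'k and iv :: "'k \<Rightarrow> 'k"
    and act :: "'k \<Rightarrow> 'm \<Rightarrow> 'm" and p :: 'm
  assumes "compact (UNIV :: 'm set)"
    and "kaehler_manifold A g"
    and "einstein_metric A g"
    and "lie_group B mul e iv"
    and "compact (UNIV :: 'k set)"
    and "connected (UNIV :: 'k set)"
    and "semisimple_lie_algebra (lie_bracket B mul e)"
    and "isometric_action B mul e A g act"
    and "hamiltonian_action B mul e iv A (kaehler_form g) act"
    and "lagrangian_submanifold A g (orbit act p)"
  shows "minimal_submanifold A g (orbit act p)"
proof -
  interpret kaehler_action B mul e iv A g act
    by unfold_locales (use assms in auto)
  note L = refl assms(10) assms(5)
  have "mean_curvature A g (orbit act p) q = 0" if q: "q \<in> orbit act p" for q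
  proof (rule mean_curvature_L[OF L q])
    have "\<omega> q (fund X q) (fund Y q) = 0" for X Y
      using lag_L[OF L q] tangent_L(1)[OF L q] by (simp add: kaehler_form_def)
    then show "tr (\<lambda>w. \<i> *s nabla Y q w) = 0" for Y
      by (rule trace_nabla_zero[OF assms(5,6,7,3)])
  qed
  then show ?thesis
    using assms(10) unfolding minimal_submanifold_def lagrangian_submanifold_def by blast
qed

end
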